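(* There does not exist a $[\![7,1,4]\!]_4$ stabiliser code.
   Context: Let $q=4$, let $\{|x\rangle : x\in\mathbb{F}_4\}$ be an orthonormal basis of $\mathbb{C}^4$ and let $\mathrm{tr}:\mathbb{F}_4\to\mathbb{F}_2$, $x\mapsto x+x^2$. For $a,b\in\mathbb{F}_4$ let $X(a)|x\rangle=|x+a\rangle$ and $Z(b)|x\rangle=(-1)^{\mathrm{tr}(bx)}|x\rangle$. The Pauli group $\mathcal{P}_n$ on $(\mathbb{C}^4)^{\otimes n}$ consists of the operators $cX(a_1)Z(b_1)\otimes\cdots\otimes X(a_n)Z(b_n)$ with $a_j,b_j\in\mathbb{F}_4$, $c\in\{\pm1,\pm i\}$; the weight of such an operator is the number of $j$ with $(a_j,b_j)\ne(0,0)$. A stabiliser code is a nonzero subspace $\mathcal{Q}=\{|x\rangle : E|x\rangle=|x\rangle\ \forall E\in\mathcal{S}\}$ for a subgroup $\mathcal{S}\le\mathcal{P}_n$, where $\mathcal{S}$ is assumed to equal $\{E\in\mathcal{P}_n: E|x\rangle=|x\rangle\ \forall |x\rangle\in\mathcal{Q}\}$. Let $\mathcal{N}(\mathcal{S})=\{E\in\mathcal{P}_n:E\mathcal{S}E^\dagger=\mathcal{S}\}$ and $[\mathcal{S}]=\{cE: c\in\{\pm1,\pm i\},E\in\mathcal{S}\}$. The minimum distance $d$ of $\mathcal{Q}$ is the minimum nonzero weight of the elements of $\mathcal{S}$ if $|\mathcal{S}|=q^n$, and the minimum nonzero weight of the elements of $\mathcal{N}(\mathcal{S})\setminus[\mathcal{S}]$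 otherwise. With $k=\log_q(\dim\mathcal{Q})$, $\mathcal{Q}$ is called an $[\![n,k,d]\!]_q$ code. *)

theory Defs
  imports "HOL-Analysis.Analysis" "HOL-Algebra.Group"
begin

text \<open>
  The field with four elements is a type \<open>'f\<close> of sort \<open>{field, finite}\<close> with \<open>CARD('f) = 4\<close>, and
  the positions \<open>1, ..., n\<close> are the elements of a finite type \<open>'n\<close>. The product vectors \<open>|x\<rangle>\<close>, for
  \<open>x\<close> in \<open>'f ^ 'n\<close>, are an orthonormal basis of the \<open>n\<close>-fold tensor power of \<open>\<complex>\<^sup>4\<close>. So this space
  is \<open>complex ^ ('f ^ 'n)\<close>, and its operators are the complex matrices with rows and columns indexed
  by \<open>'f ^ 'n\<close>.
\<close>

type_synonym 'i sqmat = "complex ^ 'i ^ 'i"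
type_synonym ('f, 'n) word = "'f ^ 'n"
type_synonym ('f, 'n) state = "complex ^ ('f ^ 'n)"
type_synonym ('f, 'n) oper = "complex ^ ('f ^ 'n) ^ ('f ^ 'n)"

definition ket :: "'i \<Rightarrow> complex ^ 'i" where
  "ket x = axis x 1"

text \<open>The trace to the prime field, whose elements are the elements 0 and 1 of \<open>'f\<close>.\<close>

definition tr :: "'f::field \<Rightarrow> 'f" where
  "tr x = x + x\<^sup>2"

definition minus_one_power :: "'f::field \<Rightarrow> complex" where
  "minus_one_power t = (if t = 0 then 1 else -1)"

definition X_op :: "'f::{field,finite} \<Rightarrow> 'f sqmat" where
  "X_op a = (\<chi> x y. if x = y + a then 1 else 0)"

definition Z_op :: "'f::{field,finite} \<Rightarrow> 'f sqmat" where
  "Z_op b = (\<chi> x y. if x = y then minus_one_power (tr (b * y)) else 0)"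

lemma X_op_ket: "X_op a *v ket x = ket (x + a)"
  by (simp add: ket_def X_op_def matrix_vector_mult_def axis_def vec_eq_iff mult_delta_right)

lemma Z_op_ket: "Z_op b *v ket x = minus_one_power (tr (b * x)) *s ket x"
  by (simp add: ket_def Z_op_def matrix_vector_mult_def axis_def vec_eq_iff mult_delta_right)

definition tensor :: "('n \<Rightarrow> 'f sqmat) \<Rightarrow> ('f::finite, 'n::finite) oper" where
  "tensor A = (\<chi> x y. \<Prod>j\<in>UNIV. A j $ (x $ j) $ (y $ j))"

definition scale_op :: "complex \<Rightarrow> ('f::finite, 'n::finite) oper \<Rightarrow> ('f, 'n) oper" where
  "scale_op c A = (\<chi> x y. c * A $ x $ y)"

definition adjoint_op :: "('f::finite, 'n::finite) oper \<Rightarrow> ('f, 'n) oper" where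
  "adjoint_op A = (\<chi> x y. cnj (A $ y $ x))"

definition phases :: "complex set" where
  "phases = {1, -1, \<i>, -\<i>}"

definition pauli_op ::
  "complex \<Rightarrow> ('f, 'n) word \<Rightarrow> ('f, 'n) word \<Rightarrow> ('f::{field,finite}, 'n::finite) oper" where
  "pauli_op c a b = scale_op c (tensor (\<lambda>j. X_op (a $ j) ** Z_op (b $ j)))"

definition paulis :: "('f::{field,finite}, 'n::finite) oper set" where
  "paulis = {pauli_op c a b | c a b. c \<in> phases}"

definition pauli_group :: "('f::{field,finite}, 'n::finite) oper monoid" where
  "pauli_group = \<lparr>carrier = paulis, monoid.mult = (**), one = mat 1\<rparr>"

definition weight :: "('f::{field,finite}, 'n::finite) oper \<Rightarrow> nat" where
  "weight E = (THE w. \<exists>c\<in>phases. \<exists>a b. E = pauli_op c a b \<and>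
                 w = card {j. (a $ j, b $ j) \<noteq> (0, 0)})"

definition fixed_space :: "('f::finite, 'n::finite) oper set \<Rightarrow> ('f, 'n) state set" where
  "fixed_space S = {v. \<forall>E\<in>S. E *v v = v}"

definition fixing_paulis ::
  "('f::{field,finite}, 'n::finite) state set \<Rightarrow> ('f, 'n) oper set" where
  "fixing_paulis Q = {E \<in> paulis. \<forall>v\<in>Q. E *v v = v}"

definition is_stabiliser_of ::
  "('f::{field,finite}, 'n::finite) oper set \<Rightarrow> ('f, 'n) state set \<Rightarrow> bool" where
  "is_stabiliser_of S Q \<longleftrightarrow>
     subgroup S pauli_group \<and> Q = fixed_space S \<and> Q \<noteq> {0} \<and> S = fixing_paulis Q"

definition pauli_normaliser ::
  "('f::{field,finite}, 'n::finite) oper set \<Rightarrow> ('f, 'n) oper set" where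
  "pauli_normaliser S = {E \<in> paulis. (\<lambda>A. E ** A ** adjoint_op E) ` S = S}"

definition phase_closure :: "('f::finite, 'n::finite) oper set \<Rightarrow> ('f, 'n) oper set" where
  "phase_closure S = {scale_op c E | c E. c \<in> phases \<and> E \<in> S}"

text \<open>
  The minimum distance is a predicate, so that no value is assigned to it when there is no element
  of nonzero weight.
\<close>

definition is_min_nonzero_weight ::
  "('f::{field,finite}, 'n::finite) oper set \<Rightarrow> nat \<Rightarrow> bool" where
  "is_min_nonzero_weight T d \<longleftrightarrow>
     d \<in> {weight E | E. E \<in> T \<and> weight E \<noteq> 0} \<and>
     (\<forall>w\<in>{weight E | E. E \<in> T \<and> weight E \<noteq> 0}. d \<le> w)"

definition is_min_distance ::
  "('f::{field,finite}, 'n::finite) oper set \<Rightarrow> nat \<Rightarrow> bool" where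
  "is_min_distance S d \<longleftrightarrow>
     (if card S = CARD('f) ^ CARD('n) then is_min_nonzero_weight S d
      else is_min_nonzero_weight (pauli_normaliser S - phase_closure S) d)"

text \<open>
  \<open>vec.dim\<close> is the dimension over \<open>complex\<close>. The base of the logarithm is \<open>q = CARD('f)\<close>; the
  notion is the intended one only for \<open>q = 4\<close>, since \<open>tr\<close> is.
\<close>

definition is_stabiliser_code ::
  "('f::{field,finite}, 'n::finite) state set \<Rightarrow> nat \<Rightarrow> real \<Rightarrow> nat \<Rightarrow> bool" where
  "is_stabiliser_code Q n k d \<longleftrightarrow>
     n = CARD('n) \<and>
     k = log (real CARD('f)) (real (vec.dim Q)) \<and>
     (\<exists>S. is_stabiliser_of S Q \<and> is_min_distance S d)"


subsection \<open>Well-definedness of the Pauli group and of the weight\<close>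

lemma prod_minus_one_power: "(\<Prod>j\<in>A. minus_one_power (f j)) \<in> {1, -1}"
  by (induction A rule: infinite_finite_induct) (auto simp: minus_one_power_def)

context
  assumes card4: "CARD('f::{field,finite}) = 4"
begin

lemma two_eq_0: "(1::'f) + 1 = 0"
proof -
  have "(\<Sum>x\<in>(UNIV::'f set). x + 1) = (\<Sum>x\<in>UNIV. x)"
    by (rule sum.reindex_bij_betw) (rule bij_betw_byWitness[where f' = "\<lambda>x. x - 1"], auto)
  hence "of_nat CARD('f) * (1::'f) = 0" by (simp add: sum.distrib)
  hence "(1 + 1) * ((1::'f) + 1) = 0" by (simp add: card4)
  thus ?thesis by (metis mult_eq_0_iff)
qed

lemma add_self: "(x::'f) + x = 0"
  using two_eq_0 by (metis distrib_left mult.right_neutral mult_zero_right)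

lemma power4: "(x::'f) ^ 4 = x"
proof (cases "x = 0")
  case False
  have "(\<Prod>y\<in>-{0::'f}. x * y) = (\<Prod>y\<in>-{0}. y)"
    by (rule prod.reindex_bij_betw)
      (rule bij_betw_byWitness[where f' = "\<lambda>y. y / x"], use False in auto)
  moreover have "(\<Prod>y\<in>-{0::'f}. y) \<noteq> 0" by simp
  ultimately have "x ^ card (- {0::'f}) = 1" by (simp add: prod.distrib)
  moreover have "card (- {0::'f}) = 3" by (simp add: Compl_eq_Diff_UNIV card_Diff_singleton card4)
  ultimately have "x ^ 3 = 1" by simp
  thus ?thesis by (simp add: eval_nat_numeral)
qed simp

lemma tr_add: "tr ((x::'f) + y) = tr x + tr y"
proof -
  have "tr (x + y) = tr x + tr y + (x * y + x * y)"
    by (simp add: tr_def power2_eq_square algebra_simps)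
  thus ?thesis by (simp add: add_self)
qed

lemma tr_cases: "tr (x::'f) = 0 \<or> tr x = 1"
proof -
  have "(tr x)\<^sup>2 = x\<^sup>2 + x ^ 4 + (x ^ 3 + x ^ 3)"
    by (simp add: tr_def power2_eq_square eval_nat_numeral algebra_simps)
  hence "(tr x)\<^sup>2 = tr x" by (simp add: add_self power4 tr_def add.commute)
  thus ?thesis by (simp add: power2_eq_square)
qed

lemma tr_nontrivial: "\<exists>x::'f. tr x \<noteq> 0"
proof (rule ccontr)
  assume "\<not> ?thesis"
  hence "x * (x + 1) = 0" for x :: 'f
    by (simp add: tr_def power2_eq_square algebra_simps)
  hence "x = 0 \<or> x = -1" for x :: 'f
    by (simp add: eq_neg_iff_add_eq_0)
  hence "(UNIV::'f set) \<subseteq> {0, -1}" by auto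
  hence "CARD('f) \<le> card {0, -1::'f}" by (intro card_mono) auto
  also have "\<dots> \<le> 2" by (simp add: card_insert_if)
  finally show False by (simp add: card4)
qed


lemma minus_one_power_tr_add:
  "minus_one_power (tr ((x::'f) + y)) = minus_one_power (tr x) * minus_one_power (tr y)"
  using tr_cases[of x] tr_cases[of y]
  by (auto simp: tr_add minus_one_power_def two_eq_0 simp del: one_add_one)

lemma pauli_op_entry:
  "pauli_op c a b $ x $ y =
     (if x = y + a then c * (\<Prod>j\<in>UNIV. minus_one_power (tr ((b $ j :: 'f) * y $ j))) else 0)"
proof -
  have "(X_op s ** Z_op t) $ u $ v = (if u = v + s then minus_one_power (tr (t * v)) else 0)"
    for s t u v :: 'f
    by (simp add: X_op_def Z_op_def matrix_matrix_mult_def if_distrib[of "\<lambda>z. _ * z"]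
          sum.delta cong: if_cong)
  thus ?thesis
    by (auto simp: pauli_op_def scale_op_def tensor_def vec_eq_iff intro!: prod.cong)
qed

lemma pauli_op_eq_iff:
  fixes a b a' b' :: "('f, 'n::finite) word"
  assumes "c \<in> phases" "c' \<in> phases"
  shows "pauli_op c a b = pauli_op c' a' b' \<longleftrightarrow> c = c' \<and> a = a' \<and> b = b'"
proof
  assume eq: "pauli_op c a b = pauli_op c' a' b'"
  have [simp]: "c \<noteq> 0" "c' \<noteq> 0" using assms by (auto simp: phases_def)
  have m0: "minus_one_power (tr (0::'f)) = 1" by (simp add: minus_one_power_def tr_def)
  have ac: "a = a' \<and> c = c'"
    using arg_cong[OF eq, of "\<lambda>A. A $ a $ 0"] by (simp add: pauli_op_entry m0 split: if_splits)
  have "b $ j = b' $ j" for j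
  proof (rule ccontr)
    assume ne: "b $ j \<noteq> b' $ j"
    obtain r :: 'f where r: "tr r \<noteq> 0" using tr_nontrivial by blast
    define y :: "('f, 'n) word" where "y = axis j (r / (b $ j + b' $ j))"
    have nz: "b $ j + b' $ j \<noteq> 0"
      using ne add_self[of "b' $ j"] by (metis add_right_cancel)
    have single: "(\<Prod>i\<in>UNIV. minus_one_power (tr (d $ i * y $ i))) =
        minus_one_power (tr (d $ j * y $ j))" for d :: "('f, 'n) word"
    proof -
      have "(\<Prod>i\<in>UNIV. minus_one_power (tr (d $ i * y $ i))) =
          (\<Prod>i\<in>UNIV. if i = j then minus_one_power (tr (d $ j * y $ j)) else 1)"
        by (intro prod.cong) (auto simp: y_def axis_def m0)
      thus ?thesis by simp
    qed
    have "minus_one_power (tr (b $ j * y $ j)) = minus_one_power (tr (b' $ j * y $ j))"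
      using arg_cong[OF eq, of "\<lambda>A. A $ (y + a) $ y"] ac by (simp add: pauli_op_entry single)
    hence "minus_one_power (tr (b $ j * y $ j + b' $ j * y $ j)) = 1"
      unfolding minus_one_power_tr_add by (simp add: minus_one_power_def)
    moreover have "b $ j * y $ j + b' $ j * y $ j = r"
      unfolding distrib_right[symmetric] using nz by (simp add: y_def axis_def)
    ultimately show False using r by (simp add: minus_one_power_def split: if_splits)
  qed
  with ac show "c = c' \<and> a = a' \<and> b = b'" by (simp add: vec_eq_iff)
qed auto

lemma weight_pauli_op:
  fixes a b :: "('f, 'n::finite) word"
  assumes "c \<in> phases"
  shows "weight (pauli_op c a b) = card {j. (a $ j, b $ j) \<noteq> (0, 0)}"
  unfolding weight_def using assms
  by (intro the_equality) (auto simp: pauli_op_eq_iff)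

lemma pauli_op_mult:
  fixes a b a' b' :: "('f, 'n::finite) word"
  shows "pauli_op c a b ** pauli_op c' a' b' =
    pauli_op (c * c' * (\<Prod>j\<in>UNIV. minus_one_power (tr (b $ j * a' $ j)))) (a + a') (b + b')"
proof -
  have "(pauli_op c a b ** pauli_op c' a' b') $ x $ y =
    pauli_op (c * c' * (\<Prod>j\<in>UNIV. minus_one_power (tr (b $ j * a' $ j)))) (a + a') (b + b')
      $ x $ y" for x y :: "('f, 'n) word"
  proof -
    have "(pauli_op c a b ** pauli_op c' a' b') $ x $ y =
        pauli_op c a b $ x $ (y + a') * pauli_op c' a' b' $ (y + a') $ y"
      unfolding matrix_matrix_mult_def
      by (simp add: pauli_op_entry[of c'] if_distrib[of "\<lambda>z. _ * z"] sum.delta cong: if_cong)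
    also have "\<dots> = pauli_op (c * c' * (\<Prod>j\<in>UNIV. minus_one_power (tr (b $ j * a' $ j))))
        (a + a') (b + b') $ x $ y"
      by (simp add: pauli_op_entry minus_one_power_tr_add prod.distrib algebra_simps)
    finally show ?thesis .
  qed
  thus ?thesis by (simp add: vec_eq_iff)
qed

lemma pauli_op_one: "pauli_op 1 0 (0::('f, 'n::finite) word) = mat 1"
  by (simp add: vec_eq_iff[where 'b = "('f, 'n) word"] vec_eq_iff[where 'a = complex]
        pauli_op_entry mat_def minus_one_power_def tr_def)

lemma group_pauli_group: "Group.group (pauli_group :: ('f, 'n::finite) oper monoid)"
proof (rule groupI)
  have closed: "c * c' * p \<in> phases" if "c \<in> phases" "c' \<in> phases" "p \<in> {1, -1}" for c c' p
    using that by (auto simp: phases_def)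
  show "E \<otimes>\<^bsub>pauli_group\<^esub> F \<in> carrier pauli_group"
    if "E \<in> carrier pauli_group" "F \<in> carrier pauli_group" for E F :: "('f, 'n) oper"
    using that closed[OF _ _ prod_minus_one_power]
    by (fastforce simp: pauli_group_def paulis_def pauli_op_mult)
  show "\<one>\<^bsub>pauli_group\<^esub> \<in> carrier (pauli_group :: ('f, 'n) oper monoid)"
    unfolding pauli_group_def paulis_def by (auto simp: phases_def intro!: pauli_op_one[symmetric] exI)
  fix E :: "('f, 'n) oper"
  assume "E \<in> carrier pauli_group"
  then obtain c and a b :: "('f, 'n) word" where E: "E = pauli_op c a b" and c: "c \<in> phases"
    by (auto simp: pauli_group_def paulis_def)
  define p where "p = (\<Prod>j\<in>UNIV. minus_one_power (tr (b $ j * a $ j)))"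
  have p: "p \<in> {1, -1}" unfolding p_def by (rule prod_minus_one_power)
  have "cnj c * 1 * p \<in> phases" using c by (intro closed p) (auto simp: phases_def)
  hence F: "pauli_op (cnj c * p) a b \<in> paulis" by (auto simp: paulis_def)
  have "cnj c * p * c * p = 1" using c p by (auto simp: phases_def)
  moreover have "a + a = 0" "b + b = 0" by (intro vec_eq_iff[THEN iffD2] allI, simp only: vector_add_component add_self zero_index)+
  ultimately have "pauli_op (cnj c * p) a b ** E = mat 1"
    unfolding E pauli_op_mult by (simp add: pauli_op_one flip: p_def)
  with F show "\<exists>F\<in>carrier pauli_group. F \<otimes>\<^bsub>pauli_group\<^esub> E = \<one>\<^bsub>pauli_group\<^esub>"
    by (auto simp: pauli_group_def)
qed (simp_all add: pauli_group_def matrix_mul_assoc)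

end

end

theory Submission
  imports Defs "HOL-Library.Z2"
begin

text \<open>
  Up to phases the stabiliser of a \<open>[[7,1,4]]\<close> code is an additive code \<open>L\<close> of \<open>4096\<close> words of
  length \<open>7\<close> over the alphabet of pairs \<open>(a, b)\<close>, self-orthogonal for the trace symplectic form, and
  a word of weight at most \<open>3\<close> orthogonal to \<open>L\<close> lies in \<open>L\<close>. Comparing the words of \<open>L\<close> supported
  on three positions with those supported on the other four shows that \<open>L\<close> is MDS: any three letters
  of a word of \<open>L\<close> can be prescribed, and they determine the word.

  Single out two positions. On the other five, the words of \<open>L\<close> that vanish at both positions are
  given by five isomorphisms from \<open>F_2^4\<close> to the alphabet. Transporting the letters along these
  isomorphisms makes these words constant, and turns the symplectic form into five nondegenerate
  alternating forms on \<open>F_2^4\<close> with sum zero. The words of \<open>L\<close> that vanish at just the second or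
  just the first position become two spaces \<open>Y\<close> and \<open>X\<close> of words of length five which contain the
  constant words, are orthogonal to each other, and inherit strong distance conditions. Up to
  \<open>GL_4(2)\<close> and permutations of the positions there are five such families of forms. For each of
  them an exhaustive search, shortened by the automorphisms of the family, shows that \<open>Y\<close> and \<open>X\<close> do
  not exist.
\<close>

subsection \<open>From stabilisers to additive codes\<close>

text \<open>Nothing forces the stabiliser to be linear over \<open>F_4\<close>, so only the
  structure over \<open>F_2\<close> is available, and equivalences range over all of
  \<open>GL_4(2)\<close>. Degenerate codes are allowed too, so a short word of the dual may lie in
  \<open>L\<close>; counting has to exclude this. Two positions are singled out because exactly 16
  words of \<open>L\<close> vanish there and each other position reads off such a word bijectively:
  a common coordinate system for five alphabets. Their mutual orthogonality makes the five forms add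
  up to zero. The classification starts from the Pfaffian, a quadratic form on the six-dimensional
  space of alternating forms; polarisation forces two of the first four forms to have a nonsingular
  sum. \<open>Y\<close> and \<open>X\<close> have 256 words each, 16 modulo constants, so four basis
  words describe each. Some word of \<open>Y\<close> has letters 0 and \<open>c1\<close> at
  \<open>IA\<close> and \<open>IB\<close>; it suffices to refute all candidates for it. A refuted
  word is excluded from every configuration of its family, hence from \<open>X\<close> as well,
  since \<open>Y\<close> and \<open>X\<close> can be interchanged; so each refutation prunes later
  searches on both sides.\<close>

text \<open>Expanding the columns of \<open>P\<close> in a basis \<open>B\<close> of
  \<open>Q\<close> turns the trace into a sum over \<open>b\<close> in \<open>B\<close>; each term
  is the \<open>b\<close>-coordinate of \<open>P *v b = b\<close>, that is 1.\<close>

lemma trace_eq_dim_of_projection: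
  fixes P :: "complex ^ 'i::finite ^ 'i"
  assumes sub: "vec.subspace Q" and range: "\<And>v. P *v v \<in> Q" and fix_Q: "\<And>v. v \<in> Q \<Longrightarrow> P *v v = v"
  shows "trace P = of_nat (vec.dim Q)"
proof -
  obtain B where B: "B \<subseteq> Q" "vec.independent B" "Q \<subseteq> vec.span B" "card B = vec.dim Q"
    using vec.basis_exists by blast
  have fin: "finite B" using B(2) by (rule vec.finiteI_independent)
  have sp: "vec.span B = Q" using B sub by (simp add: vec.span_minimal subset_antisym)
  define r where "r x b = vec.representation B (column x P) b" for x b
  have col: "column x P \<in> Q" for x
  proof -
    have "P *v axis x 1 = column x P"
      by (simp add: column_def matrix_vector_mult_def axis_def vec_eq_iff mult_delta_right)
    thus ?thesis using range[of "axis x 1"] by simp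
  qed
  have colsum: "(\<Sum>b\<in>B. r x b *s b) = column x P" for x
    unfolding r_def using vec.sum_representation_eq[OF B(2) _ fin subset_refl, of "column x P"] col sp
    by simp
  have diag: "(\<Sum>x\<in>UNIV. b $ x * r x b) = 1" if b: "b \<in> B" for b
  proof -
    have "(\<Sum>x\<in>UNIV. b $ x * r x b) = (\<Sum>x\<in>UNIV. vec.representation B (b $ x *s column x P) b)"
      by (simp add: r_def vec.representation_scale[OF B(2)] col sp)
    also have "\<dots> = vec.representation B (\<Sum>x\<in>UNIV. b $ x *s column x P) b"
      by (subst vec.representation_sum[OF B(2)]) (auto simp: sp col vec.subspace_scale[OF sub])
    also have "(\<Sum>x\<in>UNIV. b $ x *s column x P) = b"
      using fix_Q[of b] b B(1) by (auto simp: matrix_mult_sum)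
    finally show ?thesis by (simp add: vec.representation_basis[OF B(2) b])
  qed
  have "trace P = (\<Sum>x\<in>UNIV. column x P $ x)" by (simp add: trace_def column_def)
  also have "\<dots> = (\<Sum>x\<in>UNIV. \<Sum>b\<in>B. r x b * b $ x)" by (simp flip: colsum)
  also have "\<dots> = (\<Sum>b\<in>B. \<Sum>x\<in>UNIV. b $ x * r x b)" by (subst sum.swap) (simp add: mult.commute)
  also have "\<dots> = of_nat (card B)" by (simp add: diag)
  finally show ?thesis by (simp add: B(4))
qed

lemma sum_matrix_vector_mult:
  fixes S :: "(complex ^ 'i::finite ^ 'i) set"
  shows "finite S \<Longrightarrow> (\<Sum>E\<in>S. E) *v v = (\<Sum>E\<in>S. E *v v)"
  by (induction S rule: finite_induct) (simp_all add: matrix_vector_mult_add_rdistrib)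

lemma scale_op_mult_vec: "scale_op c A *v v = c *s (A *v v)"
  by (simp add: scale_op_def matrix_vector_mult_def vec_eq_iff sum_distrib_left mult.assoc)

definition bit_sign :: "bit \<Rightarrow> complex" where "bit_sign x = (if x = 0 then 1 else - 1)"

lemma bit_sign_add: "bit_sign (x + y) = bit_sign x * bit_sign y"
  by (cases x; cases y) (simp_all add: bit_sign_def)

lemma bit_sign_0: "bit_sign 0 = 1" by (simp add: bit_sign_def)

lemma bit_sign_sum: "bit_sign (sum f A) = (\<Prod>j\<in>A. bit_sign (f j))"
  by (induction A rule: infinite_finite_induct) 
    (simp_all only: sum.infinite sum.empty sum.insert prod.infinite prod.empty prod.insert
      bit_sign_add bit_sign_0 not_False_eq_True)

text \<open>The commutation exponent of two Pauli operators at one position, moved from the elements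
  0 and 1 of \<open>'f\<close> to \<open>bit\<close>, where all later linear algebra takes
  place.\<close>

fun sympl :: "'f::field \<times> 'f \<Rightarrow> 'f \<times> 'f \<Rightarrow> bit" where
  "sympl (a, b) (a', b') = (if tr (b * a' + b' * a) = 0 then 0 else 1)"

definition letters :: "'f ^ 'n \<Rightarrow> 'f ^ 'n \<Rightarrow> ('f \<times> 'f) ^ 'n" where
  "letters a b = (\<chi> j. (a $ j, b $ j))"

lemma letters_surj: "\<exists>a b. w = letters a b"
  by (rule exI[of _ "\<chi> j. fst (w $ j)"], rule exI[of _ "\<chi> j. snd (w $ j)"])
    (simp add: letters_def vec_eq_iff)

lemma letters_eq_iff: "letters a b = letters a' b' \<longleftrightarrow> a = a' \<and> b = b'"
  by (auto simp: letters_def vec_eq_iff)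

lemma letters_add: "letters a b + letters a' b' = letters (a + a') (b + b')"
  by (simp add: letters_def vec_eq_iff)

section \<open>Pauli operators and the words of a stabiliser\<close>

context
  assumes card4: "CARD('f::{field,finite}) = 4"
begin

lemma word_add_self: "(a :: 'f ^ 'n::finite) + a = 0"
  by (intro vec_eq_iff[THEN iffD2] allI) (simp only: vector_add_component add_self[OF card4] zero_index)

lemma bit_sign_sympl:
  "bit_sign (sympl ((a::'f), b) (a', b')) = minus_one_power (tr (b * a')) * minus_one_power (tr (b' * a))"
  by (simp add: bit_sign_def minus_one_power_tr_add[OF card4, symmetric] minus_one_power_def[of "tr (b * a' + b'
    * a)"])

lemma bit_sign_sum_sympl:
  fixes a b a' b' :: "'f ^ 'n::finite"
  shows "bit_sign (\<Sum>j\<in>UNIV. sympl (letters a b $ j) (letters a' b' $ j)) =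
    (\<Prod>j\<in>UNIV. minus_one_power (tr (b $ j * a' $ j))) * (\<Prod>j\<in>UNIV. minus_one_power (tr (b' $ j * a $ j)))"
  by (simp add: bit_sign_sum letters_def bit_sign_sympl prod.distrib del: sympl.simps)

lemma sign_eq: "x * y = 1 \<Longrightarrow> y \<in> {1, -1} \<Longrightarrow> y = (x :: complex)"
  by (auto simp: minus_equation_iff[of x])

text \<open>A nonzero \<open>a\<close> leaves no diagonal entries; for \<open>a = 0\<close> the
  trace is a character sum, which vanishes unless \<open>b = 0\<close>.\<close>

lemma trace_pauli_op:
  fixes a b :: "'f ^ 'n::finite"
  shows "trace (pauli_op c a b) = (if a = 0 \<and> b = 0 then c * 4 ^ CARD('n) else 0)"
proof -
  let ?p = "\<lambda>y :: 'f ^ 'n. \<Prod>j\<in>UNIV. minus_one_power (tr (b $ j * y $ j))"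
  have tr: "trace (pauli_op c a b) = (\<Sum>y\<in>UNIV. if a = 0 then c * ?p y else 0)"
    unfolding trace_def by (intro sum.cong) (auto simp: pauli_op_entry[OF card4])
  have sum0: "(\<Sum>y\<in>UNIV. ?p y) = 0" if b0: "b \<noteq> 0"
  proof -
    obtain i where i: "b $ i \<noteq> 0" using b0 unfolding vec_eq_iff by auto
    obtain r :: 'f where r: "tr r \<noteq> 0" using tr_nontrivial[OF card4] by blast
    \<comment> \<open>Translation by \<open>z\<close> multiplies the character by -1.\<close>
    define z :: "'f ^ 'n" where "z = axis i (r / b $ i)"
    have "?p z = (\<Prod>j\<in>UNIV. if j = i then -1 else 1)"
      using i r by (intro prod.cong) (auto simp: z_def axis_def minus_one_power_def tr_def)
    hence pz: "?p z = -1" by simp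
    have "(\<Sum>y\<in>UNIV. ?p y) = (\<Sum>y\<in>UNIV. ?p (y + z))"
      by (rule sum.reindex_bij_witness[of _ "\<lambda>y. y + z" "\<lambda>y. y - z"]) auto
    also have "\<dots> = (\<Sum>y\<in>UNIV. ?p y * ?p z)"
      by (simp add: distrib_left minus_one_power_tr_add[OF card4] prod.distrib)
    also have "\<dots> = - (\<Sum>y\<in>UNIV. ?p y)" by (simp add: pz sum_negf)
    finally show ?thesis by simp
  qed
  have total: "(\<Sum>y\<in>(UNIV :: ('f ^ 'n) set). (1::complex)) = 4 ^ CARD('n)"
    by (simp add: card4)
  show ?thesis
  proof (cases "a = 0")
    case True
    hence "trace (pauli_op c a b) = c * (\<Sum>y\<in>UNIV. ?p y)" unfolding tr using True by (simp add: sum_distrib_left)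
    moreover have "(\<Sum>y\<in>UNIV. ?p y) = 4 ^ CARD('n)" if "b = 0"
    proof -
      have "?p y = 1" for y by (simp add: that minus_one_power_def tr_def)
      thus ?thesis using total by simp
    qed
    ultimately show ?thesis using sum0 True by auto
  qed (simp add: tr)
qed

lemma pauli_op_adjoint:
  fixes a b :: "'f ^ 'n::finite"
  shows "pauli_op 1 a b ** adjoint_op (pauli_op 1 a b) = mat 1"
proof -
  let ?p = "\<lambda>y :: 'f ^ 'n. \<Prod>j\<in>UNIV. minus_one_power (tr (b $ j * y $ j))"
  have pp: "?p y * cnj (?p y) = 1" for y
  proof -
    consider "?p y = 1" | "?p y = -1"
      using prod_minus_one_power[of "\<lambda>j. tr (b $ j * y $ j)" UNIV] by blast
    thus ?thesis by cases (simp_all only: complex_cnj_one complex_cnj_minus mult_1_left minus_mult_minus)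
  qed
  have "(pauli_op 1 a b ** adjoint_op (pauli_op 1 a b)) $ x $ z = (mat 1 :: ('f, 'n) oper) $ x $ z" for x z
  proof -
    have "(pauli_op 1 a b ** adjoint_op (pauli_op 1 a b)) $ x $ z =
        (\<Sum>y\<in>UNIV. pauli_op 1 a b $ x $ y * cnj (pauli_op 1 a b $ z $ y))"
      by (simp add: matrix_matrix_mult_def adjoint_op_def)
    also have "\<dots> = (\<Sum>y\<in>UNIV. if y = x - a then (if x = z then 1 else 0) else 0)"
    proof (rule sum.cong[OF refl])
      fix y
      show "pauli_op 1 a b $ x $ y * cnj (pauli_op 1 a b $ z $ y) =
          (if y = x - a then (if x = z then 1 else 0) else 0)"
        using pp[of y] by (auto simp: pauli_op_entry[OF card4] simp del: cnj_prod)
    qed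
    finally have "(pauli_op 1 a b ** adjoint_op (pauli_op 1 a b)) $ x $ z =
        (\<Sum>y\<in>UNIV. if y = x - a then (if x = z then 1 else 0) else 0)" .
    thus ?thesis by (simp add: mat_def)
  qed
  thus ?thesis by (simp add: vec_eq_iff)
qed

lemma pauli_op_scale:
  "scale_op c (pauli_op c' a b) = pauli_op (c * c') a (b :: 'f ^ 'n::finite)"
  by (simp add: scale_op_def pauli_op_def vec_eq_iff mult.assoc)

lemma pauli_op_scalar: "pauli_op c 0 (0 :: 'f ^ 'n::finite) *v v = c *s v"
proof -
  have "pauli_op c 0 (0 :: 'f ^ 'n) = scale_op c (mat 1)"
    by (simp add: pauli_op_one[OF card4, symmetric] pauli_op_scale)
  also have "\<dots> *v v = c *s v"
  proof (rule vec_eq_iff[THEN iffD2], rule allI)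
    fix i
    show "(scale_op c (mat 1) *v v) $ i = (c *s v) $ i"
      by (simp add: scale_op_def mat_def matrix_vector_mult_def if_distrib[of "\<lambda>z. c * z"]
          if_distrib[of "\<lambda>z. z * _"] cong: if_cong)
  qed
  finally show ?thesis .
qed

text \<open>Membership in \<open>paulis\<close> only gives some representation with a phase;
  comparing entries in column 0 shows that \<open>c\<close> is that phase.\<close>

lemma pauli_op_phase:
  fixes a b :: "'f ^ 'n::finite"
  assumes "pauli_op c a b \<in> paulis"
  shows "c \<in> phases"
proof -
  obtain c' a' b' where c': "c' \<in> phases" and eq: "pauli_op c a b = pauli_op c' a' b'"
    using assms by (auto simp: paulis_def)
  have m0: "minus_one_power (tr (0::'f)) = 1" by (simp add: minus_one_power_def tr_def)
  have "(if a' = a then c else 0) = c'"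
    using arg_cong[OF eq, of "\<lambda>A. A $ a' $ 0"] by (simp add: pauli_op_entry[OF card4] m0 split: if_splits)
  thus ?thesis using c' by (auto simp: phases_def split: if_splits)
qed

text \<open>The number 4096 is \<open>4 ^ 7 / 4\<close>: the average of \<open>S\<close> projects
  onto \<open>Q\<close>, and only the identity in \<open>S\<close> has nonzero trace.
  \<open>L\<close> is \<open>S\<close> with the phases forgotten; this loses nothing, because the
  only scalar in \<open>S\<close> is 1.\<close>

lemma stabiliser_words:
  fixes Q :: "('f, 'n::finite) state set"
  assumes code: "is_stabiliser_code Q 7 1 4"
  obtains L :: "(('f \<times> 'f) ^ 'n) set" where "0 \<in> L" "\<And>u v. u \<in> L \<Longrightarrow> v \<in> L \<Longrightarrow> u + v \<in> L" "card L = 4096"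
    "\<And>u v. u \<in> L \<Longrightarrow> v \<in> L \<Longrightarrow> (\<Sum>j\<in>UNIV. sympl (u $ j) (v $ j)) = 0"
    "\<And>w. (\<And>u. u \<in> L \<Longrightarrow> (\<Sum>j\<in>UNIV. sympl (u $ j) (w $ j)) = 0) \<Longrightarrow> card {j. w $ j \<noteq> 0} \<le> 3 \<Longrightarrow> w \<in> L"
proof -
  from code obtain S where S: "is_stabiliser_of S Q" and d: "is_min_distance S 4"
    and n: "CARD('n) = 7" and k: "log 4 (real (vec.dim Q)) = 1"
    unfolding is_stabiliser_code_def by (auto simp: card4)
  have sg: "subgroup S pauli_group" using S unfolding is_stabiliser_of_def by (elim conjE)
  have QS: "Q = fixed_space S" using S unfolding is_stabiliser_of_def by (elim conjE)
  have Q0: "Q \<noteq> {0}" using S unfolding is_stabiliser_of_def by (elim conjE)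
  have SP: "S \<subseteq> paulis" using subgroup.subset[OF sg] by (simp add: pauli_group_def)
  have mult: "E ** F \<in> S" if "E \<in> S" "F \<in> S" for E F
    using subgroup.m_closed[OF sg that] by (simp add: pauli_group_def)
  have oneS: "mat 1 \<in> S" using subgroup.one_closed[OF sg] by (simp add: pauli_group_def)
  have finS: "finite S"
  proof (rule finite_subset[OF SP])
    have "paulis \<subseteq> (\<lambda>(c, a, b). pauli_op c a (b :: 'f ^ 'n)) ` (phases \<times> UNIV)"
    proof
      fix E :: "('f, 'n) oper" assume "E \<in> paulis"
      then obtain c a b where "E = pauli_op c a b" "c \<in> phases" by (auto simp: paulis_def)
      thus "E \<in> (\<lambda>(c, a, b). pauli_op c a (b :: 'f ^ 'n)) ` (phases \<times> UNIV)"
        by (intro image_eqI[of _ _ "(c, a, b)"]) auto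
    qed
    thus "finite (paulis :: ('f, 'n) oper set)" by (rule finite_subset) (simp add: phases_def)
  qed
  have subQ: "vec.subspace Q"
    unfolding vec.subspace_def QS fixed_space_def
    by (simp add: matrix_vector_right_distrib vector_scalar_commute)
  obtain q where q: "q \<in> Q" "q \<noteq> 0" using Q0 vec.subspace_0[OF subQ] by blast
  have dimQ: "vec.dim Q = 4"
  proof -
    \<comment> \<open>The logarithm can be inverted only at a positive dimension.\<close>
    have "vec.dim Q \<noteq> 0" using q by auto
    hence "real (vec.dim Q) = 4 powr (log 4 (real (vec.dim Q)))" by (intro powr_log_cancel[symmetric]) auto
    thus ?thesis by (simp add: k)
  qed
  have scalar: "c = 1" if "pauli_op c 0 (0 :: 'f ^ 'n) \<in> S" for c
  proof -
    have "c *s q = q" using that q(1) by (auto simp: QS fixed_space_def pauli_op_scalar[symmetric])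
    hence "c * q $ i = q $ i" for i by (metis vector_smult_component)
    moreover obtain i where "q $ i \<noteq> 0" using q(2) unfolding vec_eq_iff by auto
    ultimately show ?thesis by (metis mult_cancel_right1)
  qed
  have ES: "\<exists>c\<in>phases. \<exists>a b. E = pauli_op c a (b :: 'f ^ 'n)" if "E \<in> S" for E
    using that SP by (force simp: paulis_def)
  have phaseS: "c \<in> phases" if "pauli_op c a (b :: 'f ^ 'n) \<in> S" for c a b
    using that SP pauli_op_phase by blast
  \<comment> \<open>The product of the first operator with the second and its square are both
    scalars in \<open>S\<close>, with the same sign \<open>x\<close>; both are 1, so the phases
    agree.\<close>
  have phase_unique: "c = c'" if "pauli_op c a b \<in> S" "pauli_op c' a b \<in> S" for c c' and a b :: "'f ^ 'n"
  proof -
    define x where "x = (\<Prod>j\<in>UNIV. minus_one_power (tr (b $ j * a $ j)))"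
    have "c * c' * x = 1"
      using mult[OF that] scalar by (simp add: pauli_op_mult[OF card4] word_add_self flip: x_def)
    moreover have "c * c * x = 1"
      using mult[OF that(1) that(1)] scalar by (simp add: pauli_op_mult[OF card4] word_add_self flip: x_def)
    ultimately have "c * x * (c' - c) = 0" "c * x \<noteq> 0" by (auto simp: algebra_simps)
    thus ?thesis by (metis mult_eq_0_iff right_minus_eq)
  qed
  define L where "L = {w. \<exists>c a b. w = letters a b \<and> pauli_op c a (b :: 'f ^ 'n) \<in> S}"
  have L_add: "u + v \<in> L" if uv: "u \<in> L" "v \<in> L" for u v
  proof -
    from uv obtain c a b c' a' b' where "u = letters a b" "pauli_op c a b \<in> S" "v = letters a' b'" "pauli_op c'
      a' b' \<in> S"
      by (auto simp: L_def)
    thus ?thesis using mult[of "pauli_op c a b" "pauli_op c' a' b'"]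
      by (auto simp: L_def letters_add pauli_op_mult[OF card4])
  qed
  have L_orth: "(\<Sum>j\<in>UNIV. sympl (u $ j) (v $ j)) = 0" if uv: "u \<in> L" "v \<in> L" for u v
  proof -
    from uv obtain c a b c' a' b' where u: "u = letters a b" "pauli_op c a b \<in> S"
      and v: "v = letters a' b'" "pauli_op c' a' b' \<in> S"
      by (auto simp: L_def)
    let ?x = "\<Prod>j\<in>UNIV. minus_one_power (tr (b $ j * a' $ j))" and ?y = "\<Prod>j\<in>UNIV. minus_one_power (tr (b' $ j * a
      $ j))"
    \<comment> \<open>The products in the two orders have the same letters, hence the same
      phase.\<close>
    have "c * c' * ?x = c' * c * ?y"
      using mult[OF u(2) v(2)] mult[OF v(2) u(2)]
      by (intro phase_unique[of _ "a + a'" "b + b'"]) (simp_all add: pauli_op_mult[OF card4] add.commute)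
    moreover have "c \<noteq> 0" "c' \<noteq> 0" using phaseS[OF u(2)] phaseS[OF v(2)] by (auto simp: phases_def)
    ultimately have "?x = ?y" by simp
    hence "?x * ?y = 1" using prod_minus_one_power[of "\<lambda>j. tr (b $ j * a' $ j)" UNIV] by auto
    hence "bit_sign (\<Sum>j\<in>UNIV. sympl (u $ j) (v $ j)) = 1" by (simp add: u v bit_sign_sum_sympl)
    thus ?thesis by (simp add: bit_sign_def split: if_splits)
  qed
  have card_SL: "card L = card S"
  proof -
    define T where "T = {(c, a, b). c \<in> phases \<and> pauli_op c a (b :: 'f ^ 'n) \<in> S}"
    have "L = (\<lambda>(c, a, b). letters a b) ` T"
      using phaseS by (force simp: L_def T_def)
    moreover have "inj_on (\<lambda>(c, a, b). letters a b) T"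
      using phase_unique by (auto simp: inj_on_def T_def letters_eq_iff)
    moreover have "S = (\<lambda>(c, a, b). pauli_op c a b) ` T"
      using ES by (force simp: T_def)
    moreover have "inj_on (\<lambda>(c, a, b). pauli_op c a b) T"
      by (auto simp: inj_on_def T_def pauli_op_eq_iff[OF card4])
    ultimately show ?thesis by (metis card_image)
  qed
  have card_S: "card S = 4096"
  proof -
    have S0: "card S > 0" using finS oneS by (auto simp: card_gt_0_iff)
    \<comment> \<open>The group average, which is the projection onto \<open>Q\<close>.\<close>
    define P where "P = scale_op (1 / of_nat (card S)) (\<Sum>E\<in>S. E)"
    have Pv: "P *v v = (1 / of_nat (card S)) *s (\<Sum>E\<in>S. E *v v)" for v
    proof -
      have "P *v v = (1 / of_nat (card S)) *s ((\<Sum>E\<in>S. E) *v v)"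
        by (simp add: P_def scale_op_mult_vec)
      thus ?thesis by (simp add: sum_matrix_vector_mult[OF finS])
    qed
    have "trace P = of_nat (vec.dim Q)"
    proof (rule trace_eq_dim_of_projection[OF subQ])
      fix v :: "('f, 'n) state"
      show "P *v v = v" if "v \<in> Q"
      proof -
        have "(\<Sum>E\<in>S. E *v v) = of_nat (card S) *s v"
        proof (rule vec_eq_iff[THEN iffD2], rule allI)
          fix i
          have "(\<Sum>E\<in>S. E *v v) $ i = (\<Sum>E\<in>S. (E *v v) $ i)" by (rule sum_component)
          also have "\<dots> = (\<Sum>E\<in>S. v $ i)"
            using that by (intro sum.cong) (auto simp: QS fixed_space_def)
          finally show "(\<Sum>E\<in>S. E *v v) $ i = (of_nat (card S) *s v) $ i" by simp
        qed
        thus ?thesis using S0 by (simp add: Pv vector_smult_assoc)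
      qed
      have "E *v (\<Sum>F\<in>S. F *v v) = (\<Sum>F\<in>S. F *v v)" if E: "E \<in> S" for E
      proof -
        have inj: "inj_on (\<lambda>F. E ** F) S"
        proof (rule inj_onI)
          fix F G assume "F \<in> S" "G \<in> S" "E ** F = E ** G"
          obtain E' where "E' ** E = mat 1"
            using group.l_inv_ex[OF group_pauli_group[OF card4], of E] E SP by (auto simp: pauli_group_def)
          thus "F = G" using \<open>E ** F = E ** G\<close> by (metis matrix_mul_assoc matrix_mul_lid)
        qed
        have "(\<lambda>F. E ** F) ` S = S"
          using mult[OF E] by (intro card_subset_eq[OF finS]) (auto simp: card_image[OF inj])
        hence "(\<Sum>F\<in>S. F *v v) = (\<Sum>F\<in>S. (E ** F) *v v)" using sum.reindex[OF inj, of "\<lambda>F. F *v v"] by simp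
        also have "\<dots> = E *v (\<Sum>F\<in>S. F *v v)"
          by (simp add: matrix_vector_mul_assoc[symmetric] vec.linear_sum[OF matrix_vector_mul_linear_gen])
        finally show ?thesis by simp
      qed
      thus "P *v v \<in> Q" by (simp add: QS fixed_space_def Pv vector_scalar_commute)
    qed
    also have "trace P = (1 / of_nat (card S)) * (\<Sum>E\<in>S. trace E)"
    proof -
      have "(\<Sum>E\<in>S. trace E) = (\<Sum>i\<in>UNIV. (\<Sum>E\<in>S. E) $ i $ i)"
        unfolding trace_def sum_component by (rule sum.swap)
      thus ?thesis by (simp only: P_def trace_def scale_op_def vec_lambda_beta sum_distrib_left)
    qed
    also have "(\<Sum>E\<in>S. trace E) = (\<Sum>E\<in>S. if E = mat 1 then 4 ^ CARD('n) else 0)"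
    proof (rule sum.cong[OF refl])
      fix E assume E: "E \<in> S"
      then obtain c a b where e: "c \<in> phases" "E = pauli_op c a (b :: 'f ^ 'n)" using ES by blast
      have "E = mat 1 \<longleftrightarrow> c = 1 \<and> a = 0 \<and> b = 0"
        unfolding e(2) pauli_op_one[OF card4, symmetric] using e(1)
        by (subst pauli_op_eq_iff[OF card4]) (auto simp: phases_def)
      thus "trace E = (if E = mat 1 then 4 ^ CARD('n) else 0)"
        using scalar E by (auto simp: e(2) trace_pauli_op)
    qed
    also have "\<dots> = 4 ^ 7" using finS oneS by (simp add: n)
    finally have "complex_of_nat (4 * card S) = of_nat (4 ^ 7)" using S0 by (simp add: dimQ field_simps)
    hence "4 * card S = 4 ^ 7" by (simp only: of_nat_eq_iff)
    thus ?thesis by simp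
  qed
  have low: "w \<in> L" if orth: "\<And>u. u \<in> L \<Longrightarrow> (\<Sum>j\<in>UNIV. sympl (u $ j) (w $ j)) = 0" and wt: "card {j. w $ j \<noteq> 0} \<le>
    3" for w
  proof -
    obtain a b where w: "w = letters a b" using letters_surj by blast
    \<comment> \<open>The phase 1 is as good as any: neither the normaliser nor
      \<open>phase_closure S\<close> distinguishes phases.\<close>
    let ?E = "pauli_op 1 a (b :: 'f ^ 'n)"
    have EP: "?E \<in> paulis" by (auto simp: paulis_def phases_def)
    have conj: "?E ** A ** adjoint_op ?E = A" if A: "A \<in> S" for A
    proof -
      obtain c a' b' where A': "A = pauli_op c a' b'" using ES[OF A] by blast
      have "letters a' b' \<in> L" using A A' by (auto simp: L_def)
      from orth[OF this] have "bit_sign (\<Sum>j\<in>UNIV. sympl (letters a' b' $ j) (letters a b $ j)) = 1"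
        by (simp add: w bit_sign_def)
      hence xy: "(\<Prod>j\<in>UNIV. minus_one_power (tr (b' $ j * a $ j))) * (\<Prod>j\<in>UNIV. minus_one_power (tr (b $ j * a' $
        j))) = (1::complex)"
        by (simp add: bit_sign_sum_sympl)
      have "(\<Prod>j\<in>UNIV. minus_one_power (tr (b $ j * a' $ j))) = (\<Prod>j\<in>UNIV. minus_one_power (tr (b' $ j * a $ j)))"
        using xy prod_minus_one_power[of "\<lambda>j. tr (b $ j * a' $ j)" UNIV] by (rule sign_eq)
      hence "?E ** A = A ** ?E" by (simp add: A' pauli_op_mult[OF card4] add.commute)
      thus ?thesis by (simp add: matrix_mul_assoc[symmetric] pauli_op_adjoint)
    qed
    have N: "?E \<in> pauli_normaliser S"
      using EP conj by (force simp: pauli_normaliser_def)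
    have "?E \<in> phase_closure S"
    proof (rule ccontr)
      assume not: "?E \<notin> phase_closure S"
      have wE: "weight ?E = card {j. w $ j \<noteq> 0}"
        by (simp add: weight_pauli_op[OF card4] phases_def w letters_def zero_prod_def)
      \<comment> \<open>Since 4096 differs from \<open>4 ^ 7\<close>, the distance is the one of the
        normaliser outside \<open>phase_closure S\<close>.\<close>
      have "card S \<noteq> CARD('f) ^ CARD('n)" by (simp add: card_S card4 n)
      hence "\<forall>x\<in>{weight E | E. E \<in> pauli_normaliser S - phase_closure S \<and> weight E \<noteq> 0}. 4 \<le> x"
        using d by (simp add: is_min_distance_def is_min_nonzero_weight_def)
      hence "weight ?E = 0" using N not wt wE by fastforce
      hence "{j. w $ j \<noteq> 0} = {}" using wE by simp
      hence "a = 0 \<and> b = 0" by (auto simp: w letters_def vec_eq_iff zero_prod_def)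
      hence "?E = mat 1" by (simp add: pauli_op_one[OF card4])
      moreover have "mat 1 \<in> phase_closure S"
        using oneS by (force simp: phase_closure_def phases_def scale_op_def vec_eq_iff)
      ultimately show False using not by simp
    qed
    then obtain c E where c: "c \<in> phases" "E \<in> S" "?E = scale_op c E" by (auto simp: phase_closure_def)
    obtain c' a' b' where E: "c' \<in> phases" "E = pauli_op c' a' b'" using ES[OF c(2)] by blast
    have "pauli_op 1 a b = pauli_op (c * c') a' b'" using c(3) by (simp add: E pauli_op_scale)
    hence "a = a' \<and> b = b'"
      using c(1) E(1) by (subst (asm) pauli_op_eq_iff[OF card4]) (auto simp: phases_def)
    thus ?thesis using c(2) E by (auto simp: L_def w)
  qed
  have L0: "0 \<in> L"
  proof -
    have "letters 0 0 \<in> L" using oneS by (auto simp: L_def pauli_op_one[OF card4, symmetric])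
    thus ?thesis by (simp add: letters_def zero_vec_def zero_prod_def)
  qed
  show thesis by (rule that[OF L0 L_add _ L_orth low]) (simp_all add: card_SL card_S)
qed

end

subsection \<open>Self-orthogonal additive codes of length seven\<close>

definition int_sign :: "bit \<Rightarrow> int" where "int_sign x = (if x = 0 then 1 else - 1)"

lemma int_sign_add: "int_sign (x + y) = int_sign x * int_sign y"
  by (cases x; cases y) (simp_all add: int_sign_def)

lemma card_vec_components:
  fixes B :: "'n::finite \<Rightarrow> 'v::finite set"
  shows "card {u :: 'v ^ 'n. \<forall>j. u $ j \<in> B j} = (\<Prod>j\<in>UNIV. card (B j))"
proof -
  have "bij_betw vec_lambda (PiE UNIV B) {u :: 'v ^ 'n. \<forall>j. u $ j \<in> B j}"
    by (rule bij_betw_byWitness[where f' = vec_nth]) (auto simp: vec_lambda_inverse vec_nth_inverse)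
  from bij_betw_same_card[OF this] show ?thesis by (simp add: card_PiE)
qed

text \<open>The alphabet is kept as an additive group of order 16 with an alternating form, since
  \<open>L\<close> need not be closed under multiplication by field elements.\<close>

locale symplectic_letters =
  fixes s :: "'v::{ab_group_add,finite} \<Rightarrow> 'v \<Rightarrow> bit"
  assumes s_add: "s (x + y) z = s x z + s y z"
    and s_commute: "s x y = s y x"
    and s_self: "s x x = 0"
    and s_nondeg: "x \<noteq> 0 \<Longrightarrow> \<exists>y. s x y = 1"
    and char2: "x + x = (0 :: 'v)"
    and card_letters: "CARD('v) = 16"
begin

lemma s_add_right: "s z (x + y) = s z x + s z y"
  using s_add s_commute by metis

lemma s_zero: "s 0 y = 0"
  using s_add[of 0 0 y] by simp

definition pair :: "'v ^ 'n::finite \<Rightarrow> 'v ^ 'n \<Rightarrow> bit" where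
  "pair u w = (\<Sum>j\<in>UNIV. s (u $ j) (w $ j))"

lemma pair_add: "pair (u + v) w = pair u w + pair v w"
  by (simp only: pair_def vector_add_component s_add sum.distrib)

lemma pair_add_right: "pair w (u + v) = pair w u + pair w v"
  by (simp only: pair_def vector_add_component s_add_right sum.distrib)

lemma pair_commute: "pair u w = pair w u"
  by (simp only: pair_def s_commute)

lemma pair_axis: "pair u (axis i y) = s (u $ i) y"
proof -
  have "pair u (axis i y) = (\<Sum>j\<in>UNIV. if j = i then s (u $ i) y else 0)"
    unfolding pair_def by (intro sum.cong refl) (auto simp: axis_def s_commute[of _ 0] s_zero)
  thus ?thesis by simp
qed

lemma pair_nondeg: "u \<noteq> 0 \<Longrightarrow> \<exists>w. pair u w = 1"
  using s_nondeg pair_axis by (metis vec_eq_iff zero_index)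

lemma word_char2: "(u :: 'v ^ 'n::finite) + u = 0"
  by (rule vec_eq_iff[THEN iffD2]) (simp only: vector_add_component char2 zero_index simp_thms)

lemma word_char2_left: "(u :: 'v ^ 'n::finite) + (u + v) = v"
  by (simp only: add.assoc[symmetric] word_char2 add_0)

lemmas word_ac = add.assoc add.commute add.left_commute word_char2 word_char2_left

definition additive :: "('v ^ 'n::finite) set \<Rightarrow> bool" where
  "additive M \<longleftrightarrow> 0 \<in> M \<and> (\<forall>u\<in>M. \<forall>v\<in>M. u + v \<in> M)"

lemma sum_shift_zero:
  assumes M: "additive M" "m0 \<in> M" and f: "\<And>u v. f (u + v) = f u + f v" "f m0 = 1"
  shows "(\<Sum>m\<in>M. int_sign (f m)) = 0"
proof -
  have "(\<Sum>m\<in>M. int_sign (f m)) = (\<Sum>m\<in>M. int_sign (f (m + m0)))"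
    using M by (intro sum.reindex_bij_witness[of _ "\<lambda>m. m + m0" "\<lambda>m. m + m0"])
      (auto simp: additive_def add.assoc word_char2)
  also have "\<dots> = - (\<Sum>m\<in>M. int_sign (f m))"
    by (simp only: f int_sign_add) (simp add: int_sign_def sum_negf)
  finally show ?thesis by simp
qed

text \<open>Double counting of \<open>int_sign (pair m w)\<close> over \<open>m\<close> in
  \<open>M\<close> and all \<open>w\<close>: in either order an inner sum vanishes or has all its
  terms equal to 1.\<close>

lemma card_dual:
  fixes M :: "('v ^ 'n::finite) set"
  assumes M: "additive M"
  shows "card M * card {w. \<forall>m\<in>M. pair m w = 0} = 16 ^ CARD('n)"
proof -
  let ?D = "{w. \<forall>m\<in>M. pair m w = 0}"
  have inner: "(\<Sum>m\<in>M. int_sign (pair m w)) = (if w \<in> ?D then int (card M) else 0)" for w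
  proof (cases "w \<in> ?D")
    case False
    then obtain m0 where "m0 \<in> M" "pair m0 w = 1" by auto
    hence "(\<Sum>m\<in>M. int_sign (pair m w)) = 0"
      by (intro sum_shift_zero[OF M]) (simp_all only: pair_add)
    thus ?thesis by (simp only: False if_False)
  qed (simp add: int_sign_def)
  have outer: "(\<Sum>w\<in>UNIV. int_sign (pair m w)) = (if m = 0 then int (16 ^ CARD('n)) else 0)" for m :: "'v ^ 'n"
  proof (cases "m = 0")
    case True
    have "pair 0 w = 0" for w :: "'v ^ 'n" by (simp add: pair_def s_zero)
    thus ?thesis using True by (simp add: int_sign_def card_letters)
  next
    case False
    then obtain w where "pair m w = 1" using pair_nondeg by blast
    with sum_shift_zero[of UNIV w "pair m"] False show ?thesis
      by (simp add: additive_def pair_add_right)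
  qed
  have "int (card M * card ?D) = (\<Sum>w\<in>UNIV. \<Sum>m\<in>M. int_sign (pair m w))"
    by (simp add: inner sum.If_cases)
  also have "\<dots> = (\<Sum>m\<in>M. \<Sum>w\<in>UNIV. int_sign (pair m w))" by (rule sum.swap)
  also have "\<dots> = int (16 ^ CARD('n))" using M by (simp add: outer additive_def)
  finally show ?thesis by (simp only: of_nat_eq_iff)
qed

text \<open>In characteristic two the fibre of addition over \<open>m + n\<close> consists of the
  pairs \<open>(m + t, n + t)\<close> with \<open>t\<close> in the intersection.\<close>

lemma card_sum_additive:
  fixes M N :: "('v ^ 'n::finite) set"
  assumes M: "additive M" and N: "additive N"
  shows "card ((\<lambda>(m, n). m + n) ` (M \<times> N)) * card (M \<inter> N) = card M * card N"
proof -
  let ?f = "\<lambda>(m, n). m + n :: 'v ^ 'n"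
  have fib: "card {p \<in> M \<times> N. ?f p = y} = card (M \<inter> N)" if y: "y \<in> ?f ` (M \<times> N)" for y
  proof -
    obtain m n where mn: "m \<in> M" "n \<in> N" "y = m + n" using y by auto
    have "bij_betw (\<lambda>t. (m + t, n + t)) (M \<inter> N) {p \<in> M \<times> N. ?f p = y}"
    proof (rule bij_betw_byWitness[where f' = "\<lambda>p. fst p + m"])
      show "\<forall>t\<in>M \<inter> N. fst (m + t, n + t) + m = t"
        by (simp add: word_ac)
      show "\<forall>p\<in>{p \<in> M \<times> N. ?f p = y}. (m + (fst p + m), n + (fst p + m)) = p"
      proof (intro ballI)
        fix p assume "p \<in> {p \<in> M \<times> N. ?f p = y}"
        then obtain a b where p: "p = (a, b)" and "a + b = y" by auto
        have "n + (a + m) = a + (m + n)" by (simp only: word_ac)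
        also have "\<dots> = b" using \<open>a + b = y\<close> mn(3) by (metis word_char2_left)
        finally have "b = n + (a + m)" by simp
        moreover have "m + (a + m) = a" by (simp add: word_ac)
        ultimately show "(m + (fst p + m), n + (fst p + m)) = p" by (simp add: p)
      qed
      show "(\<lambda>t. (m + t, n + t)) ` (M \<inter> N) \<subseteq> {p \<in> M \<times> N. ?f p = y}"
      proof (intro image_subsetI)
        fix t assume "t \<in> M \<inter> N"
        hence t: "t \<in> M" "t \<in> N" by auto
        have "m + t + (n + t) = m + n" by (simp add: word_ac)
        thus "(m + t, n + t) \<in> {p \<in> M \<times> N. ?f p = y}"
          using t mn M N by (auto simp: additive_def)
      qed
      show "(\<lambda>p. fst p + m) ` {p \<in> M \<times> N. ?f p = y} \<subseteq> M \<inter> N"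
      proof (intro image_subsetI)
        fix p assume "p \<in> {p \<in> M \<times> N. ?f p = y}"
        then obtain a b where p: "p = (a, b)" and ab: "a \<in> M" "b \<in> N" "a + b = y" by auto
        have "a + m = (a + b) + (b + m)" by (simp add: word_ac)
        also have "\<dots> = b + n" unfolding ab(3) mn(3) by (simp add: word_ac)
        finally have "a + m = b + n" .
        moreover have "a + m \<in> M" "b + n \<in> N" using ab mn M N by (simp_all add: additive_def)
        ultimately show "fst p + m \<in> M \<inter> N" by (simp add: p)
      qed
    qed
    from bij_betw_same_card[OF this] show ?thesis by simp
  qed
  have "card (M \<times> N) = (\<Sum>p\<in>M \<times> N. 1)" by simp
  also have "\<dots> = (\<Sum>y\<in>?f ` (M \<times> N). \<Sum>p\<in>{p. p \<in> M \<times> N \<and> ?f p = y}. 1)"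
    by (rule sum.image_gen) simp
  also have "\<dots> = (\<Sum>y\<in>?f ` (M \<times> N). card (M \<inter> N))"
    using fib by (intro sum.cong refl) simp
  finally show ?thesis by (simp add: card_cartesian_product)
qed

section \<open>The MDS property\<close>

context
  fixes L :: "('v ^ 'n::finite) set"
  assumes L: "additive L" and card_L: "card L = 4096" and n7: "CARD('n) = 7"
    and orth: "\<And>u v. u \<in> L \<Longrightarrow> v \<in> L \<Longrightarrow> pair u v = 0"
    and low: "\<And>w. (\<And>u. u \<in> L \<Longrightarrow> pair u w = 0) \<Longrightarrow> card {j. w $ j \<noteq> 0} \<le> 3 \<Longrightarrow> w \<in> L"
begin

definition supported :: "'n set \<Rightarrow> ('v ^ 'n) set" where
  "supported A = {u \<in> L. \<forall>j. j \<notin> A \<longrightarrow> u $ j = 0}"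

text \<open>Let \<open>N\<close> consist of the words vanishing on \<open>A\<close>. A word dual to
  \<open>L + N\<close> is dual to \<open>L\<close> and has its support in \<open>A\<close>, so by
  the distance condition it lies in \<open>supported A\<close>; on the other hand
  \<open>L \<inter> N\<close> is \<open>supported (- A)\<close>. Either cardinality times that of
  \<open>L + N\<close> is \<open>16 ^ 7\<close>.\<close>

lemma card_supported_Compl:
  assumes A: "card A = 3"
  shows "card (supported A) = card (supported (- A))"
proof -
  define N where "N = {u :: 'v ^ 'n. \<forall>j. u $ j \<in> (if j \<in> A then {0} else UNIV)}"
  have addN: "additive N" by (auto simp: N_def additive_def)
  have "card N = (\<Prod>j\<in>UNIV. if j \<in> A then 1 else 16)"
    unfolding N_def card_vec_components by (intro prod.cong refl) (simp add: card_letters)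
  also have "\<dots> = 16 ^ card (- A)" by (simp add: prod.If_cases Compl_eq)
  also have "card (- A) = 4" using A n7 by (simp add: Compl_eq_Diff_UNIV card_Diff_subset)
  finally have cN: "card N = 16 ^ 4" .
  let ?M = "(\<lambda>(m, n). m + n) ` (L \<times> N)"
  have "0 + 0 \<in> ?M" using L addN by (intro image_eqI[of _ _ "(0, 0)"]) (auto simp: additive_def)
  moreover have "m + n + (m' + n') \<in> ?M" if "m \<in> L" "n \<in> N" "m' \<in> L" "n' \<in> N" for m n m' n'
    using that L addN by (intro image_eqI[of _ _ "(m + m', n + n')"]) (auto simp: additive_def algebra_simps)
  ultimately have addM: "additive ?M" by (auto simp: additive_def)
  have dual: "{w. \<forall>m\<in>?M. pair m w = 0} = supported A"
  proof (rule subset_antisym; rule subsetI)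
    fix w assume "w \<in> {w. \<forall>m\<in>?M. pair m w = 0}"
    hence w: "pair (m + n) w = 0" if "m \<in> L" "n \<in> N" for m n using that by auto
    have zN: "0 \<in> N" and zL: "0 \<in> L" using addN L by (auto simp: additive_def)
    have wL: "pair u w = 0" if "u \<in> L" for u using w[OF that zN] by simp
    have w0: "w $ j = 0" if j: "j \<notin> A" for j
    proof (rule ccontr)
      assume "w $ j \<noteq> 0"
      then obtain y where y: "s (w $ j) y = 1" using s_nondeg by blast
      have "axis j y \<in> N" using j by (auto simp: N_def axis_def)
      from w[OF zL this] have "pair (axis j y) w = 0" by simp
      thus False using y by (simp add: pair_commute[of _ w] pair_axis)
    qed
    have "{j. w $ j \<noteq> 0} \<subseteq> A" using w0 by auto
    hence "card {j. w $ j \<noteq> 0} \<le> 3" using A by (metis card_mono finite)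
    thus "w \<in> supported A" using low wL w0 by (auto simp: supported_def)
  next
    fix w assume w: "w \<in> supported A"
    have "pair n w = 0" if n: "n \<in> N" for n
      unfolding pair_def
    proof (intro sum.neutral ballI)
      fix j
      have "n $ j \<in> (if j \<in> A then {0} else UNIV)" using n by (simp add: N_def)
      hence "n $ j = 0 \<or> w $ j = 0" using w by (cases "j \<in> A") (auto simp: supported_def)
      thus "s (n $ j) (w $ j) = 0" using s_zero s_commute by metis
    qed
    thus "w \<in> {w. \<forall>m\<in>?M. pair m w = 0}" using w orth by (auto simp: supported_def pair_add)
  qed
  have "L \<inter> N = supported (- A)" by (auto simp: N_def supported_def split: if_splits)
  hence "card ?M * card (supported (- A)) = 4096 * 16 ^ 4"
    using card_sum_additive[OF L addN] by (simp add: card_L cN)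
  moreover have "card ?M * card (supported A) = 16 ^ 7"
    using card_dual[OF addM] by (simp only: dual n7)
  ultimately have "card ?M * card (supported A) = card ?M * card (supported (- A))" by simp
  moreover have "card ?M \<noteq> 0" using \<open>card ?M * card (supported A) = 16 ^ 7\<close> by auto
  ultimately show ?thesis by simp
qed

text \<open>With \<open>B\<close> the three given positions and \<open>l\<close> outside
  \<open>B\<close>, let \<open>A\<close> be the complement of \<open>B\<close> without
  \<open>l\<close>. Complementation gives \<open>card (supported (- B)) = card (supported B) \<le>
  card (supported (- A)) = card (supported A)\<close>, while \<open>supported A\<close> is contained
  in \<open>supported (- B)\<close>. The two coincide, so a word of \<open>L\<close> vanishing on
  \<open>B\<close> vanishes at \<open>l\<close> too.\<close>

lemma zero_of_three_zeros:
  assumes u: "u \<in> L" and ijk: "i \<noteq> j" "i \<noteq> k" "j \<noteq> k" and z: "u $ i = 0" "u $ j = 0" "u $ k = 0"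
  shows "u = 0"
proof -
  let ?B = "{i, j, k}"
  have B: "card ?B = 3" using ijk by simp
  have "u $ l = 0" for l
  proof (cases "l \<in> ?B")
    case False
    let ?A = "- ?B - {l}"
    have "card (- ?B) = 4" using B n7 by (simp add: Compl_eq_Diff_UNIV card_Diff_subset)
    hence A: "card ?A = 3" using False by simp
    have "card (supported (- ?B)) = card (supported ?B)" using card_supported_Compl[OF B] by simp
    also have "\<dots> \<le> card (supported (- ?A))"
      using L card_L by (intro card_mono) (auto simp: supported_def)
    also have "\<dots> = card (supported ?A)" using card_supported_Compl[OF A] by simp
    finally have "supported ?A = supported (- ?B)"
      by (intro card_seteq) (auto simp: supported_def)
    moreover have "u \<in> supported (- ?B)" using u z by (auto simp: supported_def)
    ultimately show ?thesis by (auto simp: supported_def)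
  qed (use z in auto)
  thus ?thesis by (simp add: vec_eq_iff)
qed

text \<open>Three letters determine a word of \<open>L\<close>, and \<open>4096 = 16 ^ 3\<close>, so
  the map to triples of letters is onto.\<close>

lemma three_letters_exist:
  assumes ijk: "i \<noteq> j" "i \<noteq> k" "j \<noteq> k"
  shows "\<exists>u\<in>L. u $ i = x \<and> u $ j = y \<and> u $ k = z"
proof -
  let ?f = "\<lambda>u :: 'v ^ 'n. (u $ i, u $ j, u $ k)"
  have inj: "inj_on ?f L"
  proof (rule inj_onI)
    fix u v assume uv: "u \<in> L" "v \<in> L" "?f u = ?f v"
    hence "u + v = 0" using L ijk
      by (intro zero_of_three_zeros[OF _ ijk]) (auto simp: additive_def char2)
    thus "u = v" using word_char2[of v] by (metis add_right_cancel)
  qed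
  have "?f ` L = UNIV"
    by (rule card_subset_eq) (simp_all add: card_image[OF inj] card_L card_letters)
  hence "(x, y, z) \<in> ?f ` L" by simp
  thus ?thesis by auto
qed

end

end

subsection \<open>The search\<close>

text \<open>
  The search is evaluated by rewriting, hence the explicit tables and the absence of \<open>if\<close>. The
  elements of \<open>F_2^4\<close> are numbered: the coordinates of \<open>ck\<close> are the binary digits of \<open>k\<close>, lowest
  first.
\<close>

datatype h = H bit bit bit bit

instantiation h :: ab_group_add
begin
definition "0 = H 0 0 0 0"
fun plus_h where "H a b c d + H e f g k = H (a + e) (b + f) (c + g) (d + k)"
definition "uminus_h (x::h) = x"
definition "minus_h (x::h) y = x + y"
instance
proof
  fix a b c :: h
  show "a + b + c = a + (b + c)" by (cases a; cases b; cases c) (simp only: plus_h.simps add.assoc)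
  show "a + b = b + a" by (cases a; cases b) (simp only: plus_h.simps add.commute)
  show "0 + a = a" by (cases a) (simp add: zero_h_def)
  show "- a + a = 0" by (cases a) (simp add: zero_h_def uminus_h_def)
  show "a - b = a + - b" by (simp add: minus_h_def uminus_h_def)
qed
end

fun dot :: "h \<Rightarrow> h \<Rightarrow> bit" where
  "dot (H a b c d) (H e f g k) = a * e + b * f + c * g + d * k"

definition "c0 = H 0 0 0 0"
definition "c1 = H 1 0 0 0"
definition "c2 = H 0 1 0 0"
definition "c3 = H 1 1 0 0"
definition "c4 = H 0 0 1 0"
definition "c5 = H 1 0 1 0"
definition "c6 = H 0 1 1 0"
definition "c7 = H 1 1 1 0"
definition "c8 = H 0 0 0 1"
definition "c9 = H 1 0 0 1"
definition "c10 = H 0 1 0 1"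
definition "c11 = H 1 1 0 1"
definition "c12 = H 0 0 1 1"
definition "c13 = H 1 0 1 1"
definition "c14 = H 0 1 1 1"
definition "c15 = H 1 1 1 1"
lemmas c_defs = c0_def c1_def c2_def c3_def c4_def c5_def c6_def c7_def c8_def c9_def c10_def c11_def c12_def
    c13_def c14_def c15_def
lemma h_add_tab:
  "c0 + c0 = c0" "c0 + c1 = c1" "c0 + c2 = c2" "c0 + c3 = c3" "c0 + c4 = c4" "c0 + c5 = c5" "c0 + c6 = c6"
  "c0 + c7 = c7" "c0 + c8 = c8" "c0 + c9 = c9" "c0 + c10 = c10" "c0 + c11 = c11" "c0 + c12 = c12"
  "c0 + c13 = c13" "c0 + c14 = c14" "c0 + c15 = c15"
  "c1 + c0 = c1" "c1 + c1 = c0" "c1 + c2 = c3" "c1 + c3 = c2" "c1 + c4 = c5" "c1 + c5 = c4" "c1 + c6 = c7"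
  "c1 + c7 = c6" "c1 + c8 = c9" "c1 + c9 = c8" "c1 + c10 = c11" "c1 + c11 = c10" "c1 + c12 = c13"
  "c1 + c13 = c12" "c1 + c14 = c15" "c1 + c15 = c14"
  "c2 + c0 = c2" "c2 + c1 = c3" "c2 + c2 = c0" "c2 + c3 = c1" "c2 + c4 = c6" "c2 + c5 = c7" "c2 + c6 = c4"
  "c2 + c7 = c5" "c2 + c8 = c10" "c2 + c9 = c11" "c2 + c10 = c8" "c2 + c11 = c9" "c2 + c12 = c14"
  "c2 + c13 = c15" "c2 + c14 = c12" "c2 + c15 = c13"
  "c3 + c0 = c3" "c3 + c1 = c2" "c3 + c2 = c1" "c3 + c3 = c0" "c3 + c4 = c7" "c3 + c5 = c6" "c3 + c6 = c5"
  "c3 + c7 = c4" "c3 + c8 = c11" "c3 + c9 = c10" "c3 + c10 = c9" "c3 + c11 = c8" "c3 + c12 = c15"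
  "c3 + c13 = c14" "c3 + c14 = c13" "c3 + c15 = c12"
  "c4 + c0 = c4" "c4 + c1 = c5" "c4 + c2 = c6" "c4 + c3 = c7" "c4 + c4 = c0" "c4 + c5 = c1" "c4 + c6 = c2"
  "c4 + c7 = c3" "c4 + c8 = c12" "c4 + c9 = c13" "c4 + c10 = c14" "c4 + c11 = c15" "c4 + c12 = c8"
  "c4 + c13 = c9" "c4 + c14 = c10" "c4 + c15 = c11"
  "c5 + c0 = c5" "c5 + c1 = c4" "c5 + c2 = c7" "c5 + c3 = c6" "c5 + c4 = c1" "c5 + c5 = c0" "c5 + c6 = c3"
  "c5 + c7 = c2" "c5 + c8 = c13" "c5 + c9 = c12" "c5 + c10 = c15" "c5 + c11 = c14" "c5 + c12 = c9"
  "c5 + c13 = c8" "c5 + c14 = c11" "c5 + c15 = c10"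
  "c6 + c0 = c6" "c6 + c1 = c7" "c6 + c2 = c4" "c6 + c3 = c5" "c6 + c4 = c2" "c6 + c5 = c3" "c6 + c6 = c0"
  "c6 + c7 = c1" "c6 + c8 = c14" "c6 + c9 = c15" "c6 + c10 = c12" "c6 + c11 = c13" "c6 + c12 = c10"
  "c6 + c13 = c11" "c6 + c14 = c8" "c6 + c15 = c9"
  "c7 + c0 = c7" "c7 + c1 = c6" "c7 + c2 = c5" "c7 + c3 = c4" "c7 + c4 = c3" "c7 + c5 = c2" "c7 + c6 = c1"
  "c7 + c7 = c0" "c7 + c8 = c15" "c7 + c9 = c14" "c7 + c10 = c13" "c7 + c11 = c12" "c7 + c12 = c11"
  "c7 + c13 = c10" "c7 + c14 = c9" "c7 + c15 = c8"
  "c8 + c0 = c8" "c8 + c1 = c9" "c8 + c2 = c10" "c8 + c3 = c11" "c8 + c4 = c12" "c8 + c5 = c13" "c8 + c6 = c14"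
  "c8 + c7 = c15" "c8 + c8 = c0" "c8 + c9 = c1" "c8 + c10 = c2" "c8 + c11 = c3" "c8 + c12 = c4" "c8 + c13 = c5"
  "c8 + c14 = c6" "c8 + c15 = c7"
  "c9 + c0 = c9" "c9 + c1 = c8" "c9 + c2 = c11" "c9 + c3 = c10" "c9 + c4 = c13" "c9 + c5 = c12" "c9 + c6 = c15"
  "c9 + c7 = c14" "c9 + c8 = c1" "c9 + c9 = c0" "c9 + c10 = c3" "c9 + c11 = c2" "c9 + c12 = c5" "c9 + c13 = c4"
  "c9 + c14 = c7" "c9 + c15 = c6"
  "c10 + c0 = c10" "c10 + c1 = c11" "c10 + c2 = c8" "c10 + c3 = c9" "c10 + c4 = c14" "c10 + c5 = c15"
  "c10 + c6 = c12" "c10 + c7 = c13" "c10 + c8 = c2" "c10 + c9 = c3" "c10 + c10 = c0" "c10 + c11 = c1"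
  "c10 + c12 = c6" "c10 + c13 = c7" "c10 + c14 = c4" "c10 + c15 = c5"
  "c11 + c0 = c11" "c11 + c1 = c10" "c11 + c2 = c9" "c11 + c3 = c8" "c11 + c4 = c15" "c11 + c5 = c14"
  "c11 + c6 = c13" "c11 + c7 = c12" "c11 + c8 = c3" "c11 + c9 = c2" "c11 + c10 = c1" "c11 + c11 = c0"
  "c11 + c12 = c7" "c11 + c13 = c6" "c11 + c14 = c5" "c11 + c15 = c4"
  "c12 + c0 = c12" "c12 + c1 = c13" "c12 + c2 = c14" "c12 + c3 = c15" "c12 + c4 = c8" "c12 + c5 = c9"
  "c12 + c6 = c10" "c12 + c7 = c11" "c12 + c8 = c4" "c12 + c9 = c5" "c12 + c10 = c6" "c12 + c11 = c7"
  "c12 + c12 = c0" "c12 + c13 = c1" "c12 + c14 = c2" "c12 + c15 = c3"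
  "c13 + c0 = c13" "c13 + c1 = c12" "c13 + c2 = c15" "c13 + c3 = c14" "c13 + c4 = c9" "c13 + c5 = c8"
  "c13 + c6 = c11" "c13 + c7 = c10" "c13 + c8 = c5" "c13 + c9 = c4" "c13 + c10 = c7" "c13 + c11 = c6"
  "c13 + c12 = c1" "c13 + c13 = c0" "c13 + c14 = c3" "c13 + c15 = c2"
  "c14 + c0 = c14" "c14 + c1 = c15" "c14 + c2 = c12" "c14 + c3 = c13" "c14 + c4 = c10" "c14 + c5 = c11"
  "c14 + c6 = c8" "c14 + c7 = c9" "c14 + c8 = c6" "c14 + c9 = c7" "c14 + c10 = c4" "c14 + c11 = c5"
  "c14 + c12 = c2" "c14 + c13 = c3" "c14 + c14 = c0" "c14 + c15 = c1"
  "c15 + c0 = c15" "c15 + c1 = c14" "c15 + c2 = c13" "c15 + c3 = c12" "c15 + c4 = c11" "c15 + c5 = c10"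
  "c15 + c6 = c9" "c15 + c7 = c8" "c15 + c8 = c7" "c15 + c9 = c6" "c15 + c10 = c5" "c15 + c11 = c4"
  "c15 + c12 = c3" "c15 + c13 = c2" "c15 + c14 = c1" "c15 + c15 = c0"
  by (simp_all add: c_defs)
lemma dot_tab:
  "dot c0 c0 = 0" "dot c0 c1 = 0" "dot c0 c2 = 0" "dot c0 c3 = 0" "dot c0 c4 = 0" "dot c0 c5 = 0"
  "dot c0 c6 = 0" "dot c0 c7 = 0" "dot c0 c8 = 0" "dot c0 c9 = 0" "dot c0 c10 = 0" "dot c0 c11 = 0"
  "dot c0 c12 = 0" "dot c0 c13 = 0" "dot c0 c14 = 0" "dot c0 c15 = 0"
  "dot c1 c0 = 0" "dot c1 c1 = 1" "dot c1 c2 = 0" "dot c1 c3 = 1" "dot c1 c4 = 0" "dot c1 c5 = 1"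
  "dot c1 c6 = 0" "dot c1 c7 = 1" "dot c1 c8 = 0" "dot c1 c9 = 1" "dot c1 c10 = 0" "dot c1 c11 = 1"
  "dot c1 c12 = 0" "dot c1 c13 = 1" "dot c1 c14 = 0" "dot c1 c15 = 1"
  "dot c2 c0 = 0" "dot c2 c1 = 0" "dot c2 c2 = 1" "dot c2 c3 = 1" "dot c2 c4 = 0" "dot c2 c5 = 0"
  "dot c2 c6 = 1" "dot c2 c7 = 1" "dot c2 c8 = 0" "dot c2 c9 = 0" "dot c2 c10 = 1" "dot c2 c11 = 1"
  "dot c2 c12 = 0" "dot c2 c13 = 0" "dot c2 c14 = 1" "dot c2 c15 = 1"
  "dot c3 c0 = 0" "dot c3 c1 = 1" "dot c3 c2 = 1" "dot c3 c3 = 0" "dot c3 c4 = 0" "dot c3 c5 = 1"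
  "dot c3 c6 = 1" "dot c3 c7 = 0" "dot c3 c8 = 0" "dot c3 c9 = 1" "dot c3 c10 = 1" "dot c3 c11 = 0"
  "dot c3 c12 = 0" "dot c3 c13 = 1" "dot c3 c14 = 1" "dot c3 c15 = 0"
  "dot c4 c0 = 0" "dot c4 c1 = 0" "dot c4 c2 = 0" "dot c4 c3 = 0" "dot c4 c4 = 1" "dot c4 c5 = 1"
  "dot c4 c6 = 1" "dot c4 c7 = 1" "dot c4 c8 = 0" "dot c4 c9 = 0" "dot c4 c10 = 0" "dot c4 c11 = 0"
  "dot c4 c12 = 1" "dot c4 c13 = 1" "dot c4 c14 = 1" "dot c4 c15 = 1"
  "dot c5 c0 = 0" "dot c5 c1 = 1" "dot c5 c2 = 0" "dot c5 c3 = 1" "dot c5 c4 = 1" "dot c5 c5 = 0"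
  "dot c5 c6 = 1" "dot c5 c7 = 0" "dot c5 c8 = 0" "dot c5 c9 = 1" "dot c5 c10 = 0" "dot c5 c11 = 1"
  "dot c5 c12 = 1" "dot c5 c13 = 0" "dot c5 c14 = 1" "dot c5 c15 = 0"
  "dot c6 c0 = 0" "dot c6 c1 = 0" "dot c6 c2 = 1" "dot c6 c3 = 1" "dot c6 c4 = 1" "dot c6 c5 = 1"
  "dot c6 c6 = 0" "dot c6 c7 = 0" "dot c6 c8 = 0" "dot c6 c9 = 0" "dot c6 c10 = 1" "dot c6 c11 = 1"
  "dot c6 c12 = 1" "dot c6 c13 = 1" "dot c6 c14 = 0" "dot c6 c15 = 0"
  "dot c7 c0 = 0" "dot c7 c1 = 1" "dot c7 c2 = 1" "dot c7 c3 = 0" "dot c7 c4 = 1" "dot c7 c5 = 0"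
  "dot c7 c6 = 0" "dot c7 c7 = 1" "dot c7 c8 = 0" "dot c7 c9 = 1" "dot c7 c10 = 1" "dot c7 c11 = 0"
  "dot c7 c12 = 1" "dot c7 c13 = 0" "dot c7 c14 = 0" "dot c7 c15 = 1"
  "dot c8 c0 = 0" "dot c8 c1 = 0" "dot c8 c2 = 0" "dot c8 c3 = 0" "dot c8 c4 = 0" "dot c8 c5 = 0"
  "dot c8 c6 = 0" "dot c8 c7 = 0" "dot c8 c8 = 1" "dot c8 c9 = 1" "dot c8 c10 = 1" "dot c8 c11 = 1"
  "dot c8 c12 = 1" "dot c8 c13 = 1" "dot c8 c14 = 1" "dot c8 c15 = 1"
  "dot c9 c0 = 0" "dot c9 c1 = 1" "dot c9 c2 = 0" "dot c9 c3 = 1" "dot c9 c4 = 0" "dot c9 c5 = 1"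
  "dot c9 c6 = 0" "dot c9 c7 = 1" "dot c9 c8 = 1" "dot c9 c9 = 0" "dot c9 c10 = 1" "dot c9 c11 = 0"
  "dot c9 c12 = 1" "dot c9 c13 = 0" "dot c9 c14 = 1" "dot c9 c15 = 0"
  "dot c10 c0 = 0" "dot c10 c1 = 0" "dot c10 c2 = 1" "dot c10 c3 = 1" "dot c10 c4 = 0" "dot c10 c5 = 0"
  "dot c10 c6 = 1" "dot c10 c7 = 1" "dot c10 c8 = 1" "dot c10 c9 = 1" "dot c10 c10 = 0" "dot c10 c11 = 0"
  "dot c10 c12 = 1" "dot c10 c13 = 1" "dot c10 c14 = 0" "dot c10 c15 = 0"
  "dot c11 c0 = 0" "dot c11 c1 = 1" "dot c11 c2 = 1" "dot c11 c3 = 0" "dot c11 c4 = 0" "dot c11 c5 = 1"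
  "dot c11 c6 = 1" "dot c11 c7 = 0" "dot c11 c8 = 1" "dot c11 c9 = 0" "dot c11 c10 = 0" "dot c11 c11 = 1"
  "dot c11 c12 = 1" "dot c11 c13 = 0" "dot c11 c14 = 0" "dot c11 c15 = 1"
  "dot c12 c0 = 0" "dot c12 c1 = 0" "dot c12 c2 = 0" "dot c12 c3 = 0" "dot c12 c4 = 1" "dot c12 c5 = 1"
  "dot c12 c6 = 1" "dot c12 c7 = 1" "dot c12 c8 = 1" "dot c12 c9 = 1" "dot c12 c10 = 1" "dot c12 c11 = 1"
  "dot c12 c12 = 0" "dot c12 c13 = 0" "dot c12 c14 = 0" "dot c12 c15 = 0"
  "dot c13 c0 = 0" "dot c13 c1 = 1" "dot c13 c2 = 0" "dot c13 c3 = 1" "dot c13 c4 = 1" "dot c13 c5 = 0"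
  "dot c13 c6 = 1" "dot c13 c7 = 0" "dot c13 c8 = 1" "dot c13 c9 = 0" "dot c13 c10 = 1" "dot c13 c11 = 0"
  "dot c13 c12 = 0" "dot c13 c13 = 1" "dot c13 c14 = 0" "dot c13 c15 = 1"
  "dot c14 c0 = 0" "dot c14 c1 = 0" "dot c14 c2 = 1" "dot c14 c3 = 1" "dot c14 c4 = 1" "dot c14 c5 = 1"
  "dot c14 c6 = 0" "dot c14 c7 = 0" "dot c14 c8 = 1" "dot c14 c9 = 1" "dot c14 c10 = 0" "dot c14 c11 = 0"
  "dot c14 c12 = 0" "dot c14 c13 = 0" "dot c14 c14 = 1" "dot c14 c15 = 1"
  "dot c15 c0 = 0" "dot c15 c1 = 1" "dot c15 c2 = 1" "dot c15 c3 = 0" "dot c15 c4 = 1" "dot c15 c5 = 0"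
  "dot c15 c6 = 0" "dot c15 c7 = 1" "dot c15 c8 = 1" "dot c15 c9 = 0" "dot c15 c10 = 0" "dot c15 c11 = 1"
  "dot c15 c12 = 0" "dot c15 c13 = 1" "dot c15 c14 = 1" "dot c15 c15 = 0"
  by (simp_all add: c_defs)
text \<open>A function on \<open>h\<close> stored by its 16 values, so that one rewrite rule per
  index evaluates it; nesting gives tables in two or three letters.\<close>

datatype 'a nd = N 'a 'a 'a 'a 'a 'a 'a 'a 'a 'a 'a 'a 'a 'a 'a 'a
fun sel :: "'a nd \<Rightarrow> h \<Rightarrow> 'a" where
  "sel (N x0 x1 x2 x3 x4 x5 x6 x7 x8 x9 x10 x11 x12 x13 x14 x15) (H a b c d) = (if d = 0 then (if c = 0 then (if
    b = 0 then (if a = 0 then x0 else x1) else (if a = 0 then x2 else x3)) else (if b = 0 then (if a = 0 then x4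
      else x5) else (if a = 0 then x6 else x7))) else (if c = 0 then (if b = 0 then (if a = 0 then x8 else x9)
        else (if a = 0 then x10 else x11)) else (if b = 0 then (if a = 0 then x12 else x13) else (if a = 0 then
          x14 else x15))))"
lemma sel_tab:
  "sel (N x0 x1 x2 x3 x4 x5 x6 x7 x8 x9 x10 x11 x12 x13 x14 x15) c0 = x0"
  "sel (N x0 x1 x2 x3 x4 x5 x6 x7 x8 x9 x10 x11 x12 x13 x14 x15) c1 = x1"
  "sel (N x0 x1 x2 x3 x4 x5 x6 x7 x8 x9 x10 x11 x12 x13 x14 x15) c2 = x2"
  "sel (N x0 x1 x2 x3 x4 x5 x6 x7 x8 x9 x10 x11 x12 x13 x14 x15) c3 = x3"
  "sel (N x0 x1 x2 x3 x4 x5 x6 x7 x8 x9 x10 x11 x12 x13 x14 x15) c4 = x4"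
  "sel (N x0 x1 x2 x3 x4 x5 x6 x7 x8 x9 x10 x11 x12 x13 x14 x15) c5 = x5"
  "sel (N x0 x1 x2 x3 x4 x5 x6 x7 x8 x9 x10 x11 x12 x13 x14 x15) c6 = x6"
  "sel (N x0 x1 x2 x3 x4 x5 x6 x7 x8 x9 x10 x11 x12 x13 x14 x15) c7 = x7"
  "sel (N x0 x1 x2 x3 x4 x5 x6 x7 x8 x9 x10 x11 x12 x13 x14 x15) c8 = x8"
  "sel (N x0 x1 x2 x3 x4 x5 x6 x7 x8 x9 x10 x11 x12 x13 x14 x15) c9 = x9"
  "sel (N x0 x1 x2 x3 x4 x5 x6 x7 x8 x9 x10 x11 x12 x13 x14 x15) c10 = x10"
  "sel (N x0 x1 x2 x3 x4 x5 x6 x7 x8 x9 x10 x11 x12 x13 x14 x15) c11 = x11"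
  "sel (N x0 x1 x2 x3 x4 x5 x6 x7 x8 x9 x10 x11 x12 x13 x14 x15) c12 = x12"
  "sel (N x0 x1 x2 x3 x4 x5 x6 x7 x8 x9 x10 x11 x12 x13 x14 x15) c13 = x13"
  "sel (N x0 x1 x2 x3 x4 x5 x6 x7 x8 x9 x10 x11 x12 x13 x14 x15) c14 = x14"
  "sel (N x0 x1 x2 x3 x4 x5 x6 x7 x8 x9 x10 x11 x12 x13 x14 x15) c15 = x15"
  by (simp_all add: c_defs)
text \<open>Equality of \<open>u\<close> and \<open>v\<close> is tested as
  \<open>isz (u + v)\<close>, which takes 16 rules instead of 256.\<close>

definition isz :: "h \<Rightarrow> bool" where "isz x \<longleftrightarrow> x = 0"
lemma isz_tab:
  "isz c0 = True" "isz c1 = False" "isz c2 = False" "isz c3 = False" "isz c4 = False" "isz c5 = False"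
  "isz c6 = False" "isz c7 = False" "isz c8 = False" "isz c9 = False" "isz c10 = False" "isz c11 = False"
  "isz c12 = False" "isz c13 = False" "isz c14 = False" "isz c15 = False"
  by (simp_all add: isz_def zero_h_def c_defs)
definition upd :: "'a nd \<Rightarrow> h \<Rightarrow> 'a \<Rightarrow> 'a nd" where
  "upd n k y = N (if isz (k + c0) then y else sel n c0) (if isz (k + c1) then y else sel n c1) (if isz (k + c2)
    then y else sel n c2) (if isz (k + c3) then y else sel n c3) (if isz (k + c4) then y else sel n c4) (if isz
      (k + c5) then y else sel n c5) (if isz (k + c6) then y else sel n c6) (if isz (k + c7) then y else sel n
        c7) (if isz (k + c8) then y else sel n c8) (if isz (k + c9) then y else sel n c9) (if isz (k + c10) then
          y else sel n c10) (if isz (k + c11) then y else sel n c11) (if isz (k + c12) then y else sel n c12)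
            (if isz (k + c13) then y else sel n c13) (if isz (k + c14) then y else sel n c14) (if isz (k + c15)
              then y else sel n c15)"
lemma upd_tab:
  "upd (N x0 x1 x2 x3 x4 x5 x6 x7 x8 x9 x10 x11 x12 x13 x14 x15) c0 y = N y x1 x2 x3 x4 x5 x6 x7 x8 x9 x10 x11
    x12 x13 x14 x15"
  "upd (N x0 x1 x2 x3 x4 x5 x6 x7 x8 x9 x10 x11 x12 x13 x14 x15) c1 y = N x0 y x2 x3 x4 x5 x6 x7 x8 x9 x10 x11
    x12 x13 x14 x15"
  "upd (N x0 x1 x2 x3 x4 x5 x6 x7 x8 x9 x10 x11 x12 x13 x14 x15) c2 y = N x0 x1 y x3 x4 x5 x6 x7 x8 x9 x10 x11
    x12 x13 x14 x15"
  "upd (N x0 x1 x2 x3 x4 x5 x6 x7 x8 x9 x10 x11 x12 x13 x14 x15) c3 y = N x0 x1 x2 y x4 x5 x6 x7 x8 x9 x10 x11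
    x12 x13 x14 x15"
  "upd (N x0 x1 x2 x3 x4 x5 x6 x7 x8 x9 x10 x11 x12 x13 x14 x15) c4 y = N x0 x1 x2 x3 y x5 x6 x7 x8 x9 x10 x11
    x12 x13 x14 x15"
  "upd (N x0 x1 x2 x3 x4 x5 x6 x7 x8 x9 x10 x11 x12 x13 x14 x15) c5 y = N x0 x1 x2 x3 x4 y x6 x7 x8 x9 x10 x11
    x12 x13 x14 x15"
  "upd (N x0 x1 x2 x3 x4 x5 x6 x7 x8 x9 x10 x11 x12 x13 x14 x15) c6 y = N x0 x1 x2 x3 x4 x5 y x7 x8 x9 x10 x11
    x12 x13 x14 x15"
  "upd (N x0 x1 x2 x3 x4 x5 x6 x7 x8 x9 x10 x11 x12 x13 x14 x15) c7 y = N x0 x1 x2 x3 x4 x5 x6 y x8 x9 x10 x11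
    x12 x13 x14 x15"
  "upd (N x0 x1 x2 x3 x4 x5 x6 x7 x8 x9 x10 x11 x12 x13 x14 x15) c8 y = N x0 x1 x2 x3 x4 x5 x6 x7 y x9 x10 x11
    x12 x13 x14 x15"
  "upd (N x0 x1 x2 x3 x4 x5 x6 x7 x8 x9 x10 x11 x12 x13 x14 x15) c9 y = N x0 x1 x2 x3 x4 x5 x6 x7 x8 y x10 x11
    x12 x13 x14 x15"
  "upd (N x0 x1 x2 x3 x4 x5 x6 x7 x8 x9 x10 x11 x12 x13 x14 x15) c10 y = N x0 x1 x2 x3 x4 x5 x6 x7 x8 x9 y x11
    x12 x13 x14 x15"
  "upd (N x0 x1 x2 x3 x4 x5 x6 x7 x8 x9 x10 x11 x12 x13 x14 x15) c11 y = N x0 x1 x2 x3 x4 x5 x6 x7 x8 x9 x10 y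
    x12 x13 x14 x15"
  "upd (N x0 x1 x2 x3 x4 x5 x6 x7 x8 x9 x10 x11 x12 x13 x14 x15) c12 y = N x0 x1 x2 x3 x4 x5 x6 x7 x8 x9 x10 x11
    y x13 x14 x15"
  "upd (N x0 x1 x2 x3 x4 x5 x6 x7 x8 x9 x10 x11 x12 x13 x14 x15) c13 y = N x0 x1 x2 x3 x4 x5 x6 x7 x8 x9 x10 x11
    x12 y x14 x15"
  "upd (N x0 x1 x2 x3 x4 x5 x6 x7 x8 x9 x10 x11 x12 x13 x14 x15) c14 y = N x0 x1 x2 x3 x4 x5 x6 x7 x8 x9 x10 x11
    x12 x13 y x15"
  "upd (N x0 x1 x2 x3 x4 x5 x6 x7 x8 x9 x10 x11 x12 x13 x14 x15) c15 y = N x0 x1 x2 x3 x4 x5 x6 x7 x8 x9 x10 x11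
    x12 x13 x14 y"
  by (simp_all only: upd_def h_add_tab isz_tab sel_tab if_True if_False)

text \<open>
  A word on the positions \<open>IA, ..., IE\<close> is normalised by adding a constant word, so that its letter
  at \<open>IA\<close> is zero; \<open>V a b c d\<close> lists the other letters. A table \<open>A\<close> records the triples \<open>(a, b, c)\<close>
  that are not yet excluded in words of \<open>Y\<close> and \<open>X\<close>, the last letter being determined by
  orthogonality to the constant words. A table \<open>M\<close> similarly records the words with no three equal
  letters, to which the sums \<open>y + x\<close> belong.
\<close>

datatype vec = V h h h h
fun addv :: "vec \<Rightarrow> vec \<Rightarrow> vec" where
  "addv (V a b c d) (V e f g k) = V (a + e) (b + f) (c + g) (d + k)"

fun va :: "vec \<Rightarrow> h" where "va (V a b c d) = a"

text \<open>The table is already specialised to the first letter of the sum and the fourth letter is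
  determined, so two letters remain to be looked up.\<close>

fun ok :: "bool nd nd \<Rightarrow> vec \<Rightarrow> vec \<Rightarrow> bool" where
  "ok n (V a b c d) (V e f g k) = sel (sel n (b + f)) (c + g)"

text \<open>Replaces a conditional: no equation applies before the test has been rewritten to a
  Boolean constant.\<close>

primrec keep :: "bool \<Rightarrow> 'a \<Rightarrow> 'a list \<Rightarrow> 'a list" where
  "keep True x r = x # r" | "keep False x r = r"

primrec filt :: "bool nd nd \<Rightarrow> vec \<Rightarrow> vec list \<Rightarrow> vec list" where
  "filt n y [] = []" | "filt n y (w # ws) = keep (ok n y w) w (filt n y ws)"

text \<open>The words in \<open>ws\<close> share the letter \<open>a\<close> at \<open>IB\<close>,
  so each \<open>y\<close> selects one subtable for the whole list; the middle equation stops once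
  no candidate is left.\<close>

fun filts :: "bool nd nd nd \<Rightarrow> h \<Rightarrow> vec list \<Rightarrow> vec list \<Rightarrow> vec list" where
  "filts A a [] ws = ws"
| "filts A a (y # ys) [] = []"
| "filts A a (y # ys) (w # ws) = filts A a ys (filt (sel A (va y + a)) y (w # ws))"

primrec adds :: "vec \<Rightarrow> vec list \<Rightarrow> vec list" where
  "adds v [] = []" | "adds v (w # ws) = addv v w # adds v ws"

fun filtss :: "bool nd nd nd \<Rightarrow> h \<Rightarrow> vec list \<Rightarrow> vec list \<Rightarrow> vec list \<Rightarrow> vec list" where
  "filtss M a Y [] ws = ws"
| "filtss M a Y (s # ss) [] = []"
| "filtss M a Y (s # ss) (w # ws) = filtss M a Y ss (filts M a (adds s Y) (w # ws))"

definition ext :: "bool nd nd nd \<Rightarrow> bool nd nd nd \<Rightarrow> h \<Rightarrow> vec list \<Rightarrow> vec list \<Rightarrow> vec list \<Rightarrow> vec list" where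
  "ext A M a Y S C = filtss M a Y S (filts A a S C)"

definition orth :: "bit \<Rightarrow> bool" where "orth x \<longleftrightarrow> x = 0"

fun dotv :: "vec \<Rightarrow> vec \<Rightarrow> bit" where
  "dotv (V a b c d) (V e f g k) = dot a e + dot b f + dot c g + dot d k"

text \<open>Gram matrices of the forms at \<open>IB\<close>, ..., \<open>IE\<close>, as tables of
  the linear maps they define; \<open>IA\<close> is absent because normalised words vanish
  there.\<close>

datatype forms = Forms "h nd" "h nd" "h nd" "h nd"

fun cov :: "forms \<Rightarrow> vec \<Rightarrow> vec" where
  "cov (Forms p q r s) (V a b c d) = V (sel p a) (sel q b) (sel r c) (sel s d)"

primrec filtO :: "vec \<Rightarrow> vec list \<Rightarrow> vec list" where
  "filtO y [] = []" | "filtO y (w # ws) = keep (orth (dotv y w)) w (filtO y ws)"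

definition pfv :: "forms \<Rightarrow> vec \<Rightarrow> vec \<Rightarrow> vec \<Rightarrow> vec \<Rightarrow> bit" where
  "pfv W x y z t = dotv (cov W x) y * dotv (cov W z) t + dotv (cov W x) z * dotv (cov W y) t
     + dotv (cov W x) t * dotv (cov W y) z"

text \<open>
  The functions \<open>f2, f3, f4\<close> extend a word \<open>y1\<close> to a basis of \<open>Y\<close> modulo the constant words, with
  letters \<open>c1, c2, c4, c8\<close> at \<open>IB\<close>, and \<open>g1, ..., g4\<close> then look for such a basis of \<open>X\<close>. A full
  basis is rejected if and only if the Pfaffian \<open>pfv\<close> of its Gram matrix vanishes. The value \<open>True\<close>
  means that \<open>y1\<close> is refuted.
\<close>

primrec g4 :: "forms \<Rightarrow> vec \<Rightarrow> vec \<Rightarrow> vec \<Rightarrow> vec list \<Rightarrow> bool" where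
  "g4 W x1 x2 x3 [] = True"
| "g4 W x1 x2 x3 (x4 # xs) = (orth (pfv W x1 x2 x3 x4) \<and> g4 W x1 x2 x3 xs)"

primrec g3 :: "bool nd nd nd \<Rightarrow> bool nd nd nd \<Rightarrow> forms \<Rightarrow> vec list \<Rightarrow> vec \<Rightarrow> vec \<Rightarrow> vec list \<Rightarrow> vec list \<Rightarrow> bool" where
  "g3 A M W Y x1 x2 C4 [] = True"
| "g3 A M W Y x1 x2 C4 (x3 # xs) =
     (g4 W x1 x2 x3 (ext A M c8 Y [x1, x2, addv x1 x2, x3, addv x3 x1, addv x3 x2, addv x3 (addv x1 x2)] C4)
      \<and> g3 A M W Y x1 x2 C4 xs)"

primrec g2 :: "bool nd nd nd \<Rightarrow> bool nd nd nd \<Rightarrow> forms \<Rightarrow> vec list \<Rightarrow> vec \<Rightarrow> vec list \<Rightarrow> vec list \<Rightarrow> vec list \<Rightarrow> bool" where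
  "g2 A M W Y x1 C3 C4 [] = True"
| "g2 A M W Y x1 C3 C4 (x2 # xs) =
     (g3 A M W Y x1 x2 C4 (ext A M c4 Y [x1, x2, addv x1 x2] C3) \<and> g2 A M W Y x1 C3 C4 xs)"

primrec g1 :: "bool nd nd nd \<Rightarrow> bool nd nd nd \<Rightarrow> forms \<Rightarrow> vec list \<Rightarrow> vec list \<Rightarrow> vec list \<Rightarrow> vec list \<Rightarrow> vec list \<Rightarrow>
    bool" where
  "g1 A M W Y C2 C3 C4 [] = True"
| "g1 A M W Y C2 C3 C4 (x1 # xs) = (g2 A M W Y x1 C3 C4 (ext A M c2 Y [x1] C2) \<and> g1 A M W Y C2 C3 C4 xs)"

text \<open>In the search the candidates are already orthogonal to \<open>y1\<close> and
  \<open>y2\<close>; orthogonality to the last two basis words and the test of the sums with the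
  completed \<open>Y\<close> remain.\<close>

definition restr :: "bool nd nd nd \<Rightarrow> forms \<Rightarrow> h \<Rightarrow> vec list \<Rightarrow> vec \<Rightarrow> vec \<Rightarrow> vec list \<Rightarrow> vec list" where
  "restr M W a Y y3 y4 X = filts M a Y (filtO (cov W y4) (filtO (cov W y3) X))"

definition leaf :: "bool nd nd nd \<Rightarrow> bool nd nd nd \<Rightarrow> forms \<Rightarrow> vec list \<Rightarrow> vec \<Rightarrow> vec \<Rightarrow>
    vec list \<Rightarrow> vec list \<Rightarrow> vec list \<Rightarrow> vec list \<Rightarrow> bool" where
  "leaf A M W Y y3 y4 X1 X2 X3 X4 =
     g1 A M W Y (restr M W c2 Y y3 y4 X2) (restr M W c4 Y y3 y4 X3) (restr M W c8 Y y3 y4 X4) (restr M W c1 Y y3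
       y4 X1)"

definition dbl :: "vec \<Rightarrow> vec list \<Rightarrow> vec list" where "dbl y Y = Y @ adds y Y"

primrec tst :: "bool \<Rightarrow> bool nd nd nd \<Rightarrow> bool nd nd nd \<Rightarrow> forms \<Rightarrow> vec list \<Rightarrow> vec \<Rightarrow> vec \<Rightarrow>
    vec list \<Rightarrow> vec list \<Rightarrow> vec list \<Rightarrow> vec list \<Rightarrow> bool" where
  "tst True A M W Y y3 y4 X1 X2 X3 X4 = True"
| "tst False A M W Y y3 y4 X1 X2 X3 X4 = leaf A M W (dbl y4 Y) y3 y4 X1 X2 X3 X4"

primrec f4 :: "bool nd nd nd \<Rightarrow> bool nd nd nd \<Rightarrow> forms \<Rightarrow> vec list \<Rightarrow> vec \<Rightarrow> vec \<Rightarrow> vec \<Rightarrow>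
    vec list \<Rightarrow> vec list \<Rightarrow> vec list \<Rightarrow> vec list \<Rightarrow> vec list \<Rightarrow> bool" where
  "f4 A M W Y y1 y2 y3 X1 X2 X3 X4 [] = True"
| "f4 A M W Y y1 y2 y3 X1 X2 X3 X4 (y4 # ys) =
     (tst (orth (pfv W y1 y2 y3 y4)) A M W Y y3 y4 X1 X2 X3 X4 \<and> f4 A M W Y y1 y2 y3 X1 X2 X3 X4 ys)"

primrec f3 :: "bool nd nd nd \<Rightarrow> bool nd nd nd \<Rightarrow> forms \<Rightarrow> vec list \<Rightarrow> vec \<Rightarrow> vec \<Rightarrow> vec list \<Rightarrow>
    vec list \<Rightarrow> vec list \<Rightarrow> vec list \<Rightarrow> vec list \<Rightarrow> vec list \<Rightarrow> bool" where
  "f3 A M W Y y1 y2 L4 X1 X2 X3 X4 [] = True"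
| "f3 A M W Y y1 y2 L4 X1 X2 X3 X4 (y3 # ys) =
     (f4 A M W (dbl y3 Y) y1 y2 y3 X1 X2 X3 X4 (filts A c8 (adds y3 Y) L4)
      \<and> f3 A M W Y y1 y2 L4 X1 X2 X3 X4 ys)"

primrec f2 :: "bool nd nd nd \<Rightarrow> bool nd nd nd \<Rightarrow> forms \<Rightarrow> vec list \<Rightarrow> vec \<Rightarrow> vec list \<Rightarrow> vec list \<Rightarrow>
    vec list \<Rightarrow> vec list \<Rightarrow> vec list \<Rightarrow> vec list \<Rightarrow> vec list \<Rightarrow> bool" where
  "f2 A M W Y y1 L3 L4 X1 X2 X3 X4 [] = True"
| "f2 A M W Y y1 L3 L4 X1 X2 X3 X4 (y2 # ys) =
     (f3 A M W (dbl y2 Y) y1 y2 (filts A c8 (adds y2 Y) L4)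
        (filtO (cov W y2) X1) (filtO (cov W y2) X2) (filtO (cov W y2) X3) (filtO (cov W y2) X4)
        (filts A c4 (adds y2 Y) L3)
      \<and> f2 A M W Y y1 L3 L4 X1 X2 X3 X4 ys)"

text \<open>Orthogonality to the constant words says that the Gram matrices applied to the letters
  sum to zero; \<open>E\<close> inverts the matrix at \<open>IE\<close> and so solves for the last
  letter.\<close>

fun lst :: "forms \<Rightarrow> h nd \<Rightarrow> h \<Rightarrow> h \<Rightarrow> h \<Rightarrow> h" where
  "lst (Forms p q r s) E a b c = sel E (sel p a + sel q b + sel r c)"

primrec colc :: "forms \<Rightarrow> h nd \<Rightarrow> bool nd \<Rightarrow> h \<Rightarrow> h \<Rightarrow> vec list \<Rightarrow> h list \<Rightarrow> vec list" where
  "colc W E n a b r [] = r"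
| "colc W E n a b r (c # cs) = keep (sel n c) (V a b c (lst W E a b c)) (colc W E n a b r cs)"

primrec colb :: "forms \<Rightarrow> h nd \<Rightarrow> bool nd nd \<Rightarrow> h \<Rightarrow> h list \<Rightarrow> vec list" where
  "colb W E n a [] = []" | "colb W E n a (b # bs) = colc W E (sel n b) a b (colb W E n a bs) [c0, c1, c2, c3,
    c4, c5, c6, c7, c8, c9, c10, c11, c12, c13, c14, c15]"

definition col :: "forms \<Rightarrow> h nd \<Rightarrow> bool nd nd nd \<Rightarrow> h \<Rightarrow> vec list" where "col W E A a = colb W E (sel A a) a [c0,
    c1, c2, c3, c4, c5, c6, c7, c8, c9, c10, c11, c12, c13, c14, c15]"

definition root1 :: "bool nd nd nd \<Rightarrow> bool nd nd nd \<Rightarrow> forms \<Rightarrow> vec \<Rightarrow> vec list \<Rightarrow> vec list \<Rightarrow> vec list \<Rightarrow> vec list \<Rightarrow>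
    bool" where
  "root1 A M W y D1 D2 D4 D8 =
     f2 A M W [V c0 c0 c0 c0, y] y (filts A c4 [y] D4) (filts A c8 [y] D8)
       (filtO (cov W y) D1) (filtO (cov W y) D2) (filtO (cov W y) D4) (filtO (cov W y) D8) (filts A c2 [y] D2)"

definition root :: "h nd \<Rightarrow> bool nd nd nd \<Rightarrow> bool nd nd nd \<Rightarrow> forms \<Rightarrow> vec \<Rightarrow> bool" where
  "root E A M W y = root1 A M W y (col W E A c1) (col W E A c2) (col W E A c4) (col W E A c8)"

section \<open>Refuted words and their orbits\<close>

fun delA :: "bool nd nd nd \<Rightarrow> vec \<Rightarrow> bool nd nd nd" where
  "delA A (V a b c d) = upd A a (upd (sel A a) b (upd (sel (sel A a) b) c False))"

datatype i5 = IA | IB | IC | ID | IE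

fun pick :: "i5 \<Rightarrow> vec \<Rightarrow> h" where
  "pick IA (V a b c d) = c0" | "pick IB (V a b c d) = a" | "pick IC (V a b c d) = b"
| "pick ID (V a b c d) = c" | "pick IE (V a b c d) = d"

datatype sym = Sym h h h h i5 i5 i5 i5 i5

definition nrm :: "h \<Rightarrow> h \<Rightarrow> h \<Rightarrow> h \<Rightarrow> h \<Rightarrow> vec" where
  "nrm z a b c d = V (a + z) (b + z) (c + z) (d + z)"

definition mk :: "h \<Rightarrow> h \<Rightarrow> h \<Rightarrow> h \<Rightarrow> h nd" where
  "mk a b c d = N c0 a b (a + b) c (a + c) (b + c) (a + b + c) d (a + d) (b + d) (a + b + d) (c + d) (a + c + d)
    (b + c + d) (a + b + c + d)"

definition appn :: "h nd \<Rightarrow> i5 \<Rightarrow> i5 \<Rightarrow> i5 \<Rightarrow> i5 \<Rightarrow> i5 \<Rightarrow> vec \<Rightarrow> vec" where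
  "appn g p q r s t v = nrm (sel g (pick p v)) (sel g (pick q v)) (sel g (pick r v)) (sel g (pick s v)) (sel g
    (pick t v))"

primrec app :: "sym \<Rightarrow> vec \<Rightarrow> vec" where
  "app (Sym a b c d p q r s t) v = appn (mk a b c d) p q r s t v"

fun alive :: "bool nd nd nd \<Rightarrow> vec \<Rightarrow> bool" where
  "alive A (V a b c d) = sel (sel (sel A a) b) c"

primrec imgs :: "sym list \<Rightarrow> vec \<Rightarrow> vec list \<Rightarrow> vec list" where
  "imgs [] w r = r" | "imgs (g # gs) w r = app g w # imgs gs w r"

primrec delif :: "bool \<Rightarrow> bool nd nd nd \<Rightarrow> vec \<Rightarrow> bool nd nd nd" where
  "delif True A w = delA A w" | "delif False A w = A"

primrec imgif :: "bool \<Rightarrow> sym list \<Rightarrow> vec \<Rightarrow> vec list \<Rightarrow> vec list" where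
  "imgif True G w r = imgs G w r" | "imgif False G w r = r"

text \<open>
  Deletes the orbits of the refuted words \<open>ws\<close> under the automorphisms \<open>G\<close>; the first list is fuel
  only.
\<close>

fun wl :: "h list \<Rightarrow> sym list \<Rightarrow> bool nd nd nd \<Rightarrow> vec list \<Rightarrow> bool nd nd nd" where
  "wl [] G A ws = A"
| "wl (f # fs) G A [] = A"
| "wl (f # fs) G A (w # ws) = wl fs G (delif (alive A w) A w) (imgif (alive A w) G w ws)"

primrec rootif :: "bool \<Rightarrow> h nd \<Rightarrow> bool nd nd nd \<Rightarrow> bool nd nd nd \<Rightarrow> forms \<Rightarrow> vec \<Rightarrow> bool" where
  "rootif True E A M W y = root E A M W y" | "rootif False E A M W y = True"

text \<open>A word no longer alive lies in the orbit of a refuted one, so its search is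
  skipped.\<close>

primrec run :: "h nd \<Rightarrow> h list \<Rightarrow> sym list \<Rightarrow> bool nd nd nd \<Rightarrow> forms \<Rightarrow> bool nd nd nd \<Rightarrow> vec list \<Rightarrow> bool" where
  "run E fl G M W A [] = True"
| "run E fl G M W A (y # ys) = (rootif (alive A y) E A M W y
     \<and> run E fl G M W (wl fl G A (keep (alive A y) y [])) ys)"

text \<open>The letter 0 at \<open>IA\<close> counts as well, so there are ten pairs to
  compare.\<close>

definition dst :: "h \<Rightarrow> h \<Rightarrow> h \<Rightarrow> h \<Rightarrow> bool" where
  "dst a b c d \<longleftrightarrow> \<not> ( isz a \<or> isz b \<or> isz c \<or> isz d \<or> isz (a + b) \<or> isz (a + c) \<or> isz (a + d)
     \<or> isz (b + c) \<or> isz (b + d) \<or> isz (c + d))"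

definition mlt :: "h \<Rightarrow> h \<Rightarrow> h \<Rightarrow> h \<Rightarrow> bool" where
  "mlt a b c d \<longleftrightarrow> \<not> (isz a \<and> isz b) \<and> \<not> (isz a \<and> isz c) \<and> \<not> (isz a \<and> isz d) \<and> \<not> (isz b \<and> isz c)
     \<and> \<not> (isz b \<and> isz d) \<and> \<not> (isz c \<and> isz d) \<and> \<not> (isz (a + b) \<and> isz (a + c)) \<and> \<not> (isz (a + b) \<and> isz (a + d))
     \<and> \<not> (isz (a + c) \<and> isz (a + d)) \<and> \<not> (isz (b + c) \<and> isz (b + d))"

definition "a3 W E a b c = dst a b c (lst W E a b c)"
definition "m3 W E a b c = mlt a b c (lst W E a b c)"
definition "a2 W E a b = N (a3 W E a b c0) (a3 W E a b c1) (a3 W E a b c2) (a3 W E a b c3) (a3 W E a b c4) (a3 W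
    E a b c5) (a3 W E a b c6) (a3 W E a b c7) (a3 W E a b c8) (a3 W E a b c9) (a3 W E a b c10) (a3 W E a b c11)
      (a3 W E a b c12) (a3 W E a b c13) (a3 W E a b c14) (a3 W E a b c15)"
definition "a1 W E a = N (a2 W E a c0) (a2 W E a c1) (a2 W E a c2) (a2 W E a c3) (a2 W E a c4) (a2 W E a c5) (a2
    W E a c6) (a2 W E a c7) (a2 W E a c8) (a2 W E a c9) (a2 W E a c10) (a2 W E a c11) (a2 W E a c12) (a2 W E a
      c13) (a2 W E a c14) (a2 W E a c15)"
definition "m2 W E a b = N (m3 W E a b c0) (m3 W E a b c1) (m3 W E a b c2) (m3 W E a b c3) (m3 W E a b c4) (m3 W
    E a b c5) (m3 W E a b c6) (m3 W E a b c7) (m3 W E a b c8) (m3 W E a b c9) (m3 W E a b c10) (m3 W E a b c11)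
      (m3 W E a b c12) (m3 W E a b c13) (m3 W E a b c14) (m3 W E a b c15)"
definition "m1 W E a = N (m2 W E a c0) (m2 W E a c1) (m2 W E a c2) (m2 W E a c3) (m2 W E a c4) (m2 W E a c5) (m2
    W E a c6) (m2 W E a c7) (m2 W E a c8) (m2 W E a c9) (m2 W E a c10) (m2 W E a c11) (m2 W E a c12) (m2 W E a
      c13) (m2 W E a c14) (m2 W E a c15)"
definition "a0 W E = N (a1 W E c0) (a1 W E c1) (a1 W E c2) (a1 W E c3) (a1 W E c4) (a1 W E c5) (a1 W E c6) (a1 W
    E c7) (a1 W E c8) (a1 W E c9) (a1 W E c10) (a1 W E c11) (a1 W E c12) (a1 W E c13) (a1 W E c14) (a1 W E c15)"
definition "m0 W E = N (m1 W E c0) (m1 W E c1) (m1 W E c2) (m1 W E c3) (m1 W E c4) (m1 W E c5) (m1 W E c6) (m1 W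
    E c7) (m1 W E c8) (m1 W E c9) (m1 W E c10) (m1 W E c11) (m1 W E c12) (m1 W E c13) (m1 W E c14) (m1 W E c15)"

definition chk2 :: "h nd \<Rightarrow> h list \<Rightarrow> sym list \<Rightarrow> forms \<Rightarrow> bool nd nd nd \<Rightarrow> bool nd nd nd \<Rightarrow> bool" where
  "chk2 E fl G W M A = run E fl G M W A (col W E A c1)"

text \<open>Applied four times to a list of length 16 it gives 4096 units of fuel. Exhausted fuel
  leaves words alive, which costs time but not soundness.\<close>

definition four :: "h list \<Rightarrow> h list" where "four xs = xs @ xs @ xs @ xs"

text \<open>
  An alternating form on \<open>F_2^4\<close>, by the entries 12, 13, 14, 23, 24, 34 of its Gram matrix.
\<close>

datatype code = Code bit bit bit bit bit bit

fun fev :: "code \<Rightarrow> h \<Rightarrow> h \<Rightarrow> bit" where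
  "fev (Code a b c d e f) (H x0 x1 x2 x3) (H y0 y1 y2 y3) =
     a * (x0 * y1 + x1 * y0) + b * (x0 * y2 + x2 * y0) + c * (x0 * y3 + x3 * y0)
     + d * (x1 * y2 + x2 * y1) + e * (x1 * y3 + x3 * y1) + f * (x2 * y3 + x3 * y2)"

text \<open>The Pfaffian of the Gram matrix, which is 1 exactly for nondegenerate forms.\<close>

fun pfc :: "code \<Rightarrow> bit" where "pfc (Code a b c d e f) = a * f + b * e + c * d"

fun addc :: "code \<Rightarrow> code \<Rightarrow> code" where
  "addc (Code a b c d e f) (Code a' b' c' d' e' f') = Code (a + a') (b + b') (c + c') (d + d') (e + e') (f + f')"

fun nodef :: "code \<Rightarrow> h nd" where
  "nodef (Code a b c d e f) = mk (H 0 a b c) (H a 0 d e) (H b d 0 f) (H c e f 0)"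

definition pull :: "h nd \<Rightarrow> code \<Rightarrow> code" where
  "pull g f = Code (fev f (sel g c1) (sel g c2)) (fev f (sel g c1) (sel g c4)) (fev f (sel g c1) (sel g c8))
     (fev f (sel g c2) (sel g c4)) (fev f (sel g c2) (sel g c8)) (fev f (sel g c4) (sel g c8))"

datatype codes = Codes code code code code code

fun cod :: "codes \<Rightarrow> i5 \<Rightarrow> code" where
  "cod (Codes p q r s t) IA = p" | "cod (Codes p q r s t) IB = q" | "cod (Codes p q r s t) IC = r"
| "cod (Codes p q r s t) ID = s" | "cod (Codes p q r s t) IE = t"

primrec formsof :: "codes \<Rightarrow> forms" where
  "formsof (Codes p q r s t) = Forms (nodef q) (nodef r) (nodef s) (nodef t)"

text \<open>These equations make the linear map together with the permutation preserve
  \<open>gram\<close>. Invertibility of the map is not tested separately; it follows from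
  nondegeneracy of the forms.\<close>

primrec symok :: "codes \<Rightarrow> sym \<Rightarrow> bool" where
  "symok F (Sym a b c d p q r s t) \<longleftrightarrow> distinct [p, q, r, s, t]
     \<and> pull (mk a b c d) (cod F IA) = cod F p \<and> pull (mk a b c d) (cod F IB) = cod F q
     \<and> pull (mk a b c d) (cod F IC) = cod F r \<and> pull (mk a b c d) (cod F ID) = cod F s
     \<and> pull (mk a b c d) (cod F IE) = cod F t"

primrec symsok :: "codes \<Rightarrow> sym list \<Rightarrow> bool" where
  "symsok F [] = True" | "symsok F (g # gs) = (symok F g \<and> symsok F gs)"

definition invok :: "h nd \<Rightarrow> h nd \<Rightarrow> bool" where
  "invok E s \<longleftrightarrow> isz (sel E (sel s c1) + c1) \<and> isz (sel E (sel s c2) + c2) \<and> isz (sel E (sel s c4) + c4) \<and> isz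
    (sel E (sel s c8) + c8)"

definition chk :: "codes \<Rightarrow> sym list \<Rightarrow> h \<Rightarrow> h \<Rightarrow> h \<Rightarrow> h \<Rightarrow> bool" where
  "chk F G a b c d \<longleftrightarrow> symsok F G \<and> invok (mk a b c d) (nodef (cod F IE)) \<and>
     chk2 (mk a b c d) (four (four (four (four [c0, c1, c2, c3, c4, c5, c6, c7, c8, c9, c10, c11, c12, c13, c14,
       c15])))) G (formsof F) (m0 (formsof F) (mk a b c d)) (a0 (formsof F) (mk a b c d))"

lemma orth_tab: "orth 0 = True" "orth 1 = False" by (simp_all add: orth_def)

lemma bit_tab: "(0::bit) + 0 = 0" "(0::bit) + 1 = 1" "(1::bit) + 0 = 1" "(1::bit) + 1 = 0"
  "(0::bit) * 0 = 0" "(0::bit) * 1 = 0" "(1::bit) * 0 = 0" "(1::bit) * 1 = 1" by simp_all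

lemma h_char2: "(x::h) + x = 0" by (cases x) (simp add: zero_h_def)

lemma h_left: "(x::h) + (x + y) = y" by (simp only: add.assoc[symmetric] h_char2 add_0)

lemma c0_zero: "c0 = 0" by (simp add: zero_h_def c0_def)

definition smul :: "bit \<Rightarrow> h \<Rightarrow> h" where "smul x a = (if x = 0 then 0 else a)"

lemma smul_add: "smul (x + y) a = smul x a + smul y a"
  by (cases x; cases y) (simp_all add: smul_def h_char2)

lemma sel_mk: "sel (mk a b c d) (H x y z w) = smul x a + smul y b + smul z c + smul w d"
  by (cases x; cases y; cases z; cases w) (simp_all add: mk_def smul_def c0_zero)

lemma sel_mk_add: "sel (mk a b c d) (u + v) = sel (mk a b c d) u + sel (mk a b c d) v"
  by (cases u; cases v) (simp only: plus_h.simps sel_mk smul_add add_ac)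

lemma fev_dot: "fev f x y = dot x (sel (nodef f) y)"
proof (cases f; cases x; cases y)
  fix a b c d e g x0 x1 x2 x3 y0 y1 y2 y3
  assume "f = Code a b c d e g" "x = H x0 x1 x2 x3" "y = H y0 y1 y2 y3"
  moreover have "smul t (H p q r s) = H (t * p) (t * q) (t * r) (t * s)" for t p q r s
    by (cases t) (simp_all add: smul_def zero_h_def)
  ultimately show ?thesis by (simp only: fev.simps nodef.simps sel_mk plus_h.simps dot.simps) (simp only:
    algebra_simps mult_zero_right mult_zero_left add_0 add_0_right)
qed

lemma nodef_mk: "\<exists>a b c d. nodef f = mk a b c d" by (cases f) auto

lemma H_tab:
  "H 0 0 0 0 = c0" "H 1 0 0 0 = c1" "H 0 1 0 0 = c2" "H 1 1 0 0 = c3"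
  "H 0 0 1 0 = c4" "H 1 0 1 0 = c5" "H 0 1 1 0 = c6" "H 1 1 1 0 = c7"
  "H 0 0 0 1 = c8" "H 1 0 0 1 = c9" "H 0 1 0 1 = c10" "H 1 1 0 1 = c11"
  "H 0 0 1 1 = c12" "H 1 0 1 1 = c13" "H 0 1 1 1 = c14" "H 1 1 1 1 = c15"
  by (simp_all add: c_defs)

lemma bit_eq_tab: "((0::bit) = 0) = True" "((0::bit) = 1) = False" "((1::bit) = 0) = False" "((1::bit) = 1) =
    True" by simp_all

lemmas eval_rules = h_add_tab dot_tab sel_tab upd_tab isz_tab addv.simps va.simps ok.simps keep.simps filt.simps
    filts.simps adds.simps filtss.simps ext_def orth_tab dotv.simps cov.simps filtO.simps pfv_def g4.simps
      g3.simps g2.simps g1.simps restr_def leaf_def dbl_def tst.simps f4.simps f3.simps f2.simps colc.simps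
        colb.simps col_def root1_def root_def delA.simps pick.simps nrm_def app.simps alive.simps imgs.simps
          wl.simps delif.simps imgif.simps rootif.simps run.simps dst_def mlt_def lst.simps a3_def m3_def a2_def
            m2_def a1_def m1_def a0_def m0_def mk_def appn_def fev_dot nodef.simps pull_def cod.simps
              formsof.simps symok.simps symsok.simps invok_def distinct.simps list.set insert_iff empty_iff
                i5.distinct code.inject H_tab bit_eq_tab pfc.simps addc.simps chk2_def four_def chk_def
                  append.simps simp_thms bit_tab

subsection \<open>Configurations\<close>

instance i5 :: finite
proof
  have "UNIV = {IA, IB, IC, ID, IE}" by (auto intro: i5.exhaust)
  thus "finite (UNIV :: i5 set)" by (metis finite.emptyI finite.insertI)
qed

lemma UNIV_i5: "UNIV = {IA, IB, IC, ID, IE}" by (auto intro: i5.exhaust)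

abbreviation fv :: "codes \<Rightarrow> i5 \<Rightarrow> h \<Rightarrow> h \<Rightarrow> bit" where "fv F j \<equiv> fev (cod F j)"

definition gram :: "codes \<Rightarrow> (i5 \<Rightarrow> h) \<Rightarrow> (i5 \<Rightarrow> h) \<Rightarrow> bit" where
  "gram F u v = (\<Sum>j\<in>UNIV. fv F j (u j) (v j))"

definition half :: "codes \<Rightarrow> (i5 \<Rightarrow> h) set \<Rightarrow> bool" where
  "half F Y \<longleftrightarrow> (\<forall>u\<in>Y. \<forall>v\<in>Y. (\<lambda>j. u j + v j) \<in> Y) \<and> (\<forall>x. (\<lambda>_. x) \<in> Y) \<and>
     (\<forall>u\<in>Y. \<forall>x. gram F u (\<lambda>_. x) = 0) \<and>
     (\<forall>u\<in>Y. \<forall>i j. i \<noteq> j \<longrightarrow> u i = u j \<longrightarrow> (\<forall>k. u k = u i)) \<and>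
     (\<forall>i j e. i \<noteq> j \<longrightarrow> (\<exists>u\<in>Y. u i = 0 \<and> u j = e)) \<and>
     (\<forall>u\<in>Y. (\<exists>i j. u i \<noteq> u j) \<longrightarrow> (\<exists>v\<in>Y. gram F u v = 1))"

text \<open>
  The last condition of \<open>half\<close> is the nondegeneracy of \<open>gram\<close> modulo the constant words, which comes
  from the symplectic form at the position where the words of \<open>Y\<close> do not vanish; the last condition
  of \<open>conf\<close> holds because a word of \<open>L\<close> with three zero letters is zero.
\<close>

definition conf :: "codes \<Rightarrow> (i5 \<Rightarrow> h) set \<Rightarrow> (i5 \<Rightarrow> h) set \<Rightarrow> bool" where
  "conf F Y X \<longleftrightarrow> (\<forall>j. pfc (cod F j) = 1) \<and> (\<forall>x y. gram F (\<lambda>_. x) (\<lambda>_. y) = 0) \<and> half F Y \<and> half F X \<and>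
     (\<forall>y\<in>Y. \<forall>x\<in>X. gram F y x = 0) \<and>
     (\<forall>y\<in>Y. \<forall>x\<in>X. \<forall>i j k. i \<noteq> j \<longrightarrow> i \<noteq> k \<longrightarrow> j \<noteq> k \<longrightarrow> y i + x i = y j + x j \<longrightarrow> y i + x i = y k + x k \<longrightarrow>
        (\<forall>l. x l = x i \<and> y l = y i))"

lemma halfD:
  assumes "half F Y"
  shows half_add: "\<forall>u\<in>Y. \<forall>v\<in>Y. (\<lambda>j. u j + v j) \<in> Y" and half_const: "\<forall>x. (\<lambda>_. x) \<in> Y"
    and half_orth: "\<forall>u\<in>Y. \<forall>x. gram F u (\<lambda>_. x) = 0"
    and half_distinct: "\<forall>u\<in>Y. \<forall>i j. i \<noteq> j \<longrightarrow> u i = u j \<longrightarrow> (\<forall>k. u k = u i)"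
    and half_pairs: "\<forall>i j e. i \<noteq> j \<longrightarrow> (\<exists>u\<in>Y. u i = 0 \<and> u j = e)"
    and half_nondeg: "\<forall>u\<in>Y. (\<exists>i j. u i \<noteq> u j) \<longrightarrow> (\<exists>v\<in>Y. gram F u v = 1)"
  using assms unfolding half_def by - (elim conjE, assumption)+

lemma confD:
  assumes "conf F Y X"
  shows conf_pf: "\<forall>j. pfc (cod F j) = 1" and conf_zero: "\<forall>x y. gram F (\<lambda>_. x) (\<lambda>_. y) = 0"
    and conf_left: "half F Y" and conf_right: "half F X" and conf_cross: "\<forall>y\<in>Y. \<forall>x\<in>X. gram F y x = 0"
    and conf_triple: "\<forall>y\<in>Y. \<forall>x\<in>X. \<forall>i j k. i \<noteq> j \<longrightarrow> i \<noteq> k \<longrightarrow> j \<noteq> k \<longrightarrow> y i + x i = y j + x j \<longrightarrow>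
      y i + x i = y k + x k \<longrightarrow> (\<forall>l. x l = x i \<and> y l = y i)"
  using assms unfolding conf_def by - (elim conjE, assumption)+

lemma fev_commute: "fev f x y = fev f y x"
  by (cases f; cases x; cases y) (simp only: fev.simps mult.commute add.commute)

lemma dot_add: "dot (x + y) z = dot x z + dot y z"
  by (cases x; cases y; cases z) (simp only: plus_h.simps dot.simps distrib_right add_ac)

lemma fev_add: "fev f (x + y) z = fev f x z + fev f y z"
  by (simp only: fev_dot dot_add)

lemma fev_add_right: "fev f z (x + y) = fev f z x + fev f z y"
  by (simp only: fev_commute[of f z] fev_add)

lemma dot_commute: "dot x y = dot y x"
  by (cases x; cases y) (simp only: dot.simps mult.commute)

lemma dot_nondeg: "(\<And>x. dot x z = 0) \<Longrightarrow> z = 0"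
  by (cases z; insert dot.simps[of 1 0 0 0] dot.simps[of 0 1 0 0] dot.simps[of 0 0 1 0] dot.simps[of 0 0 0 1])
    (metis (no_types, lifting) add_0 add_0_right mult_1 mult_zero_left zero_h_def)

lemma fev_zero: "fev f 0 x = 0"
  using fev_add[of f 0 0 x] by (simp only: add_0) (metis add_cancel_left_right)

lemma gram_expand: "gram F u v = fv F IA (u IA) (v IA) + (fv F IB (u IB) (v IB) + (fv F IC (u IC) (v IC)
    + (fv F ID (u ID) (v ID) + fv F IE (u IE) (v IE))))"
  by (simp add: gram_def UNIV_i5)

lemma fev_dot_left: "fev f x y = dot (sel (nodef f) x) y"
  by (subst fev_commute) (simp only: fev_dot dot_commute[of y])

lemma gram_commute: "gram F u v = gram F v u"
  by (simp only: gram_def fev_commute)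

lemma gram_add: "gram F (\<lambda>j. u j + v j) w = gram F u w + gram F v w"
  by (simp only: gram_def fev_add sum.distrib)

text \<open>This symmetry lets one table of excluded words serve both \<open>Y\<close> and
  \<open>X\<close>.\<close>

lemma conf_commute:
  assumes c: "conf F Y X"
  shows "conf F X Y"
  unfolding conf_def
proof (intro conjI ballI allI impI)
  fix y x assume "y \<in> X" "x \<in> Y"
  thus "gram F y x = 0" using conf_cross[OF c] by (simp add: gram_commute[of F y])
next
  fix y x i j k l
  assume yx: "y \<in> X" "x \<in> Y" and ijk: "i \<noteq> j" "i \<noteq> k" "j \<noteq> k"
    and e: "y i + x i = y j + x j" "y i + x i = y k + x k"
  have "x i + y i = x j + y j" "x i + y i = x k + y k" using e by (simp_all only: add.commute)
  hence "y l = y i \<and> x l = x i" using conf_triple[OF c] yx ijk by blast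
  thus "x l = x i" "y l = y i" by simp_all
qed (use confD[OF c] in simp_all)

subsection \<open>Symmetries\<close>

definition act :: "(h \<Rightarrow> h) \<Rightarrow> (i5 \<Rightarrow> i5) \<Rightarrow> (i5 \<Rightarrow> h) \<Rightarrow> i5 \<Rightarrow> h" where
  "act g p w = (\<lambda>j. g (w (p j)))"

lemma gram_act:
  assumes "bij p" "\<And>j x y. fv F' j (g x) (g y) = fv F (p j) x y"
  shows "gram F' (act g p u) (act g p v) = gram F u v"
  unfolding gram_def act_def assms(2) by (rule sum.reindex_bij_betw[OF assms(1)])

lemma half_act:
  assumes p: "bij p" and g: "bij g" "\<And>x y. g (x + y) = g x + g y"
    and fv: "\<And>j x y. fv F' j (g x) (g y) = fv F (p j) x y" and h: "half F Y"
  shows "half F' (act g p ` Y)"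
proof -
  have g0: "g 0 = 0" using g(2)[of 0 0] by simp
  have const: "act g p (\<lambda>_. x) = (\<lambda>_. g x)" for x by (simp add: act_def)
  have add: "(\<lambda>j. act g p u j + act g p v j) = act g p (\<lambda>j. u j + v j)" for u v by (simp add: act_def g)
  have gi: "g x = g y \<longleftrightarrow> x = y" for x y using g(1) by (metis bij_def inj_eq)
  have pi: "p i = p j \<longleftrightarrow> i = j" for i j using p by (metis bij_def inj_eq)
  have ps: "\<exists>j. i = p j" for i using p by (metis bij_def surjD)
  have gs: "\<exists>y. x = g y" for x using g(1) by (metis bij_def surjD)
  note gram = gram_act[of p F' g F, OF p fv]
  show ?thesis unfolding half_def
  proof (intro conjI ballI allI impI)
    fix u v assume "u \<in> act g p ` Y" "v \<in> act g p ` Y"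
    thus "(\<lambda>j. u j + v j) \<in> act g p ` Y" using half_add[OF h] by (auto simp: add)
  next
    fix x obtain y where "x = g y" using gs by blast
    thus "(\<lambda>_. x) \<in> act g p ` Y" using half_const[OF h] by (auto intro!: image_eqI[of _ _ "\<lambda>_. y"] const[symmetric])
  next
    fix u x assume "u \<in> act g p ` Y"
    moreover obtain y where "x = g y" using gs by blast
    ultimately show "gram F' u (\<lambda>_. x) = 0" using half_orth[OF h] by (auto simp: const[symmetric] gram)
  next
    fix u i j k assume "u \<in> act g p ` Y" "i \<noteq> j" "u i = u j"
    then obtain w where w: "u = act g p w" "w \<in> Y" by auto
    have "w (p i) = w (p j)" "p i \<noteq> p j" using \<open>u i = u j\<close> \<open>i \<noteq> j\<close> by (simp_all add: w act_def gi pi)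
    hence "w (p k) = w (p i)" using half_distinct[OF h] w(2) by blast
    thus "u k = u i" by (simp add: w act_def)
  next
    fix i j :: i5 and e assume "i \<noteq> j"
    obtain y where e: "e = g y" using gs by blast
    have "p i \<noteq> p j" using \<open>i \<noteq> j\<close> by (simp add: pi)
    then obtain u where "u \<in> Y" "u (p i) = 0" "u (p j) = y" using half_pairs[OF h] by blast
    thus "\<exists>u\<in>act g p ` Y. u i = 0 \<and> u j = e" by (intro bexI[of _ "act g p u"]) (auto simp: act_def g0 e)
  next
    fix u assume "u \<in> act g p ` Y" "\<exists>i j. u i \<noteq> u j"
    then obtain w i j where w: "u = act g p w" "w \<in> Y" "u i \<noteq> u j" by auto
    have "w (p i) \<noteq> w (p j)" using w(3) by (auto simp: w act_def)
    then obtain v where "v \<in> Y" "gram F w v = 1" using half_nondeg[OF h] w(2) by blast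
    thus "\<exists>v\<in>act g p ` Y. gram F' u v = 1" by (intro bexI[of _ "act g p v"]) (auto simp: w gram)
  qed
qed

lemma conf_act:
  assumes p: "bij p" and g: "bij g" "\<And>x y. g (x + y) = g x + g y"
    and fv: "\<And>j x y. fv F' j (g x) (g y) = fv F (p j) x y" and pf: "\<And>j. pfc (cod F' j) = 1" and c: "conf F Y X"
  shows "conf F' (act g p ` Y) (act g p ` X)"
proof -
  have gi: "g x = g y \<longleftrightarrow> x = y" for x y using g(1) by (metis bij_def inj_eq)
  have pi: "p i = p j \<longleftrightarrow> i = j" for i j using p by (metis bij_def inj_eq)
  have ps: "\<exists>j. i = p j" for i using p by (metis bij_def surjD)
  have gs: "\<exists>y. x = g y" for x using g(1) by (metis bij_def surjD)
  note gram = gram_act[of p F' g F, OF p fv]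
  have const: "act g p (\<lambda>_. x) = (\<lambda>_. g x)" for x by (simp add: act_def)
  show ?thesis unfolding conf_def
  proof (intro conjI ballI allI impI)
    fix x y
    obtain x' y' where "x = g x'" "y = g y'" using gs by metis
    thus "gram F' (\<lambda>_. x) (\<lambda>_. y) = 0" using conf_zero[OF c] by (simp add: const[symmetric] gram)
  next
    show "half F' (act g p ` Y)" "half F' (act g p ` X)"
      using confD[OF c] half_act[OF p g fv] by simp_all
  next
    fix y x assume "y \<in> act g p ` Y" "x \<in> act g p ` X"
    thus "gram F' y x = 0" using conf_cross[OF c] by (auto simp: gram)
  next
    fix y x i j k l assume yx: "y \<in> act g p ` Y" "x \<in> act g p ` X" and ijk: "i \<noteq> j" "i \<noteq> k" "j \<noteq> k"
      and e: "y i + x i = y j + x j" "y i + x i = y k + x k"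
    obtain u v where uv: "y = act g p u" "u \<in> Y" "x = act g p v" "v \<in> X" using yx by auto
    have "u (p i) + v (p i) = u (p j) + v (p j)" "u (p i) + v (p i) = u (p k) + v (p k)"
      using e by (simp_all add: uv act_def gi flip: g(2))
    moreover have "p i \<noteq> p j" "p i \<noteq> p k" "p j \<noteq> p k" using ijk by (simp_all add: pi)
    ultimately have "v (p l) = v (p i) \<and> u (p l) = u (p i)" using conf_triple[OF c] uv by blast
    thus "x l = x i" "y l = y i" by (simp_all add: uv act_def)
  qed (rule pf)
qed

subsection \<open>Normalised vectors\<close>

fun wof :: "vec \<Rightarrow> i5 \<Rightarrow> h" where
  "wof (V a b c d) IA = 0" | "wof (V a b c d) IB = a" | "wof (V a b c d) IC = b"
| "wof (V a b c d) ID = c" | "wof (V a b c d) IE = d"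

lemma wof_add: "wof (addv u v) j = wof u j + wof v j"
  by (cases u; cases v; cases j) simp_all

lemma wof_addv: "wof (addv u v) = (\<lambda>j. wof u j + wof v j)"
  by (rule ext) (rule wof_add)

lemma pick_wof: "pick j v = wof v j"
  by (cases v; cases j) (simp_all add: c0_zero)

lemma va_wof: "va v = wof v IB" by (cases v) simp

lemma va_addv: "va (addv u v) = va u + va v" by (cases u; cases v) simp

lemma wof_inverse: "w IA = 0 \<Longrightarrow> wof (V (w IB) (w IC) (w ID) (w IE)) = w"
proof
  fix j assume "w IA = 0" thus "wof (V (w IB) (w IC) (w ID) (w IE)) j = w j" by (cases j) simp_all
qed

lemma gram_wof: "dotv (cov (formsof F) u) v = gram F (wof u) (wof v)"
proof (cases F; cases u; cases v)
  fix p q r s t a b c d a' b' c' d'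
  assume "F = Codes p q r s t" "u = V a b c d" "v = V a' b' c' d'"
  thus ?thesis
    by (simp only: gram_expand formsof.simps cov.simps dotv.simps cod.simps wof.simps fev_zero add_0)
      (simp only: fev_dot_left add_ac)
qed

definition invE :: "codes \<Rightarrow> h nd \<Rightarrow> bool" where
  "invE F E \<longleftrightarrow> (\<forall>x. sel E (sel (nodef (cod F IE)) x) = x)"

lemma lst_eq:
  assumes E: "invE F E" and z: "\<And>x. gram F (wof (V a b c d)) (\<lambda>_. x) = 0"
  shows "d = lst (formsof F) E a b c"
proof (cases F)
  case (Codes p q r s t)
  have "sel (nodef q) a + sel (nodef r) b + sel (nodef s) c + sel (nodef t) d = 0"
  proof (rule dot_nondeg)
    fix x
    have "dot x (sel (nodef q) a + sel (nodef r) b + sel (nodef s) c + sel (nodef t) d)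
        = fev q x a + fev r x b + fev s x c + fev t x d"
      by (simp only: fev_dot dot_commute[of x] dot_add)
    also have "\<dots> = gram F (wof (V a b c d)) (\<lambda>_. x)"
      by (simp only: gram_expand Codes cod.simps wof.simps fev_zero add_0 fev_commute[of _ x] add_ac)
    finally show "dot x (sel (nodef q) a + sel (nodef r) b + sel (nodef s) c + sel (nodef t) d) = 0"
      using z by simp
  qed
  hence "sel (nodef t) d = sel (nodef q) a + sel (nodef r) b + sel (nodef s) c"
    by (metis add.left_neutral h_char2 h_left add.commute)
  thus ?thesis using E[unfolded invE_def, rule_format, of d] by (simp add: Codes)
qed

lemma invok_invE:
  assumes "invok (mk a b c d) (nodef (cod F IE))"
  shows "invE F (mk a b c d)"
  unfolding invE_def
proof
  fix x
  obtain p q r s where n: "nodef (cod F IE) = mk p q r s" using nodef_mk by blast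
  let ?k = "\<lambda>x. sel (mk a b c d) (sel (nodef (cod F IE)) x)"
  have add: "?k (x + y) = ?k x + ?k y" for x y by (simp only: n sel_mk_add)
  have eq: "isz (u + v) \<Longrightarrow> u = v" for u v unfolding isz_def by (metis add.right_neutral h_left add.commute)
  have b: "?k c1 = c1" "?k c2 = c2" "?k c4 = c4" "?k c8 = c8"
    using assms by (auto simp: invok_def intro: eq)
  have z: "?k 0 = 0" using add[of 0 0] by simp
  obtain x0 x1 x2 x3 where x: "x = H x0 x1 x2 x3" by (cases x)
  have sm: "?k (smul t y) = smul t (?k y)" for t y by (simp add: smul_def z)
  have "x = smul x0 c1 + smul x1 c2 + smul x2 c4 + smul x3 c8"
    by (cases x0; cases x1; cases x2; cases x3) (simp_all add: x smul_def c_defs zero_h_def)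
  thus "?k x = x" by (metis add sm b)
qed

subsection \<open>Soundness of the search\<close>

lemma sel_N:
  "sel (N (f c0) (f c1) (f c2) (f c3) (f c4) (f c5) (f c6) (f c7) (f c8) (f c9) (f c10) (f c11) (f c12) (f c13)
    (f c14) (f c15)) x = f x"
proof (cases x)
  case (H a b c d)
  thus ?thesis by (cases a; cases b; cases c; cases d) (simp_all add: c_defs)
qed

lemma sel_a0: "sel (sel (sel (a0 W E) a) b) c = dst a b c (lst W E a b c)"
proof -
  have "sel (a0 W E) a = a1 W E a" unfolding a0_def by (rule sel_N)
  moreover have "sel (a1 W E a) b = a2 W E a b" unfolding a1_def by (rule sel_N)
  moreover have "sel (a2 W E a b) c = a3 W E a b c" unfolding a2_def by (rule sel_N)
  ultimately show ?thesis by (simp only: a3_def)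
qed

lemma sel_m0: "sel (sel (sel (m0 W E) a) b) c = mlt a b c (lst W E a b c)"
proof -
  have "sel (m0 W E) a = m1 W E a" unfolding m0_def by (rule sel_N)
  moreover have "sel (m1 W E a) b = m2 W E a b" unfolding m1_def by (rule sel_N)
  moreover have "sel (m2 W E a b) c = m3 W E a b c" unfolding m2_def by (rule sel_N)
  ultimately show ?thesis by (simp only: m3_def)
qed

lemma sel_upd: "sel (upd n k y) x = (if x = k then y else sel n x)"
proof -
  have e: "isz (u + v) \<longleftrightarrow> u = v" for u v :: h unfolding isz_def by (metis add.right_neutral h_char2 h_left)
  show ?thesis unfolding upd_def by (rule trans[OF sel_N[of "\<lambda>z. if isz (k + z) then y else sel n z"]]) (auto simp: e)
qed

lemma isz_add: "isz (u + v) \<longleftrightarrow> u = v"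
  unfolding isz_def by (metis add.right_neutral h_char2 h_left)

lemma set_adds: "set (adds v ws) = addv v ` set ws" by (induction ws) auto

text \<open>Only this direction matters for soundness: a filter may keep too much but must not lose
  a word of a configuration.\<close>

lemma filt_mem: "z \<in> set ws \<Longrightarrow> ok n y z \<Longrightarrow> z \<in> set (filt n y ws)"
proof (induction ws)
  case (Cons w ws) thus ?case by (cases "ok n y w") auto
qed simp

lemma ok_alive: "ok (sel A (va y + va z)) y z = alive A (addv y z)"
  by (cases y; cases z) simp

lemma filts_mem:
  "z \<in> set ws \<Longrightarrow> va z = a \<Longrightarrow> (\<And>y. y \<in> set ys \<Longrightarrow> alive A (addv y z)) \<Longrightarrow> z \<in> set (filts A a ys ws)"
proof (induction A a ys ws rule: filts.induct)
  case (3 A a y ys w ws)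
  have "ok (sel A (va y + a)) y z" using 3(3,4) by (auto simp flip: ok_alive)
  hence "z \<in> set (filt (sel A (va y + a)) y (w # ws))" using 3(2) by (rule filt_mem[rotated])
  thus ?case using 3 by simp
qed auto

lemma filtss_mem:
  "z \<in> set ws \<Longrightarrow> va z = a \<Longrightarrow> (\<And>s y. s \<in> set ss \<Longrightarrow> y \<in> set Y \<Longrightarrow> alive M (addv (addv s y) z)) \<Longrightarrow>
    z \<in> set (filtss M a Y ss ws)"
proof (induction M a Y ss ws rule: filtss.induct)
  case (3 M a Y s ss w ws)
  have "z \<in> set (filts M a (adds s Y) (w # ws))" using 3(2-4) by (intro filts_mem) (auto simp: set_adds)
  thus ?case using 3 by simp
qed auto

lemma filtO_mem: "z \<in> set ws \<Longrightarrow> dotv y z = 0 \<Longrightarrow> z \<in> set (filtO y ws)"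
proof (induction ws)
  case (Cons w ws) thus ?case by (cases "orth (dotv y w)") (auto simp: orth_def)
qed simp

lemma colc_mem: "c \<in> set cs \<Longrightarrow> sel n c \<Longrightarrow> d = lst W E a b c \<Longrightarrow> V a b c d \<in> set (colc W E n a b r cs)"
proof (induction cs)
  case (Cons c' cs) thus ?case by (cases "sel n c'") auto
qed auto

lemma colc_rest: "z \<in> set r \<Longrightarrow> z \<in> set (colc W E n a b r cs)"
proof (induction cs)
  case (Cons c' cs) thus ?case by (cases "sel n c'") auto
qed auto

lemma all_h: "x \<in> set [c0, c1, c2, c3, c4, c5, c6, c7, c8, c9, c10, c11, c12, c13, c14, c15]"
proof (cases x)
  case (H a b c d)
  thus ?thesis by (cases a; cases b; cases c; cases d) (simp_all add: c_defs)
qed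

lemma colb_mem: "b \<in> set bs \<Longrightarrow> sel (sel n b) c \<Longrightarrow> d = lst W E a b c \<Longrightarrow> V a b c d \<in> set (colb W E n a bs)"
proof (induction bs)
  case (Cons b' bs)
  show ?case
  proof (cases "b = b'")
    case True
    show ?thesis unfolding True colb.simps by (rule colc_mem[OF all_h]) (use Cons(3,4) True in simp_all)
  next
    case False
    hence "V a b c d \<in> set (colb W E n a bs)" using Cons by simp
    thus ?thesis by (simp only: colb.simps) (rule colc_rest)
  qed
qed simp

lemma col_mem: "alive A z \<Longrightarrow> (\<And>a b c d. z = V a b c d \<Longrightarrow> d = lst W E a b c) \<Longrightarrow> va z = e \<Longrightarrow> z \<in> set (col W E A e)"
proof (cases z)
  case (V a b c d)
  assume h: "alive A z" "\<And>a b c d. z = V a b c d \<Longrightarrow> d = lst W E a b c" "va z = e"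
  have "V a b c d \<in> set (colb W E (sel A a) a [c0, c1, c2, c3, c4, c5, c6, c7, c8, c9, c10, c11, c12, c13, c14, c15])"
    by (rule colb_mem[OF all_h]) (use V h in simp_all)
  thus ?thesis using V h(3) by (simp only: col_def va.simps)
qed

lemma g4_all: "g4 W x1 x2 x3 xs \<longleftrightarrow> (\<forall>x4\<in>set xs. pfv W x1 x2 x3 x4 = 0)"
  by (induction xs) (simp_all add: orth_def)

lemma g3_all: "g3 A M W Y x1 x2 C4 xs \<longleftrightarrow> (\<forall>x3\<in>set xs. g4 W x1 x2 x3
    (ext A M c8 Y [x1, x2, addv x1 x2, x3, addv x3 x1, addv x3 x2, addv x3 (addv x1 x2)] C4))"
  by (induction xs) simp_all

lemma g2_all: "g2 A M W Y x1 C3 C4 xs \<longleftrightarrow> (\<forall>x2\<in>set xs. g3 A M W Y x1 x2 C4 (ext A M c4 Y [x1, x2, addv x1 x2] C3))"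
  by (induction xs) simp_all

lemma g1_all: "g1 A M W Y C2 C3 C4 xs \<longleftrightarrow> (\<forall>x1\<in>set xs. g2 A M W Y x1 C3 C4 (ext A M c2 Y [x1] C2))"
  by (induction xs) simp_all

lemma f4_all: "f4 A M W Y y1 y2 y3 X1 X2 X3 X4 ys \<longleftrightarrow>
    (\<forall>y4\<in>set ys. tst (orth (pfv W y1 y2 y3 y4)) A M W Y y3 y4 X1 X2 X3 X4)"
  by (induction ys) simp_all

lemma f3_all: "f3 A M W Y y1 y2 L4 X1 X2 X3 X4 ys \<longleftrightarrow>
    (\<forall>y3\<in>set ys. f4 A M W (dbl y3 Y) y1 y2 y3 X1 X2 X3 X4 (filts A c8 (adds y3 Y) L4))"
  by (induction ys) simp_all

lemma f2_all: "f2 A M W Y y1 L3 L4 X1 X2 X3 X4 ys \<longleftrightarrow>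
    (\<forall>y2\<in>set ys. f3 A M W (dbl y2 Y) y1 y2 (filts A c8 (adds y2 Y) L4)
        (filtO (cov W y2) X1) (filtO (cov W y2) X2) (filtO (cov W y2) X3) (filtO (cov W y2) X4)
        (filts A c4 (adds y2 Y) L3))"
  by (induction ys) simp_all

section \<open>Normalised words of a configuration\<close>

definition part :: "(i5 \<Rightarrow> h) set \<Rightarrow> vec set" where "part Y = {v. wof v \<in> Y}"

lemma part_add: "half F Y \<Longrightarrow> u \<in> part Y \<Longrightarrow> v \<in> part Y \<Longrightarrow> addv u v \<in> part Y"
  using half_add by (auto simp: part_def wof_addv)

lemma part_lst: "half F Y \<Longrightarrow> invE F E \<Longrightarrow> V a b c d \<in> part Y \<Longrightarrow> d = lst (formsof F) E a b c"
  using half_orth by (intro lst_eq) (auto simp: part_def)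

text \<open>Two equal letters would make the word constant, hence zero, against
  \<open>a \<noteq> 0\<close>.\<close>

lemma part_dst:
  assumes h: "half F Y" and v: "V a b c d \<in> part Y" and a: "a \<noteq> 0"
  shows "dst a b c d"
proof -
  let ?w = "wof (V a b c d)"
  have ne: "?w i \<noteq> ?w j" if "i \<noteq> j" for i j
  proof
    assume "?w i = ?w j"
    hence "\<forall>k. ?w k = ?w i" using half_distinct[OF h] v that unfolding part_def by blast
    hence "?w IB = ?w IA" by metis
    thus False using a by simp
  qed
  have "a \<noteq> 0" "b \<noteq> 0" "c \<noteq> 0" "d \<noteq> 0" "a \<noteq> b" "a \<noteq> c" "a \<noteq> d" "b \<noteq> c" "b \<noteq> d" "c \<noteq> d"
    using ne[of IB IA] ne[of IC IA] ne[of ID IA] ne[of IE IA] ne[of IB IC] ne[of IB ID] ne[of IB IE]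
      ne[of IC ID] ne[of IC IE] ne[of ID IE] by simp_all
  thus ?thesis unfolding dst_def isz_add by (simp add: isz_def)
qed

lemma part_surj: "half F Y \<Longrightarrow> \<exists>v\<in>part Y. va v = e"
proof -
  assume h: "half F Y"
  then obtain u where u: "u \<in> Y" "u IA = 0" "u IB = e" using half_pairs[OF h] by (metis i5.distinct(1))
  thus ?thesis by (intro bexI[of _ "V (u IB) (u IC) (u ID) (u IE)"]) (auto simp: part_def wof_inverse)
qed

text \<open>Three equal letters of the sum would make \<open>x\<close> constant, and a normalised
  constant word is zero, against \<open>va x \<noteq> 0\<close>.\<close>

lemma part_mlt:
  assumes c: "conf F Y X" and E: "invE F E" and y: "y \<in> part Y" and x: "x \<in> part X" and nz: "va x \<noteq> 0"
  shows "alive (m0 (formsof F) E) (addv y x)"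
proof -
  obtain a b c' d where z: "addv y x = V a b c' d" by (cases "addv y x")
  let ?w = "wof (addv y x)"
  have z0: "gram F ?w (\<lambda>_. t) = 0" for t
    using half_orth[OF conf_left[OF c]] half_orth[OF conf_right[OF c]] y x
    by (simp add: wof_addv gram_add part_def)
  have d: "d = lst (formsof F) E a b c'" using z0 by (intro lst_eq[OF E]) (simp add: z)
  have ne: "\<not> (?w i = ?w j \<and> ?w i = ?w k)" if ijk: "i \<noteq> j" "i \<noteq> k" "j \<noteq> k" for i j k
  proof
    assume e: "?w i = ?w j \<and> ?w i = ?w k"
    have "wof y i + wof x i = wof y j + wof x j" using e[THEN conjunct1] by (simp only: wof_add)
    moreover have "wof y i + wof x i = wof y k + wof x k" using e[THEN conjunct2] by (simp only: wof_add)
    ultimately have "\<forall>l. wof x l = wof x i" using conf_triple[OF c] y x ijk unfolding part_def by blast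
    hence "wof x IB = wof x IA" by metis
    moreover have "wof x IA = 0" by (cases x) simp
    ultimately show False using nz by (simp add: va_wof)
  qed
  have "mlt a b c' d"
    unfolding mlt_def isz_add
    using ne[of IA IB IC] ne[of IA IB ID] ne[of IA IB IE] ne[of IA IC ID] ne[of IA IC IE] ne[of IA ID IE]
      ne[of IB IC ID] ne[of IB IC IE] ne[of IB ID IE] ne[of IC ID IE]
    by (simp add: z isz_def)
  thus ?thesis by (simp add: z sel_m0 d)
qed

lemma ex_bit: "(\<exists>x::bit. P x) \<longleftrightarrow> P 0 \<or> P 1" by (metis bit_not_zero_iff)

section \<open>The Pfaffian of a basis\<close>

text \<open>The four equations describe the kernel of the alternating matrix with entries
  \<open>a\<close>, ..., \<open>f\<close>. A vanishing Pfaffian makes it singular; over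
  \<open>F_2\<close> there are only 64 matrices to inspect.\<close>

lemma pfaffian_kernel:
  assumes "a * f + b * e + c * d = (0::bit)"
  shows "\<exists>x1 x2 x3 x4. \<not> (x1 = 0 \<and> x2 = 0 \<and> x3 = 0 \<and> x4 = 0) \<and> x2 * a + x3 * b + x4 * c = 0 \<and>
    x1 * a + x3 * d + x4 * e = 0 \<and> x1 * b + x2 * d + x4 * f = 0 \<and> x1 * c + x2 * e + x3 * f = 0"
  using assms by (cases a; cases b; cases c; cases d; cases e; cases f) (simp_all add: ex_bit)

text \<open>The coefficients are the binary digits of \<open>t\<close>. For basis words with letters
  \<open>c1\<close>, \<open>c2\<close>, \<open>c4\<close>, \<open>c8\<close> at \<open>IB\<close>
  the letter of the combination there is \<open>t\<close> itself, so \<open>t\<close> indexes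
  \<open>Y\<close> modulo constants.\<close>

definition comb :: "vec \<Rightarrow> vec \<Rightarrow> vec \<Rightarrow> vec \<Rightarrow> h \<Rightarrow> i5 \<Rightarrow> h" where
  "comb y1 y2 y3 y4 t = (\<lambda>j. case t of H a b c d \<Rightarrow>
     smul a (wof y1 j) + (smul b (wof y2 j) + (smul c (wof y3 j) + smul d (wof y4 j))))"

lemma gram_smul: "gram F (\<lambda>j. smul t (u j)) v = t * gram F u v"
proof -
  have "gram F (\<lambda>j. 0) v = 0" using gram_add[of F "\<lambda>_. 0" "\<lambda>_. 0" v] by (simp only: add_0) (metis
    add_cancel_left_right)
  thus ?thesis by (cases t) (simp_all add: smul_def)
qed

lemma smul_in: "half F Y \<Longrightarrow> u \<in> Y \<Longrightarrow> (\<lambda>j. smul t (u j)) \<in> Y"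
  using half_const[of F Y] by (cases t) (simp_all add: smul_def)

lemma add_in: "half F Y \<Longrightarrow> u \<in> Y \<Longrightarrow> v \<in> Y \<Longrightarrow> (\<lambda>j. u j + v j) \<in> Y"
  using half_add[of F Y] by blast

lemma comb_in:
  assumes "half F Y" "y1 \<in> part Y" "y2 \<in> part Y" "y3 \<in> part Y" "y4 \<in> part Y"
  shows "comb y1 y2 y3 y4 t \<in> Y"
proof (cases t)
  case (H a b c d)
  show ?thesis unfolding comb_def H h.case
    by (intro add_in[OF assms(1)] smul_in[OF assms(1)]) (use assms in \<open>simp_all add: part_def\<close>)
qed

lemma gram_comb: "gram F (comb y1 y2 y3 y4 (H a b c d)) v =
    a * gram F (wof y1) v + (b * gram F (wof y2) v + (c * gram F (wof y3) v + d * gram F (wof y4) v))"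
  by (simp only: comb_def h.case gram_add gram_smul)

lemma comb_IB:
  assumes "va y1 = c1" "va y2 = c2" "va y3 = c4" "va y4 = c8"
  shows "comb y1 y2 y3 y4 t IB = t" "comb y1 y2 y3 y4 t IA = 0"
proof -
  obtain a b c d where t: "t = H a b c d" by (cases t)
  have "wof v IA = 0" for v by (cases v) simp
  thus "comb y1 y2 y3 y4 t IA = 0" by (cases t) (simp add: comb_def smul_def)
  show "comb y1 y2 y3 y4 t IB = t"
    by (cases a; cases b; cases c; cases d)
      (simp_all add: t comb_def smul_def assms c_defs zero_h_def flip: va_wof)
qed

lemma gram_self: "gram F u u = 0"
proof -
  have bb: "(t::bit) + t = 0" for t by (cases t) simp_all
  have "fev f x x = 0" for f x
    by (cases f; cases x) (simp only: fev.simps mult.commute bb mult_zero_right add_0)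
  thus ?thesis by (simp add: gram_def)
qed

text \<open>A kernel vector of the Gram matrix would give a nonconstant word of \<open>Y\<close>
  orthogonal to the four basis words and to the constants, hence to all of \<open>Y\<close>, against
  the nondegeneracy of \<open>gram\<close>.\<close>

lemma conf_pfv:
  assumes c: "conf F Y X" and y: "y1 \<in> part Y" "y2 \<in> part Y" "y3 \<in> part Y" "y4 \<in> part Y"
    and va: "va y1 = c1" "va y2 = c2" "va y3 = c4" "va y4 = c8"
  shows "pfv (formsof F) y1 y2 y3 y4 = 1"
proof (rule ccontr)
  let ?B = "\<lambda>u v. gram F (wof u) (wof v)"
  note h = conf_left[OF c]
  assume "pfv (formsof F) y1 y2 y3 y4 \<noteq> 1"
  hence "pfv (formsof F) y1 y2 y3 y4 = 0" by (metis bit_not_one_iff)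
  hence "?B y1 y2 * ?B y3 y4 + ?B y1 y3 * ?B y2 y4 + ?B y1 y4 * ?B y2 y3 = 0"
    by (simp only: pfv_def gram_wof)
  from pfaffian_kernel[OF this] obtain p q r s where n: "\<not> (p = 0 \<and> q = 0 \<and> r = 0 \<and> s = 0)"
    and k: "q * ?B y1 y2 + r * ?B y1 y3 + s * ?B y1 y4 = 0" "p * ?B y1 y2 + r * ?B y2 y3 + s * ?B y2 y4 = 0"
      "p * ?B y1 y3 + q * ?B y2 y3 + s * ?B y3 y4 = 0" "p * ?B y1 y4 + q * ?B y2 y4 + r * ?B y3 y4 = 0"
    by blast
  let ?u = "comb y1 y2 y3 y4 (H p q r s)"
  have k': "gram F (wof v) ?u = 0" if "v = y1 \<or> v = y2 \<or> v = y3 \<or> v = y4" for v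
  proof -
    have "gram F ?u (wof y1) = 0" "gram F ?u (wof y2) = 0" "gram F ?u (wof y3) = 0" "gram F ?u (wof y4) = 0"
      using k by (simp_all only: gram_comb gram_self gram_commute[of F "wof y2" "wof y1"]
        gram_commute[of F "wof y3" "wof y1"] gram_commute[of F "wof y4" "wof y1"] gram_commute[of F "wof y3" "wof y2"]
        gram_commute[of F "wof y4" "wof y2"] gram_commute[of F "wof y4" "wof y3"] mult_zero_right add_0
          add_0_right add.assoc)
    thus ?thesis using that by (auto simp: gram_commute[of F _ ?u])
  qed
  have "?u IA \<noteq> ?u IB" using n by (simp add: comb_IB va zero_h_def)
  then obtain v where v: "v \<in> Y" "gram F ?u v = 1" using half_nondeg[OF h] comb_in[OF h y] by metis
  let ?v = "\<lambda>j. v j + v IA"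
  have vY: "?v \<in> Y" using half_const[OF h] add_in[OF h v(1)] by blast
  \<comment> \<open>The normalised \<open>v\<close> and the combination with the same letter at
    \<open>IB\<close> agree at two positions, hence everywhere.\<close>
  have vB: "?v = comb y1 y2 y3 y4 (?v IB)" (is "_ = ?c")
  proof
    fix j
    have m: "(\<lambda>j. ?v j + ?c j) \<in> Y" by (rule add_in[OF h vY comb_in[OF h y]])
    have e: "?v IA + ?c IA = ?v IB + ?c IB" by (simp add: comb_IB[OF va] h_char2)
    have "?v j + ?c j = ?v IA + ?c IA"
      by (rule half_distinct[OF h, rule_format, OF m _ e]) simp
    hence "?v j + ?c j = 0" by (simp add: comb_IB[OF va] h_char2)
    thus "?v j = ?c j" by (metis add.right_neutral h_left add.commute)
  qed
  obtain p' q' r' s' where t: "?v IB = H p' q' r' s'" by (cases "?v IB")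
  have "gram F ?v ?u = 0" by (subst vB) (simp only: t gram_comb k' simp_thms mult_zero_right add_0)
  moreover have "gram F ?v ?u = gram F v ?u + gram F (\<lambda>_. v IA) ?u" by (rule gram_add)
  moreover have "gram F (\<lambda>_. v IA) ?u = 0" using half_orth[OF h] comb_in[OF h y] by (simp add: gram_commute[of F
    _ ?u])
  ultimately show False using v(2) by (simp add: gram_commute[of F v])
qed

text \<open>Quantifying over all configurations allows deletions that are justified for the whole
  family; as \<open>Y\<close> and \<open>X\<close> may be exchanged, words of \<open>X\<close> are
  covered as well.\<close>

definition good :: "codes \<Rightarrow> bool nd nd nd \<Rightarrow> bool" where
  "good F A \<longleftrightarrow> (\<forall>Y X. conf F Y X \<longrightarrow> (\<forall>v\<in>part Y. va v \<noteq> 0 \<longrightarrow> alive A v))"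

lemma set_dbl: "set (dbl y Y) = set Y \<union> addv y ` set Y"
  by (simp add: dbl_def set_adds)

lemma restr_mem: "z \<in> set X \<Longrightarrow> dotv (cov W y3) z = 0 \<Longrightarrow> dotv (cov W y4) z = 0 \<Longrightarrow> va z = a \<Longrightarrow>
    (\<And>y. y \<in> set Y \<Longrightarrow> alive M (addv y z)) \<Longrightarrow> z \<in> set (restr M W a Y y3 y4 X)"
  unfolding restr_def by (intro filts_mem filtO_mem)

lemma addv_left: "addv (addv s y) z = addv y (addv s z)"
  by (cases s; cases y; cases z) (simp add: add_ac)

lemma ext_mem: "z \<in> set C \<Longrightarrow> va z = a \<Longrightarrow> (\<And>s. s \<in> set S \<Longrightarrow> alive A (addv s z)) \<Longrightarrow>
    (\<And>s y. s \<in> set S \<Longrightarrow> y \<in> set Y \<Longrightarrow> alive M (addv y (addv s z))) \<Longrightarrow> z \<in> set (ext A M a Y S C)"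
  unfolding ext_def by (intro filtss_mem filts_mem) (simp_all add: addv_left)

text \<open>\<open>Y\<close> has words with letters \<open>c2\<close>, \<open>c4\<close>,
  \<open>c8\<close> at \<open>IB\<close>, and \<open>X\<close> has words with letters
  \<open>c1\<close>, \<open>c2\<close>, \<open>c4\<close>, \<open>c8\<close>. They survive every
  filter, so the search reaches them and asserts that the Pfaffian of this basis of \<open>X\<close>
  is 0, whereas it is 1.\<close>

lemma root_sound:
  assumes r: "root E A (m0 (formsof F) E) (formsof F) y1" and c: "conf F Y X" and E: "invE F E" and A: "good F A"
    and y1: "y1 \<in> part Y" "va y1 = c1"
  shows False
proof -
  let ?W = "formsof F" and ?M = "m0 (formsof F) E"
  note h = conf_left[OF c] and h' = conf_right[OF c]
  obtain y2 where y2: "y2 \<in> part Y" "va y2 = c2" using part_surj[OF h] by blast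
  obtain y3 where y3: "y3 \<in> part Y" "va y3 = c4" using part_surj[OF h] by blast
  obtain y4 where y4: "y4 \<in> part Y" "va y4 = c8" using part_surj[OF h] by blast
  obtain x1 where x1: "x1 \<in> part X" "va x1 = c1" using part_surj[OF h'] by blast
  obtain x2 where x2: "x2 \<in> part X" "va x2 = c2" using part_surj[OF h'] by blast
  obtain x3 where x3: "x3 \<in> part X" "va x3 = c4" using part_surj[OF h'] by blast
  obtain x4 where x4: "x4 \<in> part X" "va x4 = c8" using part_surj[OF h'] by blast
  have gA: "alive A v" if "v \<in> part Y \<or> v \<in> part X" "\<not> isz (va v)" for v
    using A[unfolded good_def] c conf_commute[OF c] that unfolding isz_def by blast
  have gM: "alive ?M (addv y x)" if "y \<in> part Y" "x \<in> part X" "\<not> isz (va x)" for x y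
    using part_mlt[OF c E] that unfolding isz_def by blast
  have gO: "dotv (cov ?W y) x = 0" if "y \<in> part Y" "x \<in> part X" for x y
    using conf_cross[OF c] that by (simp add: gram_wof part_def)
  have gcol: "v \<in> set (col ?W E A e)" if "v \<in> part Y \<or> v \<in> part X" "va v = e" "\<not> isz e" for v e
    using that gA part_lst[OF h E] part_lst[OF h' E] by (intro col_mem) blast+
  note add = part_add[OF h] and add' = part_add[OF h']
  let ?Y1 = "[V c0 c0 c0 c0, y1]"
  let ?Y2 = "dbl y2 ?Y1" let ?Y3 = "dbl y3 ?Y2" let ?Y4 = "dbl y4 ?Y3"
  have "wof (V c0 c0 c0 c0) = (\<lambda>_. 0)"
  proof fix j show "wof (V c0 c0 c0 c0) j = 0" by (cases j) (simp_all add: c0_zero) qed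
  hence z: "V c0 c0 c0 c0 \<in> part Y" using half_const[OF h] by (simp add: part_def)
  \<comment> \<open>The letters at \<open>IB\<close> of the words generated so far are tracked,
    because the table \<open>A\<close> is known to keep only words whose letter there is
    nonzero.\<close>
  have P1: "s \<in> part Y \<and> va s \<in> {c0, c1}" if "s \<in> set ?Y1" for s using that z y1 by auto
  have P2: "s \<in> part Y \<and> va s \<in> {c0, c1, c2, c3}" if s: "s \<in> set ?Y2" for s
  proof -
    from s consider "s \<in> set ?Y1" | t where "t \<in> set ?Y1" "s = addv y2 t" unfolding set_dbl by blast
    thus ?thesis
    proof cases
      case 1 thus ?thesis using P1[of s] by blast
    next
      case 2
      have t: "t \<in> part Y" "va t \<in> {c0, c1}" using P1[OF 2(1)] by blast+
      have "va s = c2 + va t" by (simp only: 2(2) va_addv y2(2))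
      with t(2) show ?thesis using add[OF y2(1) t(1)] 2(2) by (elim insertE emptyE) (simp_all add: h_add_tab)
    qed
  qed
  have P3: "s \<in> part Y \<and> va s \<in> {c0, c1, c2, c3, c4, c5, c6, c7}" if s: "s \<in> set ?Y3" for s
  proof -
    from s consider "s \<in> set ?Y2" | t where "t \<in> set ?Y2" "s = addv y3 t" unfolding set_dbl[of y3] by blast
    thus ?thesis
    proof cases
      case 1 thus ?thesis using P2[of s] by blast
    next
      case 2
      have t: "t \<in> part Y" "va t \<in> {c0, c1, c2, c3}" using P2[OF 2(1)] by blast+
      have "va s = c4 + va t" by (simp only: 2(2) va_addv y3(2))
      with t(2) show ?thesis using add[OF y3(1) t(1)] 2(2) by (elim insertE emptyE) (simp_all add: h_add_tab)
    qed
  qed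
  have P4: "s \<in> part Y" if s: "s \<in> set ?Y4" for s
    using s P3 add[OF y4(1)] unfolding set_dbl[of y4] by blast
  have n1: "alive A (addv y1 z)" if "z \<in> part Y" "va z \<in> {c2, c4, c8}" for z
    using that by (intro gA disjI1 add y1) (auto simp: va_addv y1 h_add_tab isz_tab)
  have n2: "alive A (addv y z)" if "y \<in> set (adds y2 ?Y1)" "z \<in> part Y" "va z \<in> {c4, c8}" for y z
  proof -
    have "y \<in> part Y \<and> va y \<in> {c0, c1, c2, c3}" using that(1) by (intro P2) (auto simp: dbl_def)
    thus ?thesis using that by (intro gA disjI1 add) (auto simp: va_addv h_add_tab isz_tab)
  qed
  have n3: "alive A (addv y z)" if "y \<in> set (adds y3 ?Y2)" "z \<in> part Y" "va z = c8" for y z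
  proof -
    have "y \<in> part Y \<and> va y \<in> {c0, c1, c2, c3, c4, c5, c6, c7}" using that(1) by (intro P3) (auto simp: dbl_def)
    thus ?thesis using that by (intro gA disjI1 add) (auto simp: va_addv h_add_tab isz_tab)
  qed
  note r = r[unfolded root_def root1_def f2_all, THEN bspec[of _ _ y2], OF filts_mem[OF gcol]]
  have r2: "f3 A ?M ?W ?Y2 y1 y2 (filts A c8 (adds y2 ?Y1) (filts A c8 [y1] (col ?W E A c8)))
        (filtO (cov ?W y2) (filtO (cov ?W y1) (col ?W E A c1))) (filtO (cov ?W y2) (filtO (cov ?W y1) (col ?W E
          A c2)))
        (filtO (cov ?W y2) (filtO (cov ?W y1) (col ?W E A c4))) (filtO (cov ?W y2) (filtO (cov ?W y1) (col ?W E
          A c8)))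
        (filts A c4 (adds y2 ?Y1) (filts A c4 [y1] (col ?W E A c4)))" (is "f3 A ?M ?W ?Y2 y1 y2 ?L4 ?X1 ?X2 ?X3
          ?X4 ?L3")
    by (rule r) (use y2 n1 in \<open>auto simp: isz_tab\<close>)
  have y3m: "y3 \<in> set ?L3"
    by (intro filts_mem gcol) (use y3 n1 n2 in \<open>auto simp only: isz_tab list.set insert_iff empty_iff simp_thms\<close>)
  have y4m: "y4 \<in> set (filts A c8 (adds y3 ?Y2) ?L4)"
    by (intro filts_mem gcol) (use y4 n1 n2 n3 in \<open>auto simp only: isz_tab list.set insert_iff empty_iff simp_thms\<close>)
  have "tst (orth (pfv ?W y1 y2 y3 y4)) A ?M ?W ?Y3 y3 y4 ?X1 ?X2 ?X3 ?X4"
    using r2 y3m y4m unfolding f3_all f4_all by blast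
  moreover have "pfv ?W y1 y2 y3 y4 = 1" by (rule conf_pfv[OF c]) (use y1 y2 y3 y4 in simp_all)
  ultimately have "leaf A ?M ?W ?Y4 y3 y4 ?X1 ?X2 ?X3 ?X4" by (simp only: orth_tab tst.simps)
  hence g: "g1 A ?M ?W ?Y4 (restr ?M ?W c2 ?Y4 y3 y4 ?X2) (restr ?M ?W c4 ?Y4 y3 y4 ?X3)
      (restr ?M ?W c8 ?Y4 y3 y4 ?X4) (restr ?M ?W c1 ?Y4 y3 y4 ?X1)" (is "g1 _ _ _ _ ?R2 ?R3 ?R4 ?R1")
    by (simp only: leaf_def)
  have xm: "z \<in> set (restr ?M ?W a ?Y4 y3 y4 (filtO (cov ?W y2) (filtO (cov ?W y1) (col ?W E A a))))"
    if "z \<in> part X" "va z = a" "\<not> isz a" for z a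
    by (intro restr_mem filtO_mem gcol gO gM) (use that y1 y2 y3 y4 P4 in simp_all)
  have em: "z \<in> set (ext A ?M a ?Y4 S C)"
    if "z \<in> set C" "z \<in> part X" "va z = a" "\<And>s. s \<in> set S \<Longrightarrow> s \<in> part X \<and> \<not> isz (va s + a)" for z a S C
    by (intro ext_mem gA gM add' disjI2) (use that P4 in \<open>auto simp: va_addv\<close>)
  have m1: "x1 \<in> set ?R1" by (rule xm) (use x1 in \<open>simp_all add: isz_tab\<close>)
  have m2: "x2 \<in> set (ext A ?M c2 ?Y4 [x1] ?R2)"
    by (intro em xm) (use x1 x2 in \<open>auto simp: isz_tab h_add_tab\<close>)
  have m3: "x3 \<in> set (ext A ?M c4 ?Y4 [x1, x2, addv x1 x2] ?R3)"
    by (intro em xm) (use x1 x2 x3 in \<open>auto simp: isz_tab h_add_tab va_addv add'\<close>)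
  have m4: "x4 \<in> set (ext A ?M c8 ?Y4 [x1, x2, addv x1 x2, x3, addv x3 x1, addv x3 x2, addv x3 (addv x1 x2)] ?R4)"
    by (intro em xm) (use x1 x2 x3 x4 in \<open>auto simp: isz_tab h_add_tab va_addv add'\<close>)
  have "pfv ?W x1 x2 x3 x4 = 0"
    using g m1 m2 m3 m4 unfolding g1_all g2_all g3_all g4_all by blast
  moreover have "pfv ?W x1 x2 x3 x4 = 1" by (rule conf_pfv[OF conf_commute[OF c]]) (use x1 x2 x3 x4 in simp_all)
  ultimately show False by simp
qed

section \<open>Pullbacks of forms and transport of refuted words\<close>

instance h :: finite
proof
  have "UNIV = set [c0, c1, c2, c3, c4, c5, c6, c7, c8, c9, c10, c11, c12, c13, c14, c15]" using all_h by blast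
  thus "finite (UNIV :: h set)" by (metis finite_set)
qed

lemma bit_regular: "x1 * a + x2 * b + x3 * c = 0 \<Longrightarrow> x0 * a + x2 * d + x3 * e = 0 \<Longrightarrow> x0 * b + x1 * d + x3 * g = 0 \<Longrightarrow>
    x0 * c + x1 * e + x2 * g = 0 \<Longrightarrow> a * g + b * e + c * d = (1::bit) \<Longrightarrow> x0 = 0 \<and> x1 = 0 \<and> x2 = 0 \<and> x3 = 0"
  by (cases a; cases b; cases c; cases d; cases e; cases g; cases x0; cases x1; cases x2; cases x3) simp_all

lemma nodef_ker:
  assumes "pfc f = 1" "sel (nodef f) x = 0"
  shows "x = 0"
proof (cases f; cases x)
  fix a b c d e g x0 x1 x2 x3
  assume f: "f = Code a b c d e g" and x: "x = H x0 x1 x2 x3"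
  have sm: "smul t (H p q r s) = H (t * p) (t * q) (t * r) (t * s)" for t p q r s
    by (cases t) (simp_all add: smul_def zero_h_def)
  have "x1 * a + x2 * b + x3 * c = 0" "x0 * a + x2 * d + x3 * e = 0" "x0 * b + x1 * d + x3 * g = 0"
    "x0 * c + x1 * e + x2 * g = 0" "a * g + b * e + c * d = 1"
    using assms by (simp_all only: f x nodef.simps sel_mk sm plus_h.simps zero_h_def h.inject mult_zero_right
      add_0 add_0_right pfc.simps)
  from bit_regular[OF this] show "x = 0" unfolding x zero_h_def h.inject .
qed

lemma fev_pull: "fev (pull (mk a b c d) f) x y = fev f (sel (mk a b c d) x) (sel (mk a b c d) y)"
proof (cases x; cases y)
  fix x0 x1 x2 x3 y0 y1 y2 y3
  assume xy: "x = H x0 x1 x2 x3" "y = H y0 y1 y2 y3"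
  have bb: "(t::bit) + t = 0" for t by (cases t) simp_all
  have "fev f u u = 0" for u
    by (cases f; cases u) (simp only: fev.simps mult.commute bb mult_zero_right add_0)
  moreover have "fev f (smul t u) v = t * fev f u v" for t u v by (cases t) (simp_all add: smul_def fev_zero)
  moreover have "fev f u (smul t v) = t * fev f u v" for t u v
    using calculation(2)[of t v u] by (simp only: fev_commute[of f u])
  moreover have mk: "sel (mk a b c d) c1 = a" "sel (mk a b c d) c2 = b" "sel (mk a b c d) c4 = c" "sel (mk a b c
    d) c8 = d"
    by (simp_all only: mk_def sel_tab)
  ultimately show ?thesis
    by (simp only: xy pull_def fev.simps sel_mk fev_add fev_add_right mk)
      (simp only: mult_zero_left mult_zero_right add_0 add_0_right distrib_left distrib_right ac_simps
        fev_commute[of f b a]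
        fev_commute[of f c a] fev_commute[of f c b] fev_commute[of f d a] fev_commute[of f d b] fev_commute[of f d c])
qed

text \<open>A kernel vector of the map would lie in the radical of the pulled back form. Thus a
  single Pfaffian certifies that a matrix taken from a table is invertible.\<close>

lemma pull_bij:
  assumes p: "pfc (pull (mk a b c d) f) = 1"
  shows "bij (sel (mk a b c d))"
proof -
  let ?k = "sel (mk a b c d)"
  have k0: "?k 0 = 0" using sel_mk_add[of a b c d 0 0] by simp
  have "x = 0" if "?k x = 0" for x
  proof (rule nodef_ker[OF p], rule dot_nondeg)
    fix y
    have "dot y (sel (nodef (pull (mk a b c d) f)) x) = fev f (?k y) (?k x)"
      by (simp only: fev_dot[symmetric] fev_pull)
    thus "dot y (sel (nodef (pull (mk a b c d) f)) x) = 0" by (simp only: that fev_commute[of f "?k y"] fev_zero)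
  qed
  hence "inj ?k" by (intro injI) (metis sel_mk_add h_char2 h_left add.right_neutral)
  thus ?thesis by (simp add: bij_def finite_UNIV_inj_surj)
qed

definition arr :: "i5 \<Rightarrow> i5 \<Rightarrow> i5 \<Rightarrow> i5 \<Rightarrow> i5 \<Rightarrow> i5 \<Rightarrow> i5" where
  "arr p q r s t j = (case j of IA \<Rightarrow> p | IB \<Rightarrow> q | IC \<Rightarrow> r | ID \<Rightarrow> s | IE \<Rightarrow> t)"

lemma arr_simps: "arr p q r s t IA = p" "arr p q r s t IB = q" "arr p q r s t IC = r" "arr p q r s t ID = s"
  "arr p q r s t IE = t" by (simp_all add: arr_def)

lemma arr_bij:
  assumes "distinct [p, q, r, s, t]"
  shows "bij (arr p q r s t)"
proof -
  have "inj (arr p q r s t)"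
  proof (rule injI)
    fix i j assume "arr p q r s t i = arr p q r s t j"
    thus "i = j" using assms by (cases i; cases j) (simp_all add: arr_simps)
  qed
  thus ?thesis by (simp add: bij_def finite_UNIV_inj_surj)
qed

text \<open>
  The first condition determines the fourth letter of \<open>w\<close>, so deleting the triple of \<open>w\<close> loses no
  other word.
\<close>

definition dead :: "codes \<Rightarrow> vec \<Rightarrow> bool" where
  "dead F w \<longleftrightarrow> (\<forall>x. gram F (wof w) (\<lambda>_. x) = 0) \<and> (\<forall>Y X. conf F Y X \<longrightarrow> w \<notin> part Y)"

lemma good_delA:
  assumes E: "invE F E" and A: "good F A" and w: "dead F w"
  shows "good F (delA A w)"
  unfolding good_def
proof (intro allI impI ballI)
  fix Y X v assume c: "conf F Y X" and v: "v \<in> part Y" "va v \<noteq> 0"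
  obtain a b c' d where w': "w = V a b c' d" by (cases w)
  obtain a' b' c'' d' where v': "v = V a' b' c'' d'" by (cases v)
  have "\<not> (a' = a \<and> b' = b \<and> c'' = c')"
  proof
    assume e: "a' = a \<and> b' = b \<and> c'' = c'"
    have "d' = lst (formsof F) E a b c'" using part_lst[OF conf_left[OF c] E] v(1) e v' by blast
    moreover have "d = lst (formsof F) E a b c'" using lst_eq[OF E] w w' unfolding dead_def by blast
    ultimately have "v = w" using e by (simp add: v' w')
    thus False using w c v(1) unfolding dead_def by blast
  qed
  moreover have "alive A v" using A c v unfolding good_def by blast
  ultimately show "alive (delA A w) v" by (auto simp: v' w' sel_upd)
qed

text \<open>If a configuration contained the image, its inverse transform would be a configuration
  of the same forms containing \<open>w\<close>. The configuration \<open>Y0\<close>,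
  \<open>X0\<close> supplies that the forms are nondegenerate and sum to zero.\<close>

lemma dead_app:
  assumes s: "symok F g" and c: "conf F Y0 X0" and w: "dead F w"
  shows "dead F (app g w)"
proof (cases g)
  case (Sym a b c' d p q r s t)
  let ?k = "sel (mk a b c' d)" and ?p = "arr p q r s t"
  have pull: "pull (mk a b c' d) (cod F j) = cod F (?p j)" for j
    using s by (cases j) (simp_all add: Sym arr_simps)
  have p: "bij ?p" using s by (intro arr_bij) (simp add: Sym)
  have k: "bij ?k" using conf_pf[OF c] by (intro pull_bij[of _ _ _ _ "cod F IA"]) (simp add: pull)
  have fv: "fv F j (?k x) (?k y) = fv F (?p j) x y" for j x y by (simp only: pull[symmetric] fev_pull)
  have z: "gram F (\<lambda>_. x) (\<lambda>_. y) = 0" for x y using conf_zero[OF c] by blast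
  \<comment> \<open>Normalisation adds a constant word with this letter, which is harmless since
    \<open>Y\<close> contains the constants.\<close>
  define e where "e = ?k (wof w p)"
  have app: "wof (app g w) = (\<lambda>j. act ?k ?p (wof w) j + e)"
  proof
    fix j show "wof (app g w) j = act ?k ?p (wof w) j + e"
      by (cases j) (simp_all add: Sym appn_def nrm_def pick_wof act_def arr_simps e_def h_char2)
  qed
  show ?thesis unfolding dead_def
  proof (intro conjI allI impI notI)
    fix x obtain y where y: "x = ?k y" using k by (metis bij_def surjD)
    have "gram F (act ?k ?p (wof w)) (act ?k ?p (\<lambda>_. y)) = gram F (wof w) (\<lambda>_. y)"
      by (rule gram_act[OF p fv])
    moreover have "gram F (wof w) (\<lambda>_. y) = 0" using w unfolding dead_def by blast
    ultimately show "gram F (wof (app g w)) (\<lambda>_. x) = 0" by (simp add: app gram_add z) (simp add: y act_def)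
  next
    fix Y X assume c: "conf F Y X" and m: "app g w \<in> part Y"
    let ?k' = "inv_into UNIV ?k" and ?p' = "inv_into UNIV ?p"
    have kk: "?k (?k' x) = x" "?k' (?k x) = x" for x using k by (simp_all add: bij_def surj_f_inv_f)
    have pp: "?p (?p' x) = x" "?p' (?p x) = x" for x using p by (simp_all add: bij_def surj_f_inv_f)
    have fv': "fv F j (?k' x) (?k' y) = fv F (?p' j) x y" for j x y
      using fv[of "?p' j" "?k' x" "?k' y"] by (simp only: kk pp)
    have k'add: "?k' (x + y) = ?k' x + ?k' y" for x y
      using sel_mk_add[of a b c' d "?k' x" "?k' y"] by (simp only: kk) (metis kk(2))
    have c': "conf F (act ?k' ?p' ` Y) (act ?k' ?p' ` X)"
      by (rule conf_act[OF bij_imp_bij_inv[OF p] bij_imp_bij_inv[OF k] k'add fv' _ c])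
        (use conf_pf[OF c] in blast)
    have "(\<lambda>j. wof (app g w) j + e) \<in> Y"
      using add_in[OF conf_left[OF c], of "wof (app g w)" "\<lambda>_. e"] m half_const[OF conf_left[OF c]]
      unfolding part_def by blast
    moreover have "(\<lambda>j. wof (app g w) j + e) = act ?k ?p (wof w)"
      by (simp only: app add.assoc h_char2 add_0_right)
    ultimately have "act ?k ?p (wof w) \<in> Y" by simp
    hence "act ?k' ?p' (act ?k ?p (wof w)) \<in> act ?k' ?p' ` Y" by (rule imageI)
    moreover have "act ?k' ?p' (act ?k ?p (wof w)) = wof w" by (simp only: act_def kk pp)
    ultimately have "w \<in> part (act ?k' ?p' ` Y)" by (simp add: part_def)
    thus False using w c' unfolding dead_def by blast
  qed
qed

lemma symsok_all: "symsok F G \<longleftrightarrow> (\<forall>g\<in>set G. symok F g)" by (induction G) simp_all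

lemma imgs_set: "set (imgs G w r) = (\<lambda>g. app g w) ` set G \<union> set r" by (induction G) auto

lemma wl_good:
  assumes "symsok F G" "conf F Y X" "invE F E" "good F A" "\<And>w. w \<in> set ws \<Longrightarrow> dead F w"
  shows "good F (wl fl G A ws)"
  using assms
proof (induction fl G A ws rule: wl.induct)
  case (3 f fs G A w ws)
  show ?case
  proof (cases "alive A w")
    case False thus ?thesis using 3 by simp
  next
    case True
    have "good F (delA A w)" using good_delA 3 by simp
    moreover have "dead F v" if "v \<in> set (imgs G w ws)" for v
      using that 3 dead_app[of F _ Y X w] by (auto simp: imgs_set symsok_all)
    ultimately show ?thesis using 3 True by simp
  qed
qed simp_all

text \<open>The converse of \<open>lst_eq\<close>; it provides the first condition of
  \<open>dead\<close> for the words enumerated by \<open>col\<close>.\<close>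

lemma lst_orth:
  assumes E: "invE F E" and d: "d = lst (formsof F) E a b c"
  shows "gram F (wof (V a b c d)) (\<lambda>_. x) = 0"
proof (cases F)
  case (Codes p q r s t)
  have "inj (sel (nodef t))" using E by (intro injI) (metis invE_def Codes cod.simps(5))
  hence "surj (sel (nodef t))" by (simp add: finite_UNIV_inj_surj)
  then obtain d' where "sel (nodef q) a + sel (nodef r) b + sel (nodef s) c = sel (nodef t) d'" by (metis surjD)
  hence e: "sel (nodef t) d = sel (nodef q) a + sel (nodef r) b + sel (nodef s) c"
    using E by (simp add: d Codes invE_def)
  have "gram F (wof (V a b c d)) (\<lambda>_. x)
      = dot (sel (nodef q) a + sel (nodef r) b + sel (nodef s) c + sel (nodef t) d) x"
    by (simp only: gram_expand Codes cod.simps wof.simps fev_zero add_0) (simp only: fev_dot_left dot_add add_ac)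
  also have "\<dots> = 0" by (simp only: e h_char2) (cases x, simp add: zero_h_def)
  finally show ?thesis .
qed

lemma colc_elem: "z \<in> set (colc W E n a b r cs) \<Longrightarrow> z \<in> set r \<or> (\<exists>c. z = V a b c (lst W E a b c))"
proof (induction cs)
  case (Cons c' cs) thus ?case by (cases "sel n c'") auto
qed simp

lemma colb_elem: "z \<in> set (colb W E n a bs) \<Longrightarrow> \<exists>b c. z = V a b c (lst W E a b c)"
proof (induction bs)
  case (Cons b' bs) thus ?case unfolding colb.simps using colc_elem by blast
qed simp

text \<open>All deletions keep the table good, so \<open>y\<close> is still alive when the run
  reaches it; it is then refuted, which \<open>root_sound\<close> forbids.\<close>

lemma run_sound:
  assumes G: "symsok F G" and c: "conf F Y X" and E: "invE F E" and y: "y \<in> part Y"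
    and r: "run E fl G (m0 (formsof F) E) (formsof F) A ys" and A: "good F A"
    and ys: "\<And>z. z \<in> set ys \<Longrightarrow> va z = c1 \<and> (\<forall>x. gram F (wof z) (\<lambda>_. x) = 0)" and m: "y \<in> set ys"
  shows False
  using r A ys m
proof (induction ys arbitrary: A)
  case (Cons z zs)
  have va: "va z = c1" "va y = c1" using Cons(4,5) by auto
  have nz: "c1 \<noteq> 0" by (simp add: c_defs zero_h_def)
  show ?case
  proof (cases "alive A z")
    case True
    have "dead F z" unfolding dead_def
    proof (intro conjI allI impI notI)
      fix Y' X' assume "conf F Y' X'" "z \<in> part Y'"
      moreover have "root E A (m0 (formsof F) E) (formsof F) z" using Cons(2) True by simp
      ultimately show False using root_sound E Cons(3) va by blast
    qed (use Cons(4) in auto)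
    hence "good F (wl fl G A [z])" by (intro wl_good[OF G c E Cons(3)]) simp
    moreover have "y \<in> set zs" using \<open>dead F z\<close> c y Cons(5) unfolding dead_def by auto
    moreover have "run E fl G (m0 (formsof F) E) (formsof F) (wl fl G A [z]) zs" using Cons(2) True by simp
    ultimately show False by (intro Cons(1)[of "wl fl G A [z]"]) (use Cons(4) in auto)
  next
    case False
    have "y \<in> set zs" using Cons(3,5) False c y va nz unfolding good_def by auto
    moreover have "good F (wl fl G A [])" by (rule wl_good[OF G c E Cons(3)]) simp
    moreover have "run E fl G (m0 (formsof F) E) (formsof F) (wl fl G A []) zs" using Cons(2) False by simp
    ultimately show False by (intro Cons(1)[of "wl fl G A []"]) (use Cons(4) in auto)
  qed
qed simp

theorem chk_sound:
  assumes k: "chk F G a b c d" and cf: "conf F Y X"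
  shows False
proof -
  let ?E = "mk a b c d" and ?A = "a0 (formsof F) (mk a b c d)"
  have G: "symsok F G" and i: "invok ?E (nodef (cod F IE))" using k unfolding chk_def by blast+
  have E: "invE F ?E" by (rule invok_invE[OF i])
  have A: "good F ?A" unfolding good_def
  proof (intro allI impI ballI)
    fix Y X v assume cf: "conf F Y X" and v: "v \<in> part Y" "va v \<noteq> 0"
    show "alive ?A v"
    proof (cases v)
      case (V a b c d)
      thus ?thesis using v part_dst[OF conf_left[OF cf]] part_lst[OF conf_left[OF cf] E] by (simp add: sel_a0)
    qed
  qed
  obtain y where y: "y \<in> part Y" "va y = c1" using part_surj[OF conf_left[OF cf]] by blast
  have "c1 \<noteq> 0" by (simp add: c_defs zero_h_def)
  hence "alive ?A y" using A cf y unfolding good_def by metis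
  hence m: "y \<in> set (col (formsof F) ?E ?A c1)"
    using part_lst[OF conf_left[OF cf] E] y by (intro col_mem) blast+
  have ys: "va z = c1 \<and> (\<forall>x. gram F (wof z) (\<lambda>_. x) = 0)" if z: "z \<in> set (col (formsof F) ?E ?A c1)" for z
  proof -
    obtain b c where "z = V c1 b c (lst (formsof F) ?E c1 b c)" using colb_elem z unfolding col_def by blast
    thus ?thesis using lst_orth[OF E] by (simp only: va.simps) blast
  qed
  show False using k[unfolded chk_def chk2_def] run_sound[OF G cf E y(1) _ A ys m] by blast
qed

subsection \<open>The five families of forms\<close>

text \<open>The four elements after the list of automorphisms are the images of \<open>c1\<close>,
  \<open>c2\<close>, \<open>c4\<close>, \<open>c8\<close> under the inverse of the Gram matrix at
  \<open>IE\<close>. Each \<open>Sym\<close> holds the images of the same basis and then the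
  permutation. The automorphisms serve to shorten the search; soundness asks only that each of them
  preserve the forms.\<close>

lemma chk_I:
  "chk (Codes (Code 0 0 1 1 0 0) (Code 0 0 1 1 0 0) (Code 0 0 1 1 0 0) (Code 0 1 1 0 1 0) (Code 0 1 0 1 1 0))
    [Sym c2 c1 c11 c5 IA IC IB IE ID, Sym c7 c13 c1 c3 IC IB IA ID IE]
    c12 c8 c1 c3"
  by (simp only: eval_rules)

lemma chk_II:
  "chk (Codes (Code 0 0 1 1 0 0) (Code 0 0 1 1 0 0) (Code 1 0 1 1 0 0) (Code 0 1 1 0 1 0) (Code 1 1 0 1 1 0))
    [Sym c3 c1 c12 c4 IB IA IC ID IE, Sym c6 c1 c8 c4 IA IB IC IE ID]
    c12 c8 c9 c7"
  by (simp only: eval_rules)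

lemma chk_III:
  "chk (Codes (Code 0 0 1 1 0 0) (Code 0 0 1 1 0 0) (Code 1 0 1 1 0 0) (Code 1 0 0 0 0 1) (Code 0 0 1 1 0 1))
    [Sym c12 c8 c3 c2 IB IA IE ID IC, Sym c5 c15 c1 c3 IA IB ID IE IC, Sym c2 c1 c10 c5 IA IB ID IC IE]
    c10 c5 c2 c1"
  by (simp only: eval_rules)

lemma chk_C:
  "chk (Codes (Code 0 0 1 1 0 0) (Code 1 0 1 1 0 0) (Code 0 1 1 0 1 0) (Code 1 0 0 0 0 1) (Code 0 1 1 0 1 1))
    [Sym c6 c11 c8 c12 IB IA IC IE ID, Sym c4 c8 c2 c3 IC IE IA ID IB]
    c6 c13 c3 c2"
  by (simp only: eval_rules)

lemma chk_V:
  "chk (Codes (Code 0 0 1 1 0 0) (Code 1 0 1 1 0 0) (Code 0 1 1 1 0 0) (Code 0 1 0 0 1 0) (Code 1 0 1 1 1 0))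
    [Sym c3 c5 c12 c4 IB IA ID IE IC, Sym c6 c9 c8 c4 IA IB IE ID IC]
    c12 c4 c11 c5"
  by (simp only: eval_rules)

text \<open>
  The classification moves two forms with nonsingular sum to \<open>std\<close> and \<open>nb\<close>; the third and fourth
  form then run through \<open>pfs\<close>, and each table entry names a model and a transformation to it.
\<close>

definition std :: code where "std = Code 0 0 1 1 0 0"

definition nb :: code where "nb = Code 0 1 1 0 1 0"

text \<open>The 28 nondegenerate alternating forms on \<open>F_2^4\<close>.\<close>

definition pfs :: "code list" where
  "pfs = [Code 0 0 1 1 0 0, Code 0 0 1 1 0 1, Code 0 0 1 1 1 0, Code 0 0 1 1 1 1, Code 0 1 0 0 1 0, Code 0 1 0 0 1 1,
     Code 0 1 0 1 1 0, Code 0 1 0 1 1 1, Code 0 1 1 0 1 0, Code 0 1 1 0 1 1, Code 0 1 1 1 0 0, Code 0 1 1 1 0 1,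
     Code 1 0 0 0 0 1, Code 1 0 0 0 1 1, Code 1 0 0 1 0 1, Code 1 0 0 1 1 1, Code 1 0 1 0 0 1, Code 1 0 1 0 1 1,
     Code 1 0 1 1 0 0, Code 1 0 1 1 1 0, Code 1 1 0 0 0 1, Code 1 1 0 0 1 0, Code 1 1 0 1 0 1, Code 1 1 0 1 1 0,
     Code 1 1 1 0 0 1, Code 1 1 1 0 1 0, Code 1 1 1 1 0 0, Code 1 1 1 1 1 1]"

text \<open>The 12 nondegenerate forms whose sum with \<open>std\<close> is nondegenerate as
  well.\<close>

definition nbs :: "code list" where
  "nbs = [Code 0 1 0 1 1 0, Code 0 1 0 1 1 1, Code 0 1 1 0 1 0, Code 0 1 1 0 1 1, Code 1 0 0 1 0 1, Code 1 0 0 1 1 1,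
     Code 1 0 1 0 0 1, Code 1 0 1 0 1 1, Code 1 1 0 1 0 1, Code 1 1 0 1 1 0, Code 1 1 1 0 0 1, Code 1 1 1 0 1 0]"

datatype model = M1 | M2 | M3 | M4 | M5

text \<open>Three of the forms coincide in \<open>M1\<close>, just two in \<open>M2\<close> and
  \<open>M3\<close>, none in \<open>M4\<close> and \<open>M5\<close>.\<close>

fun codes_of :: "model \<Rightarrow> codes" where
  "codes_of M1 = Codes (Code 0 0 1 1 0 0) (Code 0 0 1 1 0 0) (Code 0 0 1 1 0 0) (Code 0 1 1 0 1 0) (Code 0 1 0 1 1 0)"
| "codes_of M2 = Codes (Code 0 0 1 1 0 0) (Code 0 0 1 1 0 0) (Code 1 0 1 1 0 0) (Code 0 1 1 0 1 0) (Code 1 1 0 1 1 0)"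
| "codes_of M3 = Codes (Code 0 0 1 1 0 0) (Code 0 0 1 1 0 0) (Code 1 0 1 1 0 0) (Code 1 0 0 0 0 1) (Code 0 0 1 1 0 1)"
| "codes_of M4 = Codes (Code 0 0 1 1 0 0) (Code 1 0 1 1 0 0) (Code 0 1 1 0 1 0) (Code 1 0 0 0 0 1) (Code 0 1 1 0 1 1)"
| "codes_of M5 = Codes (Code 0 0 1 1 0 0) (Code 1 0 1 1 0 0) (Code 0 1 1 1 0 0) (Code 0 1 0 0 1 0) (Code 1 0 1 1 1 0)"

datatype ent = Skip | Ent h h h h i5 i5 i5 i5 i5 model

fun reds :: "code \<Rightarrow> code list \<Rightarrow> (h \<times> h \<times> h \<times> h) list \<Rightarrow> bool" where
  "reds t [] es = True" | "reds t (f # fs) [] = False"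
| "reds t (f # fs) ((a, b, c, d) # es) = (pull (mk a b c d) f = t \<and> reds t fs es)"

fun fixes_std :: "(h \<times> h \<times> h \<times> h) list \<Rightarrow> bool" where
  "fixes_std [] = True" | "fixes_std ((a, b, c, d) # es) = (pull (mk a b c d) std = std \<and> fixes_std es)"

primrec ent_ok :: "codes \<Rightarrow> ent \<Rightarrow> bool" where
  "ent_ok F Skip \<longleftrightarrow> pfc (cod F IE) = 0"
| "ent_ok F (Ent a b c d p q r s t m) \<longleftrightarrow> distinct [p, q, r, s, t]
     \<and> pull (mk a b c d) (cod F p) = cod (codes_of m) IA \<and> pull (mk a b c d) (cod F q) = cod (codes_of m) IB
     \<and> pull (mk a b c d) (cod F r) = cod (codes_of m) IC \<and> pull (mk a b c d) (cod F s) = cod (codes_of m) ID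
     \<and> pull (mk a b c d) (cod F t) = cod (codes_of m) IE"

text \<open>The five forms sum to zero, so the fifth is the sum of the other four.\<close>

definition completion :: "code \<Rightarrow> code \<Rightarrow> codes" where
  "completion f g = Codes std nb f g (addc (addc std nb) (addc f g))"

fun row :: "code \<Rightarrow> code list \<Rightarrow> ent list \<Rightarrow> bool" where
  "row f [] es = True" | "row f (g # gs) [] = False"
| "row f (g # gs) (e # es) = (ent_ok (completion f g) e \<and> row f gs es)"

fun table :: "code list \<Rightarrow> ent list list \<Rightarrow> bool" where
  "table [] ts = True" | "table (f # fs) [] = False" | "table (f # fs) (t # ts) = (row f pfs t \<and> table fs ts)"

lemma pfs: "pfc f = 1 \<Longrightarrow> f \<in> set pfs"
proof (cases f)
  fix a b c d e g assume "pfc f = 1" "f = Code a b c d e g"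
  thus ?thesis by (cases a; cases b; cases c; cases d; cases e; cases g) (simp_all add: pfs_def)
qed

lemma nbs: "pfc f = 1 \<Longrightarrow> pfc (addc std f) = 1 \<Longrightarrow> f \<in> set nbs"
proof (cases f)
  fix a b c d e g assume "pfc f = 1" "pfc (addc std f) = 1" "f = Code a b c d e g"
  thus ?thesis by (cases a; cases b; cases c; cases d; cases e; cases g) (simp_all add: nbs_def std_def)
qed

lemmas class_rules = eval_rules reds.simps fixes_std.simps ent_ok.simps row.simps table.simps completion_def
    pfs_def nbs_def
  std_def nb_def codes_of.simps

text \<open>Each quadruple is a basis in which the form has the Gram matrix of \<open>std\<close>:
  explicit witnesses that all nondegenerate alternating forms are equivalent.\<close>

lemma reduce_std: "reds std pfs
    [(c1, c2, c4, c8), (c1, c2, c4, c10), (c1, c2, c4, c12), (c1, c2, c4, c14), (c1, c2, c8, c4), (c1, c2, c8, c6),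
     (c1, c2, c8, c12), (c1, c2, c8, c14), (c1, c2, c12, c4), (c1, c2, c12, c6), (c1, c2, c12, c8), (c1, c2,
       c12, c10),
     (c1, c4, c8, c2), (c1, c4, c8, c6), (c1, c4, c8, c10), (c1, c4, c8, c14), (c1, c4, c10, c2), (c1, c4, c10, c6),
     (c1, c4, c10, c8), (c1, c4, c10, c12), (c1, c6, c8, c2), (c1, c6, c8, c4), (c1, c6, c8, c10), (c1, c6, c8, c12),
     (c1, c6, c10, c2), (c1, c6, c10, c4), (c1, c6, c10, c8), (c1, c6, c10, c14)]"
  by (simp only: class_rules)

definition nb_maps :: "(h \<times> h \<times> h \<times> h) list" where
  "nb_maps = [(c1, c3, c4, c12), (c1, c3, c4, c13), (c1, c2, c4, c8), (c1, c2, c4, c9), (c1, c5, c2, c10), (c1,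
    c5, c2, c11),
     (c1, c4, c2, c8), (c1, c4, c2, c9), (c1, c7, c2, c10), (c1, c7, c2, c11), (c1, c6, c2, c8), (c1, c6, c2, c9)]"

text \<open>The 12 forms of \<open>nbs\<close> lie in one orbit under the symplectic group of
  \<open>std\<close>, so the second form can be moved to \<open>nb\<close> while the first stays in
  place.\<close>

lemma reduce_nb: "reds nb nbs nb_maps \<and> fixes_std nb_maps"
  by (simp only: class_rules nb_maps_def)

text \<open>Each of the 784 entries is a certificate for one pair of forms: \<open>Skip\<close>
  where the fifth form is degenerate, otherwise a change of basis and a permutation leading to a
  model.\<close>

lemma classification_table: "table pfs
    [[Ent c1 c2 c4 c8 IA IC ID IB IE M1, Ent c4 c9 c1 c2 IA IC ID IE IB M2, Skip, Skip, Skip, Skip,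
     Ent c1 c2 c4 c8 IA IC IE IB ID M1, Ent c4 c9 c1 c2 IA IC IE ID IB M2, Skip, Skip, Skip, Skip, Skip,
     Ent c1 c2 c5 c11 IA IC ID IB IE M2, Ent c1 c2 c6 c9 IA IC IE IB ID M2, Skip, Skip, Ent c1 c2 c7 c10 IA IC
       IE IB ID M2,
     Ent c1 c2 c4 c8 IA IC ID IB IE M2, Skip, Ent c1 c2 c7 c10 IA IC ID IB IE M2, Skip, Skip,
     Ent c1 c2 c4 c8 IA IC IE IB ID M2, Ent c1 c2 c5 c11 IA IC IE IB ID M2, Skip, Skip, Ent c1 c2 c6 c9 IA IC ID
       IB IE M2],
     [Ent c4 c9 c1 c2 IA ID IC IE IB M2, Ent c4 c11 c1 c2 IC ID IA IE IB M2, Skip, Skip, Skip, Skip,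
     Ent c4 c11 c1 c2 IC IE IA ID IB M2, Ent c4 c9 c1 c2 IA IE IC ID IB M2, Skip, Skip, Skip, Skip,
     Ent c1 c3 c12 c8 IB IE IA ID IC M4, Skip, Skip, Ent c1 c3 c12 c9 IB IE IC ID IA M4,
     Ent c1 c3 c14 c10 IB IE IC ID IA M4, Skip, Skip, Ent c1 c3 c14 c11 IB IE IA ID IC M4, Skip,
     Ent c1 c3 c14 c10 IB ID IC IE IA M4, Ent c1 c3 c14 c11 IB ID IA IE IC M4, Skip, Skip,
     Ent c1 c3 c12 c8 IB ID IA IE IC M4, Ent c1 c3 c12 c9 IB ID IC IE IA M4, Skip],
     [Skip, Skip, Ent c1 c4 c2 c12 IC ID IE IB IA M3, Ent c4 c14 c1 c2 ID IC IE IB IA M5, Skip, Skip,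
     Ent c1 c4 c2 c12 IC IE ID IB IA M3, Ent c4 c14 c1 c2 IE IC ID IB IA M5, Skip, Skip, Skip, Skip,
     Ent c1 c12 c5 c14 ID IC IE IB IA M5, Skip, Skip, Ent c1 c4 c12 c14 ID IE IC IB IA M4,
     Ent c1 c5 c14 c12 ID IE IC IB IA M4, Skip, Skip, Ent c1 c14 c4 c12 ID IC IE IB IA M5,
     Ent c1 c5 c14 c12 IE ID IC IB IA M4, Skip, Skip, Ent c1 c14 c4 c12 IE IC ID IB IA M5,
     Ent c1 c12 c5 c14 IE IC ID IB IA M5, Skip, Skip, Ent c1 c4 c12 c14 IE ID IC IB IA M4],
     [Skip, Skip, Ent c4 c14 c1 c2 IC ID IE IB IA M5, Ent c1 c6 c2 c15 IC ID IE IB IA M3, Skip, Skip,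
     Ent c1 c6 c2 c15 IC IE ID IB IA M3, Ent c4 c14 c1 c2 IC IE ID IB IA M5, Skip, Skip, Skip, Skip, Skip,
     Ent c1 c7 c13 c15 IE ID IC IB IA M4, Ent c1 c13 c6 c15 IE IC ID IB IA M5, Skip, Skip,
     Ent c1 c15 c7 c13 IE IC ID IB IA M5, Ent c1 c6 c15 c13 IE ID IC IB IA M4, Skip, Skip,
     Ent c1 c15 c7 c13 ID IC IE IB IA M5, Ent c1 c6 c15 c13 ID IE IC IB IA M4, Skip, Skip,
     Ent c1 c7 c13 c15 ID IE IC IB IA M4, Ent c1 c13 c6 c15 ID IC IE IB IA M5, Skip],
     [Skip, Skip, Skip, Skip, Ent c1 c8 c2 c4 IC ID IB IA IE M3, Ent c8 c4 c1 c2 IC ID IB IA IE M5,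
     Ent c1 c8 c2 c4 IC IE IB IA ID M3, Ent c8 c4 c1 c2 IC IE IB IA ID M5, Skip, Skip, Skip, Skip,
     Ent c1 c2 c9 c6 IC ID IB IA IE M5, Ent c1 c9 c2 c6 IC IB ID IA IE M4, Ent c1 c2 c9 c6 IC IE IB IA ID M5,
     Ent c1 c9 c2 c6 IC IB IE IA ID M4, Skip, Skip, Skip, Skip, Ent c1 c8 c2 c4 IC IB ID IA IE M4,
     Ent c1 c2 c8 c4 IC ID IB IA IE M5, Ent c1 c8 c2 c4 IC IB IE IA ID M4, Ent c1 c2 c8 c4 IC IE IB IA ID M5,
       Skip, Skip,
     Skip, Skip],
     [Skip, Skip, Skip, Skip, Ent c8 c4 c1 c2 ID IC IB IA IE M5, Ent c1 c11 c2 c5 IC ID IB IA IE M3,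
     Ent c1 c11 c2 c5 IC IE IB IA ID M3, Ent c8 c4 c1 c2 IE IC IB IA ID M5, Skip, Skip, Skip, Skip, Skip, Skip,
       Skip, Skip,
     Ent c1 c10 c2 c7 IC IB IE IA ID M4, Ent c1 c2 c10 c7 IC IE IB IA ID M5, Ent c1 c10 c2 c7 IC IB ID IA IE M4,
     Ent c1 c2 c10 c7 IC ID IB IA IE M5, Skip, Skip, Skip, Skip, Ent c1 c2 c11 c5 IC IE IB IA ID M5,
     Ent c1 c11 c2 c5 IC IB IE IA ID M4, Ent c1 c2 c11 c5 IC ID IB IA IE M5, Ent c1 c11 c2 c5 IC IB ID IA IE M4],
     [Ent c1 c2 c4 c8 IA ID IE IB IC M1, Ent c4 c11 c1 c2 ID IE IA IC IB M2, Ent c1 c4 c2 c12 ID IE IC IB IA M3,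
     Ent c1 c6 c2 c15 ID IE IC IB IA M3, Ent c1 c8 c2 c4 ID IE IB IA IC M3, Ent c1 c11 c2 c5 ID IE IB IA IC M3,
     Ent c1 c2 c8 c12 IC ID IE IA IB M1, Ent c10 c14 c1 c2 ID IE IC IB IA M2, Ent c1 c2 c12 c4 IB ID IE IC IA M1,
     Ent c13 c4 c1 c2 ID IE IB IA IC M2, Ent c1 c12 c2 c8 ID IE IA IC IB M3, Ent c1 c14 c2 c11 ID IE IA IC IB M3,
     Ent c5 c10 c11 c13 ID IE IB IC IA M3, Ent c1 c12 c5 c11 ID IE IA IB IC M2, Ent c1 c4 c9 c15 ID IE IC IA IB M2,
     Ent c1 c8 c13 c7 ID IE IB IC IA M2, Ent c1 c11 c15 c6 ID IE IB IC IA M2, Ent c1 c5 c10 c13 ID IE IC IA IB M2,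
     Ent c1 c14 c4 c8 ID IE IA IB IC M2, Ent c4 c9 c8 c15 ID IE IB IC IA M3, Ent c1 c15 c7 c10 ID IE IA IB IC M2,
     Ent c14 c4 c5 c8 ID IE IC IA IB M3, Ent c1 c9 c14 c5 ID IE IB IC IA M2, Ent c1 c6 c8 c12 ID IE IC IA IB M2,
     Ent c1 c7 c11 c14 ID IE IC IA IB M2, Ent c1 c10 c12 c4 ID IE IB IC IA M2, Ent c11 c15 c14 c6 ID IE IA IB IC M3,
     Ent c1 c13 c6 c9 ID IE IA IB IC M2],
     [Ent c4 c9 c1 c2 IA ID IE IC IB M2, Ent c4 c9 c1 c2 IA IE ID IC IB M2, Ent c4 c14 c1 c2 IE ID IC IB IA M5,
     Ent c4 c14 c1 c2 ID IE IC IB IA M5, Ent c8 c4 c1 c2 ID IE IB IA IC M5, Ent c8 c4 c1 c2 IE ID IB IA IC M5,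
     Ent c10 c14 c1 c2 IC IE ID IB IA M2, Ent c10 c14 c1 c2 IC ID IE IB IA M2, Ent c12 c4 c1 c2 IB ID IE IA IC M2,
     Ent c12 c4 c1 c2 IB IE ID IA IC M2, Ent c13 c9 c1 c2 IE ID IA IC IB M5, Ent c13 c9 c1 c2 ID IE IA IC IB M5,
       Skip, Skip,
     Skip, Skip, Skip, Skip, Skip, Skip, Skip, Skip, Skip, Skip, Skip, Skip, Skip, Skip],
     [Skip, Skip, Skip, Skip, Skip, Skip, Ent c1 c2 c12 c4 IB IC IE ID IA M1, Ent c12 c4 c1 c2 IB IC IE IA ID M2,
     Ent c1 c2 c12 c4 IB IC ID IE IA M1, Ent c12 c4 c1 c2 IB IC ID IA IE M2, Skip, Skip, Skip, Skip,
     Ent c1 c3 c15 c9 IB IC IE IA ID M2, Ent c1 c3 c13 c10 IB IC ID IA IE M2, Ent c1 c3 c15 c9 IB IC ID IA IE M2,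
     Ent c1 c3 c13 c10 IB IC IE IA ID M2, Skip, Skip, Skip, Skip, Ent c1 c3 c14 c11 IB IC ID IA IE M2,
     Ent c1 c3 c12 c8 IB IC IE IA ID M2, Ent c1 c3 c14 c11 IB IC IE IA ID M2, Ent c1 c3 c12 c8 IB IC ID IA IE
       M2, Skip,
     Skip],
     [Skip, Skip, Skip, Skip, Skip, Skip, Ent c13 c4 c1 c2 IC IE IB IA ID M2, Ent c12 c4 c1 c2 IB IE IC IA ID M2,
     Ent c12 c4 c1 c2 IB ID IC IA IE M2, Ent c13 c4 c1 c2 IC ID IB IA IE M2, Skip, Skip, Ent c1 c2 c4 c8 IA IE
       IB ID IC M4,
     Ent c1 c2 c4 c9 IA IE IC ID IB M4, Skip, Skip, Skip, Skip, Ent c1 c2 c4 c8 IA ID IB IE IC M4,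
     Ent c1 c2 c4 c9 IA ID IC IE IB M4, Ent c1 c2 c6 c8 IA IE IC ID IB M4, Ent c1 c2 c6 c9 IA IE IB ID IC M4,
       Skip, Skip,
     Skip, Skip, Ent c1 c2 c6 c8 IA ID IC IE IB M4, Ent c1 c2 c6 c9 IA ID IB IE IC M4],
     [Skip, Skip, Skip, Skip, Skip, Skip, Ent c1 c12 c2 c8 IC IE IA ID IB M3, Ent c13 c9 c1 c2 IE IC IA ID IB
       M5, Skip, Skip,
     Ent c1 c12 c2 c8 IC ID IA IE IB M3, Ent c13 c9 c1 c2 ID IC IA IE IB M5, Ent c1 c4 c13 c7 ID IC IE IA IB M5,
     Ent c1 c12 c4 c7 ID IE IC IA IB M4, Skip, Skip, Ent c1 c12 c4 c7 IE ID IC IA IB M4, Ent c1 c4 c13 c7 IE IC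
       ID IA IB M5,
     Skip, Skip, Skip, Skip, Ent c1 c13 c7 c4 IE ID IC IA IB M4, Ent c1 c7 c12 c4 IE IC ID IA IB M5, Skip, Skip,
     Ent c1 c7 c12 c4 ID IC IE IA IB M5, Ent c1 c13 c7 c4 ID IE IC IA IB M4],
     [Skip, Skip, Skip, Skip, Skip, Skip, Ent c1 c14 c2 c11 IC IE IA ID IB M3, Ent c13 c9 c1 c2 IC IE IA ID IB
       M5, Skip,
     Skip, Ent c13 c9 c1 c2 IC ID IA IE IB M5, Ent c1 c14 c2 c11 IC ID IA IE IB M3, Skip, Skip,
     Ent c1 c5 c15 c6 IE IC ID IA IB M5, Ent c1 c14 c5 c6 IE ID IC IA IB M4, Skip, Skip, Ent c1 c14 c5 c6 ID IE
       IC IA IB M4,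
     Ent c1 c5 c15 c6 ID IC IE IA IB M5, Ent c1 c15 c6 c5 ID IE IC IA IB M4, Ent c1 c6 c14 c5 ID IC IE IA IB M5,
       Skip, Skip,
     Ent c1 c6 c14 c5 IE IC ID IA IB M5, Ent c1 c15 c6 c5 IE ID IC IA IB M4, Skip, Skip],
     [Skip, Ent c1 c3 c12 c8 IB IE IA IC ID M4, Ent c1 c12 c5 c14 IC ID IE IB IA M5, Skip, Ent c1 c2 c9 c6 ID IC
       IB IA IE M5,
     Skip, Ent c5 c10 c11 c13 IC IE IB ID IA M3, Skip, Skip, Ent c1 c2 c4 c8 IA IE IB IC ID M4,
     Ent c1 c4 c13 c7 IC ID IE IA IB M5, Skip, Ent c5 c10 c11 c13 IC ID IB IE IA M3, Skip,
     Ent c1 c2 c9 c6 IE IC IB IA ID M5, Skip, Skip, Ent c1 c4 c13 c7 IC IE ID IA IB M5, Ent c1 c2 c4 c8 IA ID IB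
       IC IE M4,
     Skip, Skip, Skip, Skip, Skip, Ent c1 c12 c5 c14 IC IE ID IB IA M5, Ent c1 c3 c12 c8 IB ID IA IC IE M4,
       Skip, Skip],
     [Ent c1 c2 c5 c11 IA ID IC IB IE M2, Skip, Skip, Ent c1 c7 c13 c15 IE IC ID IB IA M4, Ent c1 c9 c2 c6 ID IB
       IC IA IE M4,
     Skip, Ent c1 c12 c5 c11 IC IE IA IB ID M2, Skip, Skip, Ent c1 c2 c4 c9 IA IE ID IC IB M4,
     Ent c1 c12 c4 c7 IC IE ID IA IB M4, Skip, Skip, Ent c1 c12 c5 c11 IC ID IA IB IE M2, Skip,
     Ent c1 c9 c2 c6 IE IB IC IA ID M4, Ent c1 c12 c4 c7 IC ID IE IA IB M4, Skip, Skip, Ent c1 c2 c4 c9 IA ID IE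
       IC IB M4,
     Skip, Skip, Skip, Skip, Ent c1 c2 c5 c11 IA IE IC IB ID M2, Ent c1 c7 c13 c15 ID IC IE IB IA M4, Skip, Skip],
     [Ent c1 c2 c6 c9 IA ID IE IB IC M2, Skip, Skip, Ent c1 c13 c6 c15 IE ID IC IB IA M5, Ent c1 c2 c9 c6 ID IE
       IB IA IC M5,
     Skip, Ent c1 c4 c9 c15 IC IE ID IA IB M2, Skip, Ent c1 c3 c15 c9 IB ID IE IA IC M2, Skip, Skip,
     Ent c1 c5 c15 c6 IE ID IC IA IB M5, Ent c1 c2 c9 c6 IE ID IB IA IC M5, Skip, Ent c1 c4 c9 c15 IC ID IE IA
       IB M2, Skip,
     Ent c1 c3 c15 c9 IB IE ID IA IC M2, Skip, Skip, Ent c1 c5 c15 c6 ID IE IC IA IB M5, Skip, Skip, Skip, Skip,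
       Skip, Skip,
     Ent c1 c13 c6 c15 ID IE IC IB IA M5, Ent c1 c2 c6 c9 IA IE ID IB IC M2],
     [Skip, Ent c1 c3 c12 c9 IB IE ID IC IA M4, Ent c1 c4 c12 c14 IC IE ID IB IA M4, Skip, Ent c1 c9 c2 c6 ID IB
       IE IA IC M4,
     Skip, Ent c1 c8 c13 c7 IC IE IB ID IA M2, Skip, Ent c1 c3 c13 c10 IB ID IC IA IE M2, Skip, Skip,
     Ent c1 c14 c5 c6 IE IC ID IA IB M4, Skip, Ent c1 c9 c2 c6 IE IB ID IA IC M4, Skip, Ent c1 c8 c13 c7 IC ID
       IB IE IA M2,
     Skip, Ent c1 c3 c13 c10 IB IE IC IA ID M2, Ent c1 c14 c5 c6 ID IC IE IA IB M4, Skip, Skip, Skip, Skip,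
       Skip, Skip,
     Skip, Ent c1 c3 c12 c9 IB ID IE IC IA M4, Ent c1 c4 c12 c14 IC ID IE IB IA M4],
     [Skip, Ent c1 c3 c14 c10 IB IE ID IC IA M4, Ent c1 c5 c14 c12 IC IE ID IB IA M4, Skip, Skip,
     Ent c1 c10 c2 c7 ID IB IE IA IC M4, Ent c1 c11 c15 c6 IC IE IB ID IA M2, Skip, Ent c1 c3 c15 c9 IB ID IC IA
       IE M2,
     Skip, Ent c1 c12 c4 c7 IE IC ID IA IB M4, Skip, Skip, Ent c1 c12 c4 c7 ID IC IE IA IB M4,
     Ent c1 c3 c15 c9 IB IE IC IA ID M2, Skip, Ent c1 c11 c15 c6 IC ID IB IE IA M2, Skip,
     Ent c1 c10 c2 c7 IE IB ID IA IC M4, Skip, Ent c1 c5 c14 c12 IC ID IE IB IA M4, Ent c1 c3 c14 c10 IB ID IE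
       IC IA M4,
     Skip, Skip, Skip, Skip, Skip, Skip],
     [Ent c1 c2 c7 c10 IA ID IE IB IC M2, Skip, Skip, Ent c1 c15 c7 c13 IE ID IC IB IA M5, Skip,
     Ent c1 c2 c10 c7 ID IE IB IA IC M5, Ent c1 c5 c10 c13 IC IE ID IA IB M2, Skip, Ent c1 c3 c13 c10 IB ID IE
       IA IC M2,
     Skip, Ent c1 c4 c13 c7 IE ID IC IA IB M5, Skip, Ent c1 c4 c13 c7 ID IE IC IA IB M5, Skip, Skip,
     Ent c1 c3 c13 c10 IB IE ID IA IC M2, Skip, Ent c1 c5 c10 c13 IC ID IE IA IB M2, Skip,
     Ent c1 c2 c10 c7 IE ID IB IA IC M5, Ent c1 c2 c7 c10 IA IE ID IB IC M2, Ent c1 c15 c7 c13 ID IE IC IB IA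
       M5, Skip,
     Skip, Skip, Skip, Skip, Skip],
     [Ent c1 c2 c4 c8 IA ID IC IB IE M2, Skip, Skip, Ent c1 c6 c15 c13 IE IC ID IB IA M4, Skip,
     Ent c1 c10 c2 c7 ID IB IC IA IE M4, Ent c1 c14 c4 c8 IC IE IA IB ID M2, Skip, Skip, Ent c1 c2 c4 c8 IA IC
       IB IE ID M4,
     Skip, Ent c1 c14 c5 c6 IC IE ID IA IB M4, Ent c1 c2 c4 c8 IA IC IB ID IE M4, Skip, Skip,
     Ent c1 c14 c5 c6 IC ID IE IA IB M4, Ent c1 c10 c2 c7 IE IB IC IA ID M4, Skip, Ent c1 c14 c4 c8 IC ID IA IB
       IE M2, Skip,
     Skip, Skip, Ent c1 c6 c15 c13 ID IC IE IB IA M4, Ent c1 c2 c4 c8 IA IE IC IB ID M2, Skip, Skip, Skip, Skip],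
     [Skip, Ent c1 c3 c14 c11 IB IE IA IC ID M4, Ent c1 c14 c4 c12 IC ID IE IB IA M5, Skip, Skip,
     Ent c1 c2 c10 c7 ID IC IB IA IE M5, Ent c4 c9 c8 c15 IC IE IB ID IA M3, Skip, Skip, Ent c1 c2 c4 c9 IA IC
       ID IE IB M4,
     Skip, Ent c1 c5 c15 c6 IC ID IE IA IB M5, Skip, Ent c1 c2 c4 c9 IA IC IE ID IB M4, Ent c1 c5 c15 c6 IC IE
       ID IA IB M5,
     Skip, Skip, Ent c1 c2 c10 c7 IE IC IB IA ID M5, Skip, Ent c4 c9 c8 c15 IC ID IB IE IA M3, Skip, Skip,
     Ent c1 c3 c14 c11 IB ID IA IC IE M4, Ent c1 c14 c4 c12 IC IE ID IB IA M5, Skip, Skip, Skip, Skip],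
     [Ent c1 c2 c7 c10 IA ID IC IB IE M2, Skip, Ent c1 c5 c14 c12 IE IC ID IB IA M4, Skip, Ent c1 c8 c2 c4 ID IB
       IC IA IE M4,
     Skip, Ent c1 c15 c7 c10 IC IE IA IB ID M2, Skip, Skip, Ent c1 c2 c6 c8 IA IE ID IC IB M4, Skip,
     Ent c1 c15 c6 c5 IC IE ID IA IB M4, Skip, Skip, Skip, Skip, Ent c1 c5 c14 c12 ID IC IE IB IA M4,
     Ent c1 c2 c7 c10 IA IE IC IB ID M2, Skip, Skip, Ent c1 c15 c7 c10 IC ID IA IB IE M2, Skip,
     Ent c1 c8 c2 c4 IE IB IC IA ID M4, Skip, Skip, Ent c1 c15 c6 c5 IC ID IE IA IB M4, Ent c1 c2 c6 c8 IA ID IE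
       IC IB M4,
     Skip],
     [Skip, Ent c1 c3 c14 c10 IB IC ID IE IA M4, Skip, Ent c1 c15 c7 c13 IC ID IE IB IA M5,
     Ent c1 c2 c8 c4 ID IC IB IA IE M5, Skip, Ent c14 c4 c5 c8 IC IE ID IA IB M3, Skip, Skip,
     Ent c1 c2 c6 c9 IA IE IB IC ID M4, Skip, Ent c1 c6 c14 c5 IC ID IE IA IB M5, Skip, Skip, Skip, Skip,
     Ent c1 c3 c14 c10 IB IC IE ID IA M4, Ent c1 c15 c7 c13 IC IE ID IB IA M5, Skip, Skip, Skip,
     Ent c14 c4 c5 c8 IC ID IE IA IB M3, Skip, Ent c1 c2 c8 c4 IE IC IB IA ID M5, Ent c1 c6 c14 c5 IC IE ID IA
       IB M5, Skip,
     Skip, Ent c1 c2 c6 c9 IA ID IB IC IE M4],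
     [Skip, Ent c1 c3 c14 c11 IB IC IA IE ID M4, Skip, Ent c1 c6 c15 c13 IC IE ID IB IA M4,
     Ent c1 c8 c2 c4 ID IB IE IA IC M4, Skip, Ent c1 c9 c14 c5 IC IE IB ID IA M2, Skip, Ent c1 c3 c14 c11 IB ID
       IC IA IE M2,
     Skip, Ent c1 c13 c7 c4 IE IC ID IA IB M4, Skip, Skip, Skip, Skip, Skip, Skip, Skip,
     Ent c1 c6 c15 c13 IC ID IE IB IA M4, Ent c1 c3 c14 c11 IB IC IA ID IE M4, Ent c1 c8 c2 c4 IE IB ID IA IC
       M4, Skip,
     Ent c1 c9 c14 c5 IC ID IB IE IA M2, Skip, Ent c1 c3 c14 c11 IB IE IC IA ID M2, Skip, Skip,
     Ent c1 c13 c7 c4 ID IC IE IA IB M4],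
     [Ent c1 c2 c4 c8 IA ID IE IB IC M2, Skip, Ent c1 c14 c4 c12 IE ID IC IB IA M5, Skip, Ent c1 c2 c8 c4 ID IE
       IB IA IC M5,
     Skip, Ent c1 c6 c8 c12 IC IE ID IA IB M2, Skip, Ent c1 c3 c12 c8 IB ID IE IA IC M2, Skip,
     Ent c1 c7 c12 c4 IE ID IC IA IB M5, Skip, Skip, Skip, Skip, Skip, Skip, Skip, Ent c1 c2 c4 c8 IA IE ID IB IC M2,
     Ent c1 c14 c4 c12 ID IE IC IB IA M5, Skip, Ent c1 c2 c8 c4 IE ID IB IA IC M5, Skip, Ent c1 c6 c8 c12 IC ID
       IE IA IB M2,
     Skip, Ent c1 c3 c12 c8 IB IE ID IA IC M2, Ent c1 c7 c12 c4 ID IE IC IA IB M5, Skip],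
     [Ent c1 c2 c5 c11 IA ID IE IB IC M2, Skip, Ent c1 c12 c5 c14 IE ID IC IB IA M5, Skip, Skip,
     Ent c1 c2 c11 c5 ID IE IB IA IC M5, Ent c1 c7 c11 c14 IC IE ID IA IB M2, Skip, Ent c1 c3 c14 c11 IB ID IE
       IA IC M2,
     Skip, Skip, Ent c1 c6 c14 c5 IE ID IC IA IB M5, Ent c1 c12 c5 c14 ID IE IC IB IA M5,
     Ent c1 c2 c5 c11 IA IE ID IB IC M2, Skip, Skip, Skip, Skip, Skip, Skip, Skip, Ent c1 c6 c14 c5 ID IE IC IA IB M5,
     Ent c1 c3 c14 c11 IB IE ID IA IC M2, Skip, Ent c1 c7 c11 c14 IC ID IE IA IB M2, Skip,
     Ent c1 c2 c11 c5 IE ID IB IA IC M5, Skip],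
     [Skip, Ent c1 c3 c12 c8 IB IC IA IE ID M4, Skip, Ent c1 c7 c13 c15 IC IE ID IB IA M4, Skip,
     Ent c1 c11 c2 c5 ID IB IE IA IC M4, Ent c1 c10 c12 c4 IC IE IB ID IA M2, Skip, Ent c1 c3 c12 c8 IB ID IC IA
       IE M2,
     Skip, Skip, Ent c1 c15 c6 c5 IE IC ID IA IB M4, Ent c1 c3 c12 c8 IB IC IA ID IE M4,
     Ent c1 c7 c13 c15 IC ID IE IB IA M4, Skip, Skip, Skip, Skip, Skip, Skip, Ent c1 c15 c6 c5 ID IC IE IA IB
       M4, Skip,
     Skip, Ent c1 c3 c12 c8 IB IE IC IA ID M2, Skip, Ent c1 c10 c12 c4 IC ID IB IE IA M2, Skip,
     Ent c1 c11 c2 c5 IE IB ID IA IC M4],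
     [Skip, Ent c1 c3 c12 c9 IB IC ID IE IA M4, Skip, Ent c1 c13 c6 c15 IC ID IE IB IA M5, Skip,
     Ent c1 c2 c11 c5 ID IC IB IA IE M5, Ent c11 c15 c14 c6 IC IE IA IB ID M3, Skip, Skip,
     Ent c1 c2 c6 c8 IA IC ID IE IB M4, Ent c1 c7 c12 c4 IC ID IE IA IB M5, Skip, Skip, Skip,
     Ent c1 c13 c6 c15 IC IE ID IB IA M5, Ent c1 c3 c12 c9 IB IC IE ID IA M4, Skip, Skip, Skip, Skip,
     Ent c1 c2 c6 c8 IA IC IE ID IB M4, Skip, Skip, Ent c1 c7 c12 c4 IC IE ID IA IB M5, Ent c1 c2 c11 c5 IE IC
       IB IA ID M5,
     Skip, Ent c11 c15 c14 c6 IC ID IA IB IE M3, Skip],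
     [Ent c1 c2 c6 c9 IA ID IC IB IE M2, Skip, Ent c1 c4 c12 c14 IE IC ID IB IA M4, Skip, Skip,
     Ent c1 c11 c2 c5 ID IB IC IA IE M4, Ent c1 c13 c6 c9 IC IE IA IB ID M2, Skip, Skip, Ent c1 c2 c6 c9 IA IC
       IB IE ID M4,
     Ent c1 c13 c7 c4 IC IE ID IA IB M4, Skip, Skip, Skip, Ent c1 c2 c6 c9 IA IE IC IB ID M2,
     Ent c1 c4 c12 c14 ID IC IE IB IA M4, Skip, Skip, Skip, Skip, Skip, Ent c1 c2 c6 c9 IA IC IB ID IE M4,
     Ent c1 c13 c7 c4 IC ID IE IA IB M4, Skip, Skip, Ent c1 c11 c2 c5 IE IB IC IA ID M4, Skip,
     Ent c1 c13 c6 c9 IC ID IA IB IE M2]]"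
  by (simp only: class_rules)

section \<open>The Pfaffian as a quadratic form, and the classification\<close>

lemma fev_addc: "fev (addc f g) x y = fev f x y + fev g x y"
  by (cases f; cases g; cases x; cases y) (simp only: addc.simps fev.simps distrib_right add_ac)

lemma pull_addc: "pull k (addc f g) = addc (pull k f) (pull k g)"
  by (simp only: pull_def fev_addc addc.simps)

lemma pfc_nondeg:
  assumes "\<And>x. (\<And>y. fev f x y = 0) \<Longrightarrow> x = 0"
  shows "pfc f = 1"
proof (rule ccontr)
  obtain a b c d e g where f: "f = Code a b c d e g" by (cases f)
  assume "pfc f \<noteq> 1"
  hence "a * g + b * e + c * d = 0" by (simp only: f pfc.simps) (metis bit_not_one_iff)
  from pfaffian_kernel[OF this] obtain p q r s where n: "\<not> (p = 0 \<and> q = 0 \<and> r = 0 \<and> s = 0)"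
    and k: "q * a + r * b + s * c = 0" "p * a + r * d + s * e = 0" "p * b + q * d + s * g = 0" "p * c + q * e +
      r * g = 0"
    by blast
  have sm: "smul t (H p q r s) = H (t * p) (t * q) (t * r) (t * s)" for t p q r s
    by (cases t) (simp_all add: smul_def zero_h_def)
  have "sel (nodef f) (H p q r s) = 0"
    using k by (simp only: f nodef.simps sel_mk sm plus_h.simps zero_h_def mult_zero_right add_0 add_0_right)
  hence "fev f (H p q r s) y = 0" for y
    by (simp only: fev_dot_left) (cases y, simp add: zero_h_def)
  hence "H p q r s = 0" using assms by blast
  thus False using n by (simp add: zero_h_def)
qed

lemma pfc_pull:
  assumes k: "bij (sel (mk a b c d))" and f: "pfc f = 1"
  shows "pfc (pull (mk a b c d) f) = 1"
proof (rule pfc_nondeg)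
  fix x assume z: "\<And>y. fev (pull (mk a b c d) f) x y = 0"
  have "sel (nodef f) (sel (mk a b c d) x) = 0"
  proof (rule dot_nondeg)
    fix y obtain y' where "y = sel (mk a b c d) y'" using k by (metis bij_def surjD)
    thus "dot y (sel (nodef f) (sel (mk a b c d) x)) = 0"
      using z[of y'] by (simp only: fev_dot[symmetric] fev_pull fev_commute[of f _ "sel (mk a b c d) x"])
  qed
  hence "sel (mk a b c d) x = 0" by (rule nodef_ker[OF f])
  moreover have "sel (mk a b c d) 0 = 0" using sel_mk_add[of a b c d 0 0] by simp
  ultimately show "x = 0" using k by (metis bij_def injD)
qed

text \<open>The words move by the inverse of the map that pulls back the forms.\<close>

lemma conf_pull:
  assumes cf: "conf F Y X" and p: "bij p" and k: "pfc (pull (mk a b c d) (cod F i)) = 1"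
    and F': "\<And>j. cod F' j = pull (mk a b c d) (cod F (p j))"
  shows "\<exists>Y X. conf F' Y X"
proof -
  let ?k = "sel (mk a b c d)" and ?g = "inv_into UNIV (sel (mk a b c d))"
  have b: "bij ?k" by (rule pull_bij[OF k])
  have kk: "?k (?g x) = x" "?g (?k x) = x" for x using b by (simp_all add: bij_def surj_f_inv_f)
  have gadd: "?g (x + y) = ?g x + ?g y" for x y
    using sel_mk_add[of a b c d "?g x" "?g y"] by (simp only: kk) (metis kk(2))
  have fv: "fv F' j (?g x) (?g y) = fv F (p j) x y" for j x y by (simp only: F' fev_pull kk)
  have "pfc (cod F' j) = 1" for j using pfc_pull[OF b] conf_pf[OF cf] by (simp only: F')
  thus ?thesis using conf_act[OF p bij_imp_bij_inv[OF b] gadd fv _ cf] by blast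
qed

text \<open>Constant words are orthogonal to each other, so the five forms sum to zero as functions;
  a form is recovered from its values on pairs of basis vectors.\<close>

lemma conf_sum:
  assumes cf: "conf F Y X"
  shows "cod F IE = addc (addc (cod F IA) (cod F IB)) (addc (cod F IC) (cod F ID))"
proof -
  have e: "a + (b + (c + (d + e))) = 0 \<Longrightarrow> e = (a + b) + (c + d)" for a b c d e :: bit
    by (cases a; cases b; cases c; cases d; cases e) simp_all
  have s: "fv F IE x y = fev (addc (addc (cod F IA) (cod F IB)) (addc (cod F IC) (cod F ID))) x y" for x y
    using conf_zero[OF cf, rule_format, of x y] by (simp only: gram_expand fev_addc) (rule e)
  have u: "f = Code (fev f c1 c2) (fev f c1 c4) (fev f c1 c8) (fev f c2 c4) (fev f c2 c8) (fev f c4 c8)" for f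
    by (cases f) (simp add: c_defs)
  show ?thesis by (subst (1) u, subst u) (simp only: s)
qed

text \<open>The bilinear form that polarises the quadratic form \<open>pfc\<close>.\<close>

fun polar :: "code \<Rightarrow> code \<Rightarrow> bit" where
  "polar (Code a b c d e f) (Code a' b' c' d' e' f') = a * f' + f * a' + b * e' + e * b' + c * d' + d * c'"

lemma pfc_addc: "pfc (addc f g) = pfc f + pfc g + polar f g"
  by (cases f; cases g) (simp only: addc.simps pfc.simps polar.simps distrib_left distrib_right ac_simps)

lemma polar_addc: "polar (addc f g) h = polar f h + polar g h" "polar h (addc f g) = polar h f + polar h g"
  by (cases f; cases g; cases h; simp only: addc.simps polar.simps distrib_left distrib_right ac_simps)+

text \<open>
  A quadratic form evaluated at a sum of four vectors; the terms of the single vectors cancel modulo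
  two.
\<close>

lemma pfc_sum4: "pfc (addc (addc f g) (addc h k)) = pfc (addc f g) + pfc (addc f h) + pfc (addc f k) + pfc (addc g h)
    + pfc (addc g k) + pfc (addc h k)"
proof -
  have b: "(t::bit) + t = 0" "t + (t + u) = u" for t u by (cases t; cases u; simp)+
  show ?thesis by (simp only: pfc_addc polar_addc) (simp only: ac_simps b add_0_right)
qed

lemma reds_mem: "reds t fs es \<Longrightarrow> f \<in> set fs \<Longrightarrow> \<exists>a b c d. (a, b, c, d) \<in> set es \<and> pull (mk a b c d) f = t"
  by (induction t fs es rule: reds.induct) auto

lemma fixes_mem: "fixes_std es \<Longrightarrow> (a, b, c, d) \<in> set es \<Longrightarrow> pull (mk a b c d) std = std"
  by (induction es rule: fixes_std.induct) auto

lemma row_mem: "row f gs es \<Longrightarrow> g \<in> set gs \<Longrightarrow> \<exists>e. ent_ok (completion f g) e"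
  by (induction f gs es rule: row.induct) auto

lemma table_mem: "table fs ts \<Longrightarrow> f \<in> set fs \<Longrightarrow> \<exists>es. row f pfs es"
  by (induction fs ts rule: table.induct) auto

lemma no_conf_model: "\<not> conf (codes_of m) Y X"
  by (cases m) (use chk_I chk_II chk_III chk_C chk_V chk_sound in \<open>force simp only: codes_of.simps\<close>)+

text \<open>The fifth form is nondegenerate and the sum of the other four, so by
  \<open>pfc_sum4\<close> the Pfaffians of the six pairwise sums add up to 1 and some pair has a
  nonsingular sum. Moving this pair to the front makes the reductions to \<open>std\<close> and
  \<open>nb\<close> and then the table applicable.\<close>

theorem no_conf: "\<not> conf F Y X"
proof
  assume cf: "conf F Y X"
  note pf = conf_pf[OF cf, rule_format]
  have ex: "\<exists>q. bij q \<and> pfc (addc (cod F (q IA)) (cod F (q IB))) = 1"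
    if "distinct [i, j, r, s, t]" "pfc (addc (cod F i) (cod F j)) = 1" for i j r s t
    using arr_bij[OF that(1)] that(2) by (intro exI[of _ "arr i j r s t"]) (simp add: arr_simps)
  obtain p where p: "bij p" and pp: "pfc (addc (cod F (p IA)) (cod F (p IB))) = 1"
  proof -
    have "pfc (addc (addc (cod F IA) (cod F IB)) (addc (cod F IC) (cod F ID))) = 1"
      using pf[of IE] conf_sum[OF cf] by simp
    hence "pfc (addc (cod F IA) (cod F IB)) = 1 \<or> pfc (addc (cod F IA) (cod F IC)) = 1 \<or> pfc (addc (cod F IA)
      (cod F ID)) = 1
        \<or> pfc (addc (cod F IB) (cod F IC)) = 1 \<or> pfc (addc (cod F IB) (cod F ID)) = 1 \<or> pfc (addc (cod F IC)
          (cod F ID)) = 1"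
      unfolding pfc_sum4 by (metis add_0 bit_not_one_iff)
    hence "\<exists>q. bij q \<and> pfc (addc (cod F (q IA)) (cod F (q IB))) = 1"
      using ex[of IA IB IC ID IE] ex[of IA IC IB ID IE] ex[of IA ID IB IC IE] ex[of IB IC IA ID IE]
        ex[of IB ID IA IC IE] ex[of IC ID IA IB IE]
      by (elim disjE) simp_all
    thus thesis using that by blast
  qed
  obtain a b c d where g: "pull (mk a b c d) (cod F (p IA)) = std"
    using reds_mem[OF reduce_std pfs[OF pf]] by blast
  let ?P = "pull (mk a b c d)"
  let ?F1 = "Codes std (?P (cod F (p IB))) (?P (cod F (p IC))) (?P (cod F (p ID))) (?P (cod F (p IE)))"
  have s1: "pfc std = 1" by (simp add: std_def)
  have k1: "pfc (?P (cod F (p IA))) = 1" by (simp add: g s1)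
  have "cod ?F1 j = ?P (cod F (p j))" for j by (cases j) (simp_all add: g)
  from conf_pull[OF cf p k1 this] obtain Y1 X1 where cf1: "conf ?F1 Y1 X1" by blast
  let ?f2 = "?P (cod F (p IB))"
  have "pfc (addc std ?f2) = 1"
    using pfc_pull[OF pull_bij[OF k1] pp] by (simp only: pull_addc g)
  moreover have "pfc ?f2 = 1" using conf_pf[OF cf1, rule_format, of IB] by simp
  ultimately obtain a' b' c' d' where m: "(a', b', c', d') \<in> set nb_maps" "pull (mk a' b' c' d') ?f2 = nb"
    using reds_mem[OF conjunct1[OF reduce_nb]] nbs by blast
  let ?Q = "pull (mk a' b' c' d')"
  have Qs: "?Q std = std" by (rule fixes_mem[OF conjunct2[OF reduce_nb] m(1)])
  let ?F2 = "Codes std nb (?Q (cod ?F1 IC)) (?Q (cod ?F1 ID)) (?Q (cod ?F1 IE))"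
  have "cod ?F2 j = ?Q (cod ?F1 (id j))" for j by (cases j) (simp_all add: m Qs)
  moreover have "pfc (?Q (cod ?F1 IA)) = 1" by (simp add: Qs s1)
  ultimately obtain Y2 X2 where cf2: "conf ?F2 Y2 X2" using conf_pull[OF cf1 bij_id] by blast
  define f3 f4 where "f3 = ?Q (cod ?F1 IC)" and "f4 = ?Q (cod ?F1 ID)"
  have F2: "?F2 = completion f3 f4"
    using conf_sum[OF cf2] by (simp add: completion_def f3_def f4_def)
  note cf2 = cf2[unfolded F2]
  note pf2 = conf_pf[OF cf2, rule_format]
  have "f3 \<in> set pfs" "f4 \<in> set pfs" using pf2[of IC] pf2[of ID] by (auto simp: completion_def intro: pfs)
  then obtain e where e: "ent_ok (completion f3 f4) e"
    using table_mem[OF classification_table] row_mem by blast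
  show False
  proof (cases e)
    case Skip
    thus False using e pf2[of IE] by simp
  next
    case (Ent a b c d p q r s t m)
    have "cod (codes_of m) j = pull (mk a b c d) (cod (completion f3 f4) (arr p q r s t j))" for j
      using e by (cases j) (simp_all add: Ent arr_simps)
    moreover have "bij (arr p q r s t)" using e by (intro arr_bij) (simp add: Ent)
    moreover have "pfc (pull (mk a b c d) (cod (completion f3 f4) p)) = 1"
    proof -
      have "pull (mk a b c d) (cod (completion f3 f4) p) = cod (codes_of m) IA" using e by (simp add: Ent)
      thus ?thesis by (cases m) simp_all
    qed
    ultimately show False using conf_pull[OF cf2] no_conf_model by blast
  qed
qed

subsection \<open>From codes to configurations\<close>

lemma form_code:
  fixes B :: "h \<Rightarrow> h \<Rightarrow> bit"
  assumes add: "\<And>x y z. B (x + y) z = B x z + B y z" and com: "\<And>x y. B x y = B y x" and self: "\<And>x. B x x = 0"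
  obtains f where "\<And>x y. fev f x y = B x y"
proof
  fix x y
  obtain x0 x1 x2 x3 y0 y1 y2 y3 where xy: "x = H x0 x1 x2 x3" "y = H y0 y1 y2 y3" by (cases x; cases y)
  have z: "B 0 v = 0" for v using add[of 0 0 v] by (simp only: add_0) (metis add_cancel_left_right)
  have addr: "B z (x + y) = B z x + B z y" for x y z by (simp only: com[of z] add)
  have sl: "B (smul t u) v = t * B u v" for t u v by (cases t) (simp_all add: smul_def z)
  have sr: "B u (smul t v) = t * B u v" for t u v using sl[of t v u] by (simp only: com[of u])
  have H: "H a b c d = smul a c1 + smul b c2 + smul c c4 + smul d c8" for a b c d
    by (cases a; cases b; cases c; cases d) (simp_all add: smul_def c_defs zero_h_def)
  have "B x y = B (smul x0 c1 + smul x1 c2 + smul x2 c4 + smul x3 c8) (smul y0 c1 + smul y1 c2 + smul y2 c4 +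
    smul y3 c8)"
    by (simp only: xy H)
  also have "\<dots> = fev (Code (B c1 c2) (B c1 c4) (B c1 c8) (B c2 c4) (B c2 c8) (B c4 c8)) x y"
    by (simp only: xy fev.simps add addr sl sr self)
      (simp only: mult_zero_left mult_zero_right add_0 add_0_right distrib_left distrib_right ac_simps com[of c2 c1]
        com[of c4 c1] com[of c8 c1] com[of c4 c2] com[of c8 c2] com[of c8 c4])
  finally show "fev (Code (B c1 c2) (B c1 c4) (B c1 c8) (B c2 c4) (B c2 c8) (B c4 c8)) x y = B x y" ..
qed

context symplectic_letters
begin

text \<open>A basis is chosen greedily: as long as the span has fewer than 16 elements, some letter
  lies outside it.\<close>

lemma coordinates:
  "\<exists>\<beta> :: h \<Rightarrow> 'v. bij \<beta> \<and> (\<forall>x y. \<beta> (x + y) = \<beta> x + \<beta> y)"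
proof -
  have new: "\<exists>b :: 'v. b \<notin> set xs" if "length xs < 16" for xs
  proof (rule ccontr)
    assume "\<nexists>b :: 'v. b \<notin> set xs"
    hence "set xs = UNIV" by blast
    hence "card (set xs) = 16" by (simp add: card_letters)
    thus False using card_length[of xs] that by simp
  qed
  obtain b1 :: 'v where b1: "b1 \<notin> set [0]" using new[of "[0]"] by auto
  obtain b2 where b2: "b2 \<notin> set [0, b1]" using new[of "[0, b1]"] by auto
  obtain b3 where b3: "b3 \<notin> set [0, b1, b2, b1 + b2]" using new[of "[0, b1, b2, b1 + b2]"] by auto
  obtain b4 where b4: "b4 \<notin> set [0, b1, b2, b1 + b2, b3, b1 + b3, b2 + b3, b1 + b2 + b3]"
    using new[of "[0, b1, b2, b1 + b2, b3, b1 + b3, b2 + b3, b1 + b2 + b3]"] by auto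
  define sc where "sc t x = (if t = 0 then 0 else x)" for t :: bit and x :: 'v
  define \<beta> where "\<beta> x = (case x of H a b c d \<Rightarrow> sc a b1 + sc b b2 + sc c b3 + sc d b4)" for x
  have eq: "u + v = 0 \<longleftrightarrow> v = u" for u v :: 'v by (metis add_left_cancel char2)
  have sc_add: "sc (t + u) x = sc t x + sc u x" for t u x by (cases t; cases u) (simp_all add: sc_def char2)
  have add: "\<beta> (x + y) = \<beta> x + \<beta> y" for x y
    by (cases x; cases y) (simp only: plus_h.simps \<beta>_def h.case sc_add add_ac)
  have ker: "x = 0" if x: "\<beta> x = 0" for x
  proof -
    obtain a b c d where H: "x = H a b c d" by (cases x)
    have e: "sc a b1 + sc b b2 + sc c b3 + sc d b4 = 0" using x by (simp add: \<beta>_def H)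
    have d: "d = 0"
    proof (rule ccontr)
      assume "d \<noteq> 0"
      hence "b4 = sc a b1 + sc b b2 + sc c b3" using e by (simp add: sc_def eq)
      thus False using b4 by (cases a; cases b; cases c) (simp_all add: sc_def)
    qed
    have c: "c = 0"
    proof (rule ccontr)
      assume "c \<noteq> 0"
      hence "b3 = sc a b1 + sc b b2" using e d by (simp add: sc_def eq)
      thus False using b3 by (cases a; cases b) (simp_all add: sc_def)
    qed
    have b: "b = 0"
    proof (rule ccontr)
      assume "b \<noteq> 0"
      hence "b2 = sc a b1" using e d c by (simp add: sc_def eq)
      thus False using b2 by (cases a) (simp_all add: sc_def)
    qed
    have "a = 0" using e d c b b1 by (cases a) (simp_all add: sc_def)
    thus ?thesis using b c d by (simp add: H zero_h_def)
  qed
  have inj: "inj \<beta>"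
  proof (rule injI)
    fix x y assume "\<beta> x = \<beta> y"
    hence "\<beta> (x + y) = 0" by (simp add: add char2)
    hence "x + y = 0" by (rule ker)
    thus "x = y" by (metis add.right_neutral h_left add.commute)
  qed
  have "(UNIV :: h set) = set [c0, c1, c2, c3, c4, c5, c6, c7, c8, c9, c10, c11, c12, c13, c14, c15]" using
    all_h by blast
  also have "card \<dots> = 16" by (simp add: c_defs)
  finally have "CARD(h) = 16" .
  hence "\<beta> ` UNIV = UNIV" by (intro card_subset_eq) (simp_all add: card_image[OF inj] card_letters)
  thus ?thesis using inj add by (intro exI[of _ \<beta>]) (simp add: bij_def)
qed

theorem no_code:
  fixes L :: "('v ^ 'n::finite) set"
  assumes L: "additive L" and card_L: "card L = 4096" and n7: "CARD('n) = 7"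
    and orth: "\<And>u v. u \<in> L \<Longrightarrow> v \<in> L \<Longrightarrow> pair u v = 0"
    and low: "\<And>w. (\<And>u. u \<in> L \<Longrightarrow> pair u w = 0) \<Longrightarrow> card {j. w $ j \<noteq> 0} \<le> 3 \<Longrightarrow> w \<in> L"
  shows False
proof -
  note zero3 = zero_of_three_zeros[OF L card_L n7 orth low]
  note ex3 = three_letters_exist[OF L card_L n7 orth low]
  have L0: "0 \<in> L" and Ladd: "\<And>u v. u \<in> L \<Longrightarrow> v \<in> L \<Longrightarrow> u + v \<in> L" using L by (simp_all add: additive_def)
  obtain e where e: "bij_betw e {0..<7::nat} (UNIV :: 'n set)" using ex_bij_betw_nat_finite[of "UNIV :: 'n set"]
    n7 by auto
  have einj: "e i = e j \<longleftrightarrow> i = j" if "i < 7" "j < 7" for i j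
    using e that by (auto simp: bij_betw_def inj_on_def)
  define p1 p2 where "p1 = e 0" and "p2 = e 1"
  define t where "t j = (case j of IA \<Rightarrow> e 2 | IB \<Rightarrow> e 3 | IC \<Rightarrow> e 4 | ID \<Rightarrow> e 5 | IE \<Rightarrow> e 6)" for j
  have p12: "p1 \<noteq> p2" by (simp add: p1_def p2_def einj)
  have tp: "t j \<noteq> p1" "t j \<noteq> p2" "p1 \<noteq> t j" "p2 \<noteq> t j" for j by (cases j; simp add: t_def p1_def p2_def einj)+
  have tinj: "t i = t j \<longleftrightarrow> i = j" for i j by (cases i; cases j) (simp_all add: t_def einj)
  have U: "(UNIV :: 'n set) = insert p1 (insert p2 (t ` UNIV))"
  proof -
    have "(UNIV :: 'n set) = e ` {0..<7}" using e by (simp add: bij_betw_def)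
    also have "{0..<7::nat} = {0, 1, 2, 3, 4, 5, 6}" by auto
    finally show ?thesis by (simp add: UNIV_i5 t_def p1_def p2_def)
  qed
  have pair5: "pair u v = s (u $ p1) (v $ p1) + (s (u $ p2) (v $ p2) + (\<Sum>j\<in>UNIV. s (u $ t j) (v $ t j)))" for u
    v :: "'v ^ 'n"
  proof -
    have "p1 \<notin> insert p2 (t ` UNIV)" "p2 \<notin> t ` UNIV" using p12 tp by auto
    moreover have "inj t" using tinj by (simp add: inj_def)
    ultimately show ?thesis unfolding pair_def U by (simp add: sum.reindex)
  qed
  \<comment> \<open>Sixteen words, one for each letter at any of the other five positions; they
    become the constant words.\<close>
  define K where "K = {u \<in> L. u $ p1 = 0 \<and> u $ p2 = 0}"
  have Kadd: "u + v \<in> K" if "u \<in> K" "v \<in> K" for u v using that Ladd by (simp add: K_def)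
  have Keq: "u = v" if "u \<in> K" "v \<in> K" "u $ t j = v $ t j" for u v j
  proof -
    have "u + v = 0" using Kadd[OF that(1,2)] that(3) p12 tp by (intro zero3[of _ p1 p2 "t j"]) (auto simp:
      K_def char2)
    thus ?thesis by (metis add_left_cancel word_char2)
  qed
  obtain \<beta> :: "h \<Rightarrow> 'v" where \<beta>: "bij \<beta>" "\<And>x y. \<beta> (x + y) = \<beta> x + \<beta> y" using coordinates by blast
  define \<kappa> where "\<kappa> x = (SOME u. u \<in> K \<and> u $ t IA = \<beta> x)" for x
  have \<kappa>: "\<kappa> x \<in> K \<and> \<kappa> x $ t IA = \<beta> x" for x
  proof -
    obtain u where "u \<in> L" "u $ p1 = 0" "u $ p2 = 0" "u $ t IA = \<beta> x" using ex3[of p1 p2 "t IA"] p12 tp by blast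
    hence "u \<in> K \<and> u $ t IA = \<beta> x" by (simp add: K_def)
    thus ?thesis unfolding \<kappa>_def by (rule someI)
  qed
  have \<kappa>L: "\<kappa> x \<in> L" "\<kappa> x $ p1 = 0" "\<kappa> x $ p2 = 0" for x using \<kappa>[of x] by (simp_all add: K_def)
  have \<kappa>add: "\<kappa> (x + y) = \<kappa> x + \<kappa> y" for x y
    by (rule Keq[of _ _ IA]) (use \<kappa> Kadd \<beta>(2) in simp_all)
  define \<psi> where "\<psi> j x = \<kappa> x $ t j" for j x
  have \<psi>add: "\<psi> j (x + y) = \<psi> j x + \<psi> j y" for j x y by (simp add: \<psi>_def \<kappa>add)
  have \<psi>bij: "bij (\<psi> j)" for j
  proof -
    have \<beta>i: "\<beta> x = \<beta> y \<longleftrightarrow> x = y" for x y using \<beta>(1) by (metis bij_def inj_eq)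
    have "x = y" if "\<psi> j x = \<psi> j y" for x y
      using Keq[of "\<kappa> x" "\<kappa> y" j] that \<kappa> \<beta>i unfolding \<psi>_def by metis
    hence "inj (\<psi> j)" by (rule injI)
    moreover have "CARD(h) = CARD('v)" using bij_betw_same_card[OF \<beta>(1)] .
    ultimately have "\<psi> j ` UNIV = UNIV" by (intro card_subset_eq) (simp_all add: card_image)
    thus ?thesis using \<open>inj (\<psi> j)\<close> by (simp add: bij_def)
  qed
  have "\<exists>f. \<forall>x y. fev f x y = s (\<psi> j x) (\<psi> j y)" for j
  proof (rule form_code[of "\<lambda>x y. s (\<psi> j x) (\<psi> j y)"])
    show "s (\<psi> j (x + y)) (\<psi> j z) = s (\<psi> j x) (\<psi> j z) + s (\<psi> j y) (\<psi> j z)" for x y z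
      by (simp only: \<psi>add s_add)
    show "s (\<psi> j x) (\<psi> j y) = s (\<psi> j y) (\<psi> j x)" for x y by (rule s_commute)
    show "s (\<psi> j x) (\<psi> j x) = 0" for x by (rule s_self)
    show "\<exists>f. \<forall>x y. fev f x y = s (\<psi> j x) (\<psi> j y)" if "\<And>x y. fev f x y = s (\<psi> j x) (\<psi> j y)" for f
      using that by blast
  qed
  then obtain f where f: "\<And>j x y. fev (f j) x y = s (\<psi> j x) (\<psi> j y)" by metis
  define F where "F = Codes (f IA) (f IB) (f IC) (f ID) (f IE)"
  have cF: "cod F j = f j" for j by (cases j) (simp_all add: F_def)
  define wd where "wd u j = inv_into UNIV (\<psi> j) (u $ t j)" for u :: "'v ^ 'n" and j
  have \<psi>wd: "\<psi> j (wd u j) = u $ t j" for u j using \<psi>bij[of j] by (simp add: wd_def bij_def surj_f_inv_f)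
  have wdI: "wd u j = x" if "u $ t j = \<psi> j x" for u j x using that \<psi>bij[of j] by (simp add: wd_def bij_def)
  have wd_add: "wd (u + v) = (\<lambda>j. wd u j + wd v j)" for u v
    by (rule ext, rule wdI) (simp add: \<psi>add \<psi>wd)
  have wd\<kappa>: "wd (\<kappa> x) = (\<lambda>_. x)" for x by (rule ext, rule wdI) (simp add: \<psi>_def)
  have wdK: "wd u = (\<lambda>_. wd u IA) \<and> u = \<kappa> (wd u IA)" if "u \<in> K" for u
  proof -
    have "u = \<kappa> (wd u IA)" by (rule Keq[OF that, of _ IA]) (use \<kappa> \<psi>wd[of IA u] in \<open>simp_all add: \<psi>_def\<close>)
    thus ?thesis using wd\<kappa> by metis
  qed
  have gram: "gram F (wd u) (wd v) = (\<Sum>j\<in>UNIV. s (u $ t j) (v $ t j))" for u v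
    by (simp only: gram_def cF f \<psi>wd)
  have pairg: "pair u v = s (u $ p1) (v $ p1) + (s (u $ p2) (v $ p2) + gram F (wd u) (wd v))" for u v
    by (simp only: pair5 gram)
  have s0: "s 0 y = 0" "s y 0 = 0" for y by (simp_all add: s_zero s_commute[of y])
  \<comment> \<open>The MDS property in the form used below: a word of \<open>L\<close> agreeing
    with \<open>\<kappa> x\<close> at three positions equals it.\<close>
  have K3: "u = \<kappa> x" if "u \<in> L" "(u + \<kappa> x) $ i = 0" "(u + \<kappa> x) $ j = 0" "(u + \<kappa> x) $ k = 0" "i \<noteq> j" "i \<noteq> k" "j \<noteq> k"
    for u x i j k
  proof -
    have "u + \<kappa> x = 0" using that Ladd \<kappa>L(1) by (intro zero3[of _ i j k]) auto
    thus ?thesis by (metis add_right_cancel word_char2)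
  qed
  have z\<kappa>: "(u + \<kappa> x) $ t j = 0 \<longleftrightarrow> wd u j = x" for u x j
  proof -
    have "(u + \<kappa> x) $ t j = \<psi> j (wd u j + x)" by (simp add: \<psi>add \<psi>wd) (simp add: \<psi>_def)
    moreover have "\<psi> j 0 = 0" using \<psi>add[of j 0 0] by simp
    ultimately have "(u + \<kappa> x) $ t j = 0 \<longleftrightarrow> wd u j + x = 0" using \<psi>bij[of j] by (metis bij_def injD)
    thus ?thesis by (metis add.right_neutral h_char2 h_left)
  qed
  \<comment> \<open>Both orders of the two positions are treated at once: the words vanish at
    \<open>q\<close>, and \<open>p\<close> is the position whose form yields the
    nondegeneracy.\<close>
  have half: "half F (wd ` {u \<in> L. u $ q = 0})" if q: "p = p1 \<and> q = p2 \<or> p = p2 \<and> q = p1" for p q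
  proof -
    have qt: "p \<noteq> q" "q \<noteq> p" "t j \<noteq> q" "q \<noteq> t j" "p \<noteq> t j" for j using q p12 tp by auto
    have pq: "pair u v = s (u $ p) (v $ p) + (s (u $ q) (v $ q) + gram F (wd u) (wd v))" for u v
      using q by (auto simp: pairg add_ac)
    have \<kappa>pq: "\<kappa> x $ p = 0" "\<kappa> x $ q = 0" for x using q \<kappa>L by auto
    show ?thesis unfolding half_def
    proof (intro conjI ballI allI impI)
      fix u v assume "u \<in> wd ` {u \<in> L. u $ q = 0}" "v \<in> wd ` {u \<in> L. u $ q = 0}"
      then obtain u' v' where "u = wd u'" "v = wd v'" "u' + v' \<in> {u \<in> L. u $ q = 0}" using Ladd by auto
      thus "(\<lambda>j. u j + v j) \<in> wd ` {u \<in> L. u $ q = 0}" by (auto simp: wd_add[symmetric])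
    next
      fix x show "(\<lambda>_. x) \<in> wd ` {u \<in> L. u $ q = 0}"
        by (rule image_eqI[of _ _ "\<kappa> x"]) (simp_all add: wd\<kappa> \<kappa>L \<kappa>pq)
    next
      fix u x assume "u \<in> wd ` {u \<in> L. u $ q = 0}"
      then obtain u' where u: "u = wd u'" "u' \<in> L" by auto
      have "pair u' (\<kappa> x) = gram F u (\<lambda>_. x)" by (simp add: pq \<kappa>pq s0 u wd\<kappa>)
      thus "gram F u (\<lambda>_. x) = 0" using orth[OF u(2) \<kappa>L(1)] by metis
    next
      fix u i j k assume "u \<in> wd ` {u \<in> L. u $ q = 0}" and ij: "i \<noteq> j" "u i = u j"
      then obtain u' where u: "u = wd u'" "u' \<in> L" "u' $ q = 0" by auto
      \<comment> \<open>Both words vanish at \<open>q\<close>, and they agree at the two positions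
        with equal transported letters.\<close>
      have "u' = \<kappa> (u i)"
      proof (rule K3[OF u(2), of _ q "t i" "t j"])
        show "(u' + \<kappa> (u i)) $ q = 0" by (simp add: u \<kappa>pq)
        show "(u' + \<kappa> (u i)) $ t i = 0" by (simp only: z\<kappa> u)
        show "(u' + \<kappa> (u i)) $ t j = 0" using ij(2) by (simp only: z\<kappa> u)
      qed (simp_all add: qt tinj ij)
      hence "u = (\<lambda>_. u i)" using wd\<kappa> u(1) by metis
      thus "u k = u i" by metis
    next
      fix i j :: i5 and e assume "i \<noteq> j"
      then obtain u where "u \<in> L" "u $ q = 0" "u $ t i = \<psi> i 0" "u $ t j = \<psi> j e"
        using ex3[of q "t i" "t j"] qt tinj by metis
      thus "\<exists>u\<in>wd ` {u \<in> L. u $ q = 0}. u i = 0 \<and> u j = e"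
        by (intro bexI[of _ "wd u"]) (auto intro: wdI)
    next
      fix u assume "u \<in> wd ` {u \<in> L. u $ q = 0}" and ne: "\<exists>i j. u i \<noteq> u j"
      then obtain u' where u: "u = wd u'" "u' \<in> L" "u' $ q = 0" by auto
      have "u' $ p \<noteq> 0"
      proof
        assume "u' $ p = 0"
        hence "u' \<in> K" using u q by (auto simp: K_def)
        thus False using wdK u(1) ne by metis
      qed
      then obtain y where y: "s (u' $ p) y = 1" using s_nondeg by blast
      obtain v where v: "v \<in> L" "v $ p = y" "v $ q = 0" using ex3[of p q "t IA"] qt by metis
      \<comment> \<open>Orthogonality in \<open>L\<close> transfers the value 1 of the form at
        \<open>p\<close> to \<open>gram\<close> on the five positions.\<close>
      have "pair u' v = 1 + gram F u (wd v)" by (simp only: pq u v y s0 add_0)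
      hence "1 + gram F u (wd v) = 0" using orth[OF u(2) v(1)] by simp
      hence "gram F u (wd v) = 1" by (cases "gram F u (wd v)") simp_all
      thus "\<exists>v\<in>wd ` {u \<in> L. u $ q = 0}. gram F u v = 1" using v by blast
    qed
  qed
  have "conf F (wd ` {u \<in> L. u $ p2 = 0}) (wd ` {u \<in> L. u $ p1 = 0})"
    unfolding conf_def
  proof (intro conjI ballI allI impI)
    fix j show "pfc (cod F j) = 1"
    proof (rule pfc_nondeg)
      fix x assume z: "\<And>y. fev (cod F j) x y = 0"
      have "\<psi> j x = 0"
      proof (rule ccontr)
        assume "\<psi> j x \<noteq> 0"
        then obtain y where "s (\<psi> j x) y = 1" using s_nondeg by blast
        moreover obtain y' where "y = \<psi> j y'" using \<psi>bij[of j] by (metis bij_def surjD)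
        ultimately show False using z[of y'] by (simp add: cF f)
      qed
      moreover have "\<psi> j 0 = 0" using \<psi>add[of j 0 0] by simp
      ultimately show "x = 0" using \<psi>bij[of j] by (metis bij_def injD)
    qed
  next
    fix x y
    have "pair (\<kappa> x) (\<kappa> y) = gram F (\<lambda>_. x) (\<lambda>_. y)" by (simp add: pairg \<kappa>L s0 wd\<kappa>)
    thus "gram F (\<lambda>_. x) (\<lambda>_. y) = 0" using orth[OF \<kappa>L(1) \<kappa>L(1)] by metis
  next
    show "half F (wd ` {u \<in> L. u $ p2 = 0})" by (rule half[of p1]) simp
    show "half F (wd ` {u \<in> L. u $ p1 = 0})" by (rule half[of p2]) simp
  next
    fix y x assume "y \<in> wd ` {u \<in> L. u $ p2 = 0}" "x \<in> wd ` {u \<in> L. u $ p1 = 0}"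
    then obtain u v where uv: "y = wd u" "u \<in> L" "u $ p2 = 0" "x = wd v" "v \<in> L" "v $ p1 = 0" by auto
    have "pair u v = gram F y x" by (simp add: pairg uv s0)
    thus "gram F y x = 0" using orth[OF uv(2,5)] by metis
  next
    fix y x i j k l
    assume "y \<in> wd ` {u \<in> L. u $ p2 = 0}" "x \<in> wd ` {u \<in> L. u $ p1 = 0}" and ijk: "i \<noteq> j" "i \<noteq> k" "j \<noteq> k"
      and eq: "y i + x i = y j + x j" "y i + x i = y k + x k"
    then obtain u v where uv: "y = wd u" "u \<in> L" "u $ p2 = 0" "x = wd v" "v \<in> L" "v $ p1 = 0" by auto
    define c where "c = wd (u + v) i"
    have "wd (u + v) i = c" "wd (u + v) j = c" "wd (u + v) k = c" using eq by (simp_all add: c_def wd_add uv)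
    hence w: "u + v = \<kappa> c"
      by (intro K3[of _ _ "t i" "t j" "t k"]) (simp_all only: z\<kappa> tinj ijk not_False_eq_True Ladd uv)
    \<comment> \<open>Being equal to \<open>\<kappa> c\<close>, the sum vanishes at both singled out
      positions; each summand vanishes at one of them, hence at both.\<close>
    have "u $ p1 = (u + v) $ p1" "v $ p2 = (u + v) $ p2" by (simp_all add: uv)
    hence "u \<in> K" "v \<in> K" using uv by (simp_all add: w K_def \<kappa>L)
    hence "wd u = (\<lambda>_. wd u IA)" "wd v = (\<lambda>_. wd v IA)" using wdK by blast+
    thus "x l = x i" "y l = y i" unfolding uv by metis+
  qed
  thus False using no_conf by blast
qed

end

text \<open>Nondegeneracy: dividing an element of nonzero trace by a nonzero component of
  \<open>x\<close> gives a letter on which the form takes the value 1.\<close>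

lemma symplectic_letters_sympl:
  assumes card4: "CARD('f::{field,finite}) = 4"
  shows "symplectic_letters (sympl :: 'f \<times> 'f \<Rightarrow> 'f \<times> 'f \<Rightarrow> bit)"
proof
  note self = add_self[OF card4] and tr0 = tr_def[of "0 :: 'f", simplified]
  define tb where "tb x = (if tr x = 0 then 0 else 1 :: bit)" for x :: 'f
  have tb: "tb (x + y) = tb x + tb y" for x y
    using tr_cases[OF card4, of x] tr_cases[OF card4, of y] by (auto simp: tb_def tr_add[OF card4] self)
  have sy: "sympl (a, b) (a', b') = tb (b * a' + b' * a)" for a b a' b' by (simp add: tb_def)
  fix x y z :: "'f \<times> 'f"
  obtain a b a' b' a'' b'' where xyz: "x = (a, b)" "y = (a', b')" "z = (a'', b'')" by (cases x; cases y; cases z)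
  show "sympl (x + y) z = sympl x z + sympl y z"
    unfolding xyz add_Pair sy tb[symmetric] by (simp add: algebra_simps)
  show "sympl x y = sympl y x" unfolding xyz sy by (simp add: add.commute)
  show "sympl x x = 0" unfolding xyz sy by (simp add: self tb_def tr0)
  show "x + x = 0" by (simp add: xyz self zero_prod_def)
  show "CARD('f \<times> 'f) = 16" by (simp add: card4)
  assume "x \<noteq> 0"
  obtain r :: 'f where r: "tr r \<noteq> 0" using tr_nontrivial[OF card4] by blast
  show "\<exists>y. sympl x y = 1"
  proof (cases "a = 0")
    case True
    hence "b \<noteq> 0" using \<open>x \<noteq> 0\<close> by (simp add: xyz zero_prod_def)
    thus ?thesis using r by (intro exI[of _ "(r / b, 0)"]) (simp add: xyz)
  next
    case False
    thus ?thesis using r by (intro exI[of _ "(0, r / a)"]) (simp add: xyz)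
  qed
qed

theorem mainTheorem2:
  assumes "CARD('f::{field,finite}) = 4"
  shows "\<not> (\<exists>Q :: ('f, 'n::finite) state set. is_stabiliser_code Q 7 1 4)"
proof
  assume "\<exists>Q :: ('f, 'n) state set. is_stabiliser_code Q 7 1 4"
  then obtain Q :: "('f, 'n) state set" where Q: "is_stabiliser_code Q 7 1 4" by blast
  interpret symplectic_letters "sympl :: 'f \<times> 'f \<Rightarrow> 'f \<times> 'f \<Rightarrow> bit"
    by (rule symplectic_letters_sympl[OF assms])
  have n7: "CARD('n) = 7" using Q by (simp add: is_stabiliser_code_def)
  show False
  proof (rule stabiliser_words[OF assms Q])
    fix L :: "(('f \<times> 'f) ^ 'n) set"
    assume L: "0 \<in> L" "\<And>u v. u \<in> L \<Longrightarrow> v \<in> L \<Longrightarrow> u + v \<in> L" "card L = 4096"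
      "\<And>u v. u \<in> L \<Longrightarrow> v \<in> L \<Longrightarrow> (\<Sum>j\<in>UNIV. sympl (u $ j) (v $ j)) = 0"
      "\<And>w. (\<And>u. u \<in> L \<Longrightarrow> (\<Sum>j\<in>UNIV. sympl (u $ j) (w $ j)) = 0) \<Longrightarrow> card {j. w $ j \<noteq> 0} \<le> 3 \<Longrightarrow> w \<in> L"
    have "additive L" using L(1,2) by (simp add: additive_def)
    thus False by (rule no_code[OF _ L(3) n7]) (unfold pair_def, fact L(4), rule L(5))
  qed
qed

end
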